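(* Let $k$ be a field and let $S=k[X_1,\dots,X_n,Y_1,\dots,Y_r]$ be the polynomial ring bigraded by $\deg X_i=(1,0)$, $\deg Y_j=(d_j,1)$ with integers $d_1,\dots,d_r\ge0$; set $d=\max\{d_1,\dots,d_r\}$. Let $L$ be a finitely generated bigraded $S$-module. Then there exists an integer $\alpha$ such that $$a_*(L^e)\le de+\alpha\quad\text{for all } e.$$
   Context: For $e\in\mathbb Z$, $L^e=\bigoplus_{i\in\mathbb Z}L_{(i,e)}$, a finitely generated graded module over $S_1=k[X_1,\dots,X_n]$ (standard grading) with homogeneous maximal ideal $\mathfrak m_1=(X_1,\dots,X_n)$. For a finitely generated graded $S_1$-module $N$, $a_i(N)=\max\{j\mid H^i_{\mathfrak m_1}(N)_j\neq0\}$ if $H^i_{\mathfrak m_1}(N)\ne 0$ and $-\infty$ otherwise, and $a_*(N)=\max_i a_i(N)$. *)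

theory Defs
  imports
    "HOL-Algebra.Module"
    "HOL-Algebra.AbelCoset"
    "HOL-Algebra.Product_Groups"
    "HOL-Library.Poly_Mapping"
    "HOL-Library.Product_Plus"
    "HOL-Library.Extended_Real"
begin

section \<open>Multigraded polynomial rings\<close>

text \<open>A monomial is a finitely supported exponent vector and a polynomial a finitely supported
  family of coefficients; the product of \<^typ>\<open>('v \<Rightarrow>\<^sub>0 nat) \<Rightarrow>\<^sub>0 'k::semiring_0\<close> is then polynomial
  multiplication.\<close>

type_synonym ('v, 'k) mpoly = "('v \<Rightarrow>\<^sub>0 nat) \<Rightarrow>\<^sub>0 'k"

definition mpoly_ring :: "'v set \<Rightarrow> ('v, 'k::comm_ring_1) mpoly ring" where
  "mpoly_ring V =
    \<lparr>carrier = {p. \<forall>m\<in>Poly_Mapping.keys p. Poly_Mapping.keys m \<subseteq> V},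
     mult = (*), one = 1, zero = 0, add = (+)\<rparr>"

definition mpoly_var :: "'v \<Rightarrow> ('v, 'k::comm_ring_1) mpoly" where
  "mpoly_var v = Poly_Mapping.single (Poly_Mapping.single v 1) 1"

text \<open>The inner sum is the multiple of the weight \<^term>\<open>w v\<close> by the exponent of \<^term>\<open>v\<close>.\<close>

definition monomial_degree :: "('v \<Rightarrow> 'g::comm_monoid_add) \<Rightarrow> ('v \<Rightarrow>\<^sub>0 nat) \<Rightarrow> 'g" where
  "monomial_degree w m =
    (\<Sum>v\<in>Poly_Mapping.keys m. \<Sum>k<Poly_Mapping.lookup m v. w v)"

definition mpoly_component ::
  "'v set \<Rightarrow> ('v \<Rightarrow> 'g::comm_monoid_add) \<Rightarrow> 'g \<Rightarrow> ('v, 'k::comm_ring_1) mpoly set" where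
  "mpoly_component V w g =
    {p \<in> carrier (mpoly_ring V). \<forall>m\<in>Poly_Mapping.keys p. monomial_degree w m = g}"


section \<open>Graded and finitely generated modules\<close>

definition graded_module ::
  "('a, 'x) ring_scheme \<Rightarrow> ('g::ab_group_add \<Rightarrow> 'a set) \<Rightarrow>
   ('a, 'm, 'y) module_scheme \<Rightarrow> ('g \<Rightarrow> 'm set) \<Rightarrow> bool" where
  "graded_module R Rgr M Mgr \<longleftrightarrow>
    Module.module R M \<and>
    (\<forall>g. additive_subgroup (Mgr g) M) \<and>
    (\<forall>x\<in>carrier M. \<exists>!f. (\<forall>g. f g \<in> Mgr g) \<and> finite {g. f g \<noteq> \<zero>\<^bsub>M\<^esub>} \<and>
        x = (\<Oplus>\<^bsub>M\<^esub>g\<in>{g. f g \<noteq> \<zero>\<^bsub>M\<^esub>}. f g)) \<and>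
    (\<forall>g h. \<forall>a\<in>Rgr g. \<forall>x\<in>Mgr h. a \<odot>\<^bsub>M\<^esub> x \<in> Mgr (g + h))"

definition finitely_generated ::
  "('a, 'x) ring_scheme \<Rightarrow> ('a, 'm, 'y) module_scheme \<Rightarrow> bool" where
  "finitely_generated R M \<longleftrightarrow>
    (\<exists>B. finite B \<and> B \<subseteq> carrier M \<and>
      (\<forall>x\<in>carrier M. \<exists>c \<in> B \<rightarrow> carrier R. x = (\<Oplus>\<^bsub>M\<^esub>b\<in>B. c b \<odot>\<^bsub>M\<^esub> b)))"


section \<open>Localization of a module at the powers of a ring element\<close>

definition mfrac_rel ::
  "('a, 'x) ring_scheme \<Rightarrow> ('a, 'm, 'y) module_scheme \<Rightarrow> 'a \<Rightarrow> (('m \<times> nat) \<times> ('m \<times> nat)) set" where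
  "mfrac_rel R M f =
    {((x, s), (y, t)). x \<in> carrier M \<and> y \<in> carrier M \<and>
      (\<exists>u::nat. (f [^]\<^bsub>R\<^esub> (u + t)) \<odot>\<^bsub>M\<^esub> x = (f [^]\<^bsub>R\<^esub> (u + s)) \<odot>\<^bsub>M\<^esub> y)}"

text \<open>\<open>mfrac R M f x s\<close> is the fraction with numerator \<^term>\<open>x\<close> and denominator the
  \<^term>\<open>s\<close>-th power of \<^term>\<open>f\<close>.\<close>

definition mfrac ::
  "('a, 'x) ring_scheme \<Rightarrow> ('a, 'm, 'y) module_scheme \<Rightarrow> 'a \<Rightarrow> 'm \<Rightarrow> nat \<Rightarrow> ('m \<times> nat) set" where
  "mfrac R M f x s = mfrac_rel R M f `` {(x, s)}"

text \<open>The unions below range over the representatives of a class. The multiplication and unit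
  fields of a module record carry no meaning.\<close>

definition localization ::
  "('a, 'x) ring_scheme \<Rightarrow> ('a, 'm, 'y) module_scheme \<Rightarrow> 'a \<Rightarrow> ('a, ('m \<times> nat) set) module" where
  "localization R M f =
    \<lparr>carrier = (carrier M \<times> UNIV) // mfrac_rel R M f,
     mult = undefined,
     one = undefined,
     zero = mfrac R M f \<zero>\<^bsub>M\<^esub> 0,
     add = (\<lambda>A B. \<Union>(x, s)\<in>A. \<Union>(y, t)\<in>B.
       mfrac R M f ((f [^]\<^bsub>R\<^esub> t) \<odot>\<^bsub>M\<^esub> x \<oplus>\<^bsub>M\<^esub> (f [^]\<^bsub>R\<^esub> s) \<odot>\<^bsub>M\<^esub> y) (s + t)),
     smult = (\<lambda>a A. \<Union>(x, s)\<in>A. mfrac R M f (a \<odot>\<^bsub>M\<^esub> x) s)\<rparr>"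

text \<open>Homogeneous elements of degree \<^term>\<open>j\<close>, when \<^term>\<open>f\<close> is homogeneous of degree
  \<^term>\<open>\<delta>\<close>.\<close>

definition localization_component ::
  "('a, 'x) ring_scheme \<Rightarrow> ('a, 'm, 'y) module_scheme \<Rightarrow> (int \<Rightarrow> 'm set) \<Rightarrow> 'a \<Rightarrow> int \<Rightarrow> int \<Rightarrow>
   ('m \<times> nat) set set" where
  "localization_component R M Mgr f \<delta> j =
    {mfrac R M f x s | x s. x \<in> Mgr (j + int s * \<delta>)}"

text \<open>The canonical map from the localization at \<^term>\<open>f\<close> to the localization at the product of
  \<^term>\<open>f\<close> and \<^term>\<open>g\<close>.\<close>

definition localization_map ::
  "('a, 'x) ring_scheme \<Rightarrow> ('a, 'm, 'y) module_scheme \<Rightarrow> 'a \<Rightarrow> 'a \<Rightarrow> ('m \<times> nat) set \<Rightarrow> ('m \<times> nat) set"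
  where
  "localization_map R M f g A =
    (\<Union>(x, s)\<in>A. mfrac R M (f \<otimes>\<^bsub>R\<^esub> g) ((g [^]\<^bsub>R\<^esub> s) \<odot>\<^bsub>M\<^esub> x) s)"


section \<open>Local cohomology\<close>

text \<open>Local cohomology with support in the ideal generated by \<open>x\<^sub>1, \<dots>, x\<^sub>n\<close> is the cohomology of the
  Cech complex \<open>C\<^sup>i = \<Oplus> M\<^bsub>x\<^sub>I\<^esub>\<close>, where \<open>I\<close> ranges over the \<open>i\<close>-element subsets of \<open>{1..n}\<close> and \<open>x\<^sub>I\<close> is
  the product of the \<open>x\<^sub>l\<close> with \<open>l\<close> in \<open>I\<close>.\<close>

definition subsets_of_card :: "nat \<Rightarrow> nat \<Rightarrow> nat set set" where
  "subsets_of_card n i = {I. I \<subseteq> {1..n} \<and> card I = i}"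

definition cech_module ::
  "('a, 'x) ring_scheme \<Rightarrow> ('a, 'm, 'y) module_scheme \<Rightarrow> (nat \<Rightarrow> 'a) \<Rightarrow> nat set \<Rightarrow>
   ('a, ('m \<times> nat) set) module" where
  "cech_module R M x I = localization R M (\<Otimes>\<^bsub>R\<^esub>l\<in>I. x l)"

definition cech_cochains ::
  "('a, 'x) ring_scheme \<Rightarrow> ('a, 'm, 'y) module_scheme \<Rightarrow> (nat \<Rightarrow> 'a) \<Rightarrow> nat \<Rightarrow> nat \<Rightarrow>
   (nat set \<Rightarrow> ('m \<times> nat) set) monoid" where
  "cech_cochains R M x n i =
    product_group (subsets_of_card n i) (\<lambda>I. add_monoid (cech_module R M x I))"

definition cech_differential ::
  "('a, 'x) ring_scheme \<Rightarrow> ('a, 'm, 'y) module_scheme \<Rightarrow> (nat \<Rightarrow> 'a) \<Rightarrow> nat \<Rightarrow> nat \<Rightarrow>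
   (nat set \<Rightarrow> ('m \<times> nat) set) \<Rightarrow> nat set \<Rightarrow> ('m \<times> nat) set" where
  "cech_differential R M x n i c =
    (\<lambda>J\<in>subsets_of_card n (Suc i).
      \<Oplus>\<^bsub>cech_module R M x J\<^esub>l\<in>J.
        (let y = localization_map R M (\<Otimes>\<^bsub>R\<^esub>m\<in>J - {l}. x m) (x l) (c (J - {l}))
         in if even (card {m \<in> J. m < l}) then y else \<ominus>\<^bsub>cech_module R M x J\<^esub> y))"

definition cech_cocycles ::
  "('a, 'x) ring_scheme \<Rightarrow> ('a, 'm, 'y) module_scheme \<Rightarrow> (nat \<Rightarrow> 'a) \<Rightarrow> nat \<Rightarrow> nat \<Rightarrow>
   (nat set \<Rightarrow> ('m \<times> nat) set) set" where
  "cech_cocycles R M x n i =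
    kernel (cech_cochains R M x n i) (cech_cochains R M x n (Suc i)) (cech_differential R M x n i)"

definition cech_coboundaries ::
  "('a, 'x) ring_scheme \<Rightarrow> ('a, 'm, 'y) module_scheme \<Rightarrow> (nat \<Rightarrow> 'a) \<Rightarrow> nat \<Rightarrow> nat \<Rightarrow>
   (nat set \<Rightarrow> ('m \<times> nat) set) set" where
  "cech_coboundaries R M x n i =
    (case i of
      0 \<Rightarrow> {\<one>\<^bsub>cech_cochains R M x n 0\<^esub>}
    | Suc i' \<Rightarrow> cech_differential R M x n i' ` carrier (cech_cochains R M x n i'))"

definition cech_cohomology ::
  "('a, 'x) ring_scheme \<Rightarrow> ('a, 'm, 'y) module_scheme \<Rightarrow> (nat \<Rightarrow> 'a) \<Rightarrow> nat \<Rightarrow> nat \<Rightarrow>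
   (nat set \<Rightarrow> ('m \<times> nat) set) set monoid" where
  "cech_cohomology R M x n i =
    (cech_cochains R M x n i)\<lparr>carrier := cech_cocycles R M x n i\<rparr> Mod cech_coboundaries R M x n i"

text \<open>The degree \<open>j\<close> part of cohomology consists of the classes of homogeneous cocycles of degree
  \<open>j\<close>. All \<open>x\<^sub>l\<close> are taken to have degree 1, so that \<open>x\<^sub>I\<close> has degree \<open>card I\<close>.\<close>

definition cech_cohomology_component ::
  "('a, 'x) ring_scheme \<Rightarrow> ('a, 'm, 'y) module_scheme \<Rightarrow> (int \<Rightarrow> 'm set) \<Rightarrow> (nat \<Rightarrow> 'a) \<Rightarrow> nat \<Rightarrow> nat \<Rightarrow>
   int \<Rightarrow> (nat set \<Rightarrow> ('m \<times> nat) set) set set" where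
  "cech_cohomology_component R M Mgr x n i j =
    {cech_coboundaries R M x n i #>\<^bsub>(cech_cochains R M x n i)\<lparr>carrier := cech_cocycles R M x n i\<rparr>\<^esub> z | z.
      z \<in> cech_cocycles R M x n i \<and>
      (\<forall>I\<in>subsets_of_card n i. z I \<in>
        localization_component R M Mgr (\<Otimes>\<^bsub>R\<^esub>l\<in>I. x l) (int (card I)) j)}"


section \<open>The bigraded polynomial ring and the \<open>a\<close>-invariants\<close>

text \<open>The variable \<open>X\<^sub>i\<close> is \<^term>\<open>Inl i\<close> and \<open>Y\<^sub>j\<close> is \<^term>\<open>Inr j\<close>, with indices starting at 1. The ring
  \<open>k[X\<^sub>1, \<dots>, X\<^sub>n]\<close> is a subring of \<open>k[X\<^sub>1, \<dots>, X\<^sub>n, Y\<^sub>1, \<dots>, Y\<^sub>r]\<close>, so that modules over the latter are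
  modules over the former without any change of the scalar multiplication.\<close>

type_synonym 'k xypoly = "(nat + nat, 'k) mpoly"

definition X_vars :: "nat \<Rightarrow> (nat + nat) set" where
  "X_vars n = Inl ` {1..n}"

definition XY_vars :: "nat \<Rightarrow> nat \<Rightarrow> (nat + nat) set" where
  "XY_vars n r = Inl ` {1..n} \<union> Inr ` {1..r}"

definition X_ring :: "nat \<Rightarrow> 'k::field xypoly ring" where
  "X_ring n = mpoly_ring (X_vars n)"

definition XY_ring :: "nat \<Rightarrow> nat \<Rightarrow> 'k::field xypoly ring" where
  "XY_ring n r = mpoly_ring (XY_vars n r)"

definition bidegree :: "(nat \<Rightarrow> nat) \<Rightarrow> nat + nat \<Rightarrow> int \<times> int" where
  "bidegree d v = (case v of Inl i \<Rightarrow> (1, 0) | Inr j \<Rightarrow> (int (d j), 1))"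

definition XY_component ::
  "nat \<Rightarrow> nat \<Rightarrow> (nat \<Rightarrow> nat) \<Rightarrow> int \<times> int \<Rightarrow> 'k::field xypoly set" where
  "XY_component n r d = mpoly_component (XY_vars n r) (bidegree d)"

text \<open>The module \<open>L\<^sup>e\<close>: its elements are the finite sums of elements of the \<open>L\<^bsub>(i,e)\<^esub>\<close>. Its degree
  \<open>i\<close> component is \<open>L\<^bsub>(i,e)\<^esub>\<close>.\<close>

definition slice :: "('a, 'm, 'y) module_scheme \<Rightarrow> (int \<times> int \<Rightarrow> 'm set) \<Rightarrow> int \<Rightarrow>
  ('a, 'm, 'y) module_scheme" where
  "slice L Lgr e =
    L\<lparr>carrier := {(\<Oplus>\<^bsub>L\<^esub>i\<in>A. f i) | f A. finite A \<and> (\<forall>i\<in>A. f i \<in> Lgr (i, e))}\<rparr>"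

definition slice_component :: "(int \<times> int \<Rightarrow> 'm set) \<Rightarrow> int \<Rightarrow> int \<Rightarrow> 'm set" where
  "slice_component Lgr e i = Lgr (i, e)"

text \<open>In the following, \<^term>\<open>N\<close> is a graded module over the standard graded ring \<^term>\<open>X_ring n\<close>
  with components \<^term>\<open>Ngr\<close>, and local cohomology is taken with respect to \<open>(X\<^sub>1, \<dots>, X\<^sub>n)\<close>.\<close>

definition local_cohomology ::
  "nat \<Rightarrow> ('k::field xypoly, 'm, 'y) module_scheme \<Rightarrow> nat \<Rightarrow>
   (nat set \<Rightarrow> ('m \<times> nat) set) set monoid" where
  "local_cohomology n N i = cech_cohomology (X_ring n) N (\<lambda>l. mpoly_var (Inl l)) n i"

definition local_cohomology_component ::
  "nat \<Rightarrow> ('k::field xypoly, 'm, 'y) module_scheme \<Rightarrow> (int \<Rightarrow> 'm set) \<Rightarrow> nat \<Rightarrow> int \<Rightarrow>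
   (nat set \<Rightarrow> ('m \<times> nat) set) set set" where
  "local_cohomology_component n N Ngr i j =
    cech_cohomology_component (X_ring n) N Ngr (\<lambda>l. mpoly_var (Inl l)) n i j"

text \<open>The supremum in \<^typ>\<open>ereal\<close> is the maximum if there is one, \<open>-\<infinity>\<close> if cohomology vanishes in
  all degrees, and \<open>\<infinity>\<close> if it is nonzero in arbitrarily large degrees, so that an upper bound also
  expresses that the maximum exists.\<close>

definition a_invariant ::
  "nat \<Rightarrow> ('k::field xypoly, 'm, 'y) module_scheme \<Rightarrow> (int \<Rightarrow> 'm set) \<Rightarrow> nat \<Rightarrow> ereal" where
  "a_invariant n N Ngr i =
    Sup {ereal (real_of_int j) | j.
      local_cohomology_component n N Ngr i j \<noteq> {\<one>\<^bsub>local_cohomology n N i\<^esub>}}"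

definition a_star ::
  "nat \<Rightarrow> ('k::field xypoly, 'm, 'y) module_scheme \<Rightarrow> (int \<Rightarrow> 'm set) \<Rightarrow> ereal" where
  "a_star n N Ngr = (SUP i. a_invariant n N Ngr i)"

end

theory Submission
  imports Defs "HOL-Algebra.Subrings"
begin

text \<open>The Koszul complex of \<open>X\<^sub>1, \<dots>, X\<^sub>n\<close> on \<open>L\<close> is a finite direct sum of copies of \<open>L\<close>, hence
    Noetherian
  over \<open>S\<close>, so its cocycles are generated by homogeneous cocycles whose bidegrees \<open>(p, e)\<close> satisfy
  \<open>p \<le> d e + \<alpha>\<close> for some \<open>\<alpha>\<close>. Multiplying by \<open>Y\<^sub>j\<close> preserves this inequality, so every homogeneous
      cocycle of
  a bidegree with \<open>p > d e + \<alpha>\<close> is a combination of multiples \<open>X\<^sub>l z\<close> of cocycles \<open>z\<close>, and these are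
  coboundaries. Thus Koszul cohomology of \<open>L\<^sup>e\<close> vanishes in degrees above \<open>d e + \<alpha>\<close>. The same bound
  holds for the powers \<open>X\<^sub>1\<^sup>s, \<dots>, X\<^sub>n\<^sup>s\<close>, because the cone of a composition of two maps is an
      extension of
  their cones. Finally, clearing denominators turns a Cech cocycle into a Koszul cocycle of
  \<open>X\<^sub>1\<^sup>s, \<dots>, X\<^sub>n\<^sup>s\<close> for large \<open>s\<close>.\<close>

section \<open>Modules over finitely generated algebras are Noetherian\<close>

text \<open>The constant has to serve all \<open>e\<close> at once. Therefore the Noetherian
  property is applied to \<open>L\<close> over the full ring, whose variables Y_j link the slices,
  and not to the single modules over k[X_1, ..., X_n]. Finitely many homogeneous generators of the
  cocycles are never extracted: the submodules generated by the homogeneous cocycles with p \<le> d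
  e + k increase with k, and \<alpha> is an index at which this chain is stationary. Cochains are
  families over all subsets of {1..n}, so one constant also covers every cohomological degree.

  Cech cochains have unbounded denominators, so the passage to powers must not worsen the bound.
  This is achieved by the normalisation of degrees: for X_1^s, ..., X_n^s the entry at I is placed
  in degree j + s |I|, which makes the differential homogeneous of degree 0. Splitting one factor
  X_l off a power then needs exactness at j and at j + 1 only, and both exceed the bound if j does.
  The comparison of cones is carried out with explicit cochains instead of long exact
  sequences.\<close>

inductive_set gen :: "('a, 'm, 'y) module_scheme \<Rightarrow> 'a set \<Rightarrow> 'm set \<Rightarrow> 'm set" 
  for M (structure) and C and B where
  gen_zero: "\<zero> \<in> gen M C B"
| gen_incl: "b \<in> B \<Longrightarrow> b \<in> gen M C B"
| gen_add: "x \<in> gen M C B \<Longrightarrow> y \<in> gen M C B \<Longrightarrow> x \<oplus> y \<in> gen M C B"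
| gen_smult: "a \<in> C \<Longrightarrow> x \<in> gen M C B \<Longrightarrow> a \<odot> x \<in> gen M C B"

text \<open>The scalar set \<open>C\<close> need not be closed under ring operations; later it
  consists of the constants and finitely many variables. Adjoining a variable is then a mere
  \<open>insert\<close>, which suits an induction over the variables, and no generated subring has
  to be formed.\<close>

definition stable :: "('a, 'm, 'y) module_scheme \<Rightarrow> 'a set \<Rightarrow> 'm set \<Rightarrow> bool" where
  "stable M C W \<longleftrightarrow> W \<subseteq> carrier M \<and> \<zero>\<^bsub>M\<^esub> \<in> W \<and> (\<forall>x\<in>W. \<forall>y\<in>W. x \<oplus>\<^bsub>M\<^esub> y \<in> W) \<and>
     (\<forall>a\<in>C. \<forall>x\<in>W. a \<odot>\<^bsub>M\<^esub> x \<in> W)"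

text \<open>The chain condition is relative to a subset \<open>N\<close>, because the inductions
  below compare a chain with the span of fewer generators or of fewer scalars inside the same
  ambient module.\<close>

definition noetherian_on :: "('a, 'm, 'y) module_scheme \<Rightarrow> 'a set \<Rightarrow> 'm set \<Rightarrow> bool" where
  "noetherian_on M C N \<longleftrightarrow>
    (\<forall>W::nat \<Rightarrow> 'm set. (\<forall>i. stable M C (W i) \<and> W i \<subseteq> N \<and> W i \<subseteq> W (Suc i)) \<longrightarrow>
      (\<exists>k. \<forall>i\<ge>k. W i = W k))"

lemma noetherian_onI:
  assumes "\<And>W::nat \<Rightarrow> 'm set. (\<And>i. stable M C (W i)) \<Longrightarrow> (\<And>i. W i \<subseteq> N) \<Longrightarrow>
    (\<And>i j. i \<le> j \<Longrightarrow> W i \<subseteq> W j) \<Longrightarrow> \<exists>k. \<forall>i\<ge>k. W i \<subseteq> W k"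
  shows "noetherian_on M C N"
  unfolding noetherian_on_def
proof (intro allI impI)
  fix W :: "nat \<Rightarrow> 'm set"
  assume W: "\<forall>i. stable M C (W i) \<and> W i \<subseteq> N \<and> W i \<subseteq> W (Suc i)"
  then have mono: "W i \<subseteq> W j" if "i \<le> j" for i j
    using that lift_Suc_mono_le[of W] by blast
  with assms[of W] W obtain k where "\<forall>i\<ge>k. W i \<subseteq> W k" by blast
  with mono show "\<exists>k. \<forall>i\<ge>k. W i = W k" by blast
qed

lemma noetherian_onD:
  assumes "noetherian_on M C N" "\<And>i. stable M C (W i)" "\<And>i. W i \<subseteq> N"
    "\<And>i j. i \<le> j \<Longrightarrow> W i \<subseteq> W j"
  obtains k where "\<And>i. k \<le> i \<Longrightarrow> W i = W (k::nat)"
proof -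
  have "\<forall>i. stable M C (W i) \<and> W i \<subseteq> N \<and> W i \<subseteq> W (Suc i)"
    using assms(2-4) by simp
  then show ?thesis
    using assms(1) that unfolding noetherian_on_def by blast
qed

lemma stableD:
  assumes "stable M C W"
  shows "W \<subseteq> carrier M" "x \<in> W \<Longrightarrow> x \<in> carrier M" "\<zero>\<^bsub>M\<^esub> \<in> W" "x \<in> W \<Longrightarrow> y \<in> W \<Longrightarrow> x \<oplus>\<^bsub>M\<^esub> y \<in> W"
    "a \<in> C \<Longrightarrow> x \<in> W \<Longrightarrow> a \<odot>\<^bsub>M\<^esub> x \<in> W"
  using assms unfolding stable_def by auto

lemma stable_Int: "stable M C W \<Longrightarrow> stable M C W' \<Longrightarrow> stable M C (W \<inter> W')"
  unfolding stable_def by auto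

lemma gen_least: "stable M C W \<Longrightarrow> B \<subseteq> W \<Longrightarrow> gen M C B \<subseteq> W"
proof
  fix x assume W: "stable M C W" "B \<subseteq> W" and "x \<in> gen M C B"
  from this(3) show "x \<in> W"
    by induction (use W in \<open>auto dest: stableD\<close>)
qed

lemma gen_mono: "B \<subseteq> B' \<Longrightarrow> C \<subseteq> C' \<Longrightarrow> gen M C B \<subseteq> gen M C' B'"
proof
  fix x assume "B \<subseteq> B'" "C \<subseteq> C'" "x \<in> gen M C B"
  from this(3,1,2) show "x \<in> gen M C' B'"
    by induction (auto intro: gen.intros)
qed

context Module.module
begin

lemma stable_gen:
  assumes "C \<subseteq> carrier R" "B \<subseteq> carrier M"
  shows "stable M C (gen M C B)"
proof -
  have "x \<in> carrier M" if "x \<in> gen M C B" for x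
    using that by induction (use assms in auto)
  then show ?thesis
    unfolding stable_def by (auto intro: gen.intros)
qed

text \<open>\<open>stable\<close> does not ask for negatives; they are obtained from the scalar -1.
  Hence the recurring side condition that \<open>\<ominus> \<one>\<close> lies in
  \<open>C\<close>.\<close>

lemma stable_uminus:
  assumes "stable M C W" "\<ominus> \<one> \<in> C" "x \<in> W"
  shows "\<ominus>\<^bsub>M\<^esub> x \<in> W"
  using stableD[OF assms(1)] assms(2,3) smult_l_minus[of \<one> x] by (metis R.one_closed smult_one)

lemma stable_minus:
  assumes "stable M C W" "\<ominus> \<one> \<in> C" "x \<in> W" "y \<in> W"
  shows "x \<oplus>\<^bsub>M\<^esub> \<ominus>\<^bsub>M\<^esub> y \<in> W"
  by (intro stableD(4)[OF assms(1)] stable_uminus[OF assms(1,2)] assms(3,4))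

section \<open>Base case: finite-dimensional vector spaces\<close>

lemma gen_insert:
  assumes K: "subfield K R" and b: "b \<in> carrier M" and B: "B \<subseteq> carrier M"
  shows "gen M K (insert b B) = {a \<odot>\<^bsub>M\<^esub> b \<oplus>\<^bsub>M\<^esub> y | a y. a \<in> K \<and> y \<in> gen M K B}" (is "?L = ?S")
proof
  note Kring = subringE[OF subfieldE(1)[OF K]]
  note KR = Kring(1)
  note st = stable_gen[OF KR B]
  have "stable M K ?S"
    unfolding stable_def
  proof (intro conjI ballI)
    show "?S \<subseteq> carrier M"
      using KR b stableD(1)[OF st] by auto
    have "\<zero>\<^bsub>M\<^esub> = \<zero> \<odot>\<^bsub>M\<^esub> b \<oplus>\<^bsub>M\<^esub> \<zero>\<^bsub>M\<^esub>"
      using b by simp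
    then show "\<zero>\<^bsub>M\<^esub> \<in> ?S"
      using Kring(2) by (blast intro: gen.intros)
  next
    fix x x' assume "x \<in> ?S" "x' \<in> ?S"
    then obtain a y a' y' where *: "x = a \<odot>\<^bsub>M\<^esub> b \<oplus>\<^bsub>M\<^esub> y" "x' = a' \<odot>\<^bsub>M\<^esub> b \<oplus>\<^bsub>M\<^esub> y'"
      "a \<in> K" "a' \<in> K" "y \<in> gen M K B" "y' \<in> gen M K B" by blast
    then have "x \<oplus>\<^bsub>M\<^esub> x' = (a \<oplus> a') \<odot>\<^bsub>M\<^esub> b \<oplus>\<^bsub>M\<^esub> (y \<oplus>\<^bsub>M\<^esub> y')"
      using KR b stableD(2)[OF st] by (simp add: smult_l_distr subset_iff M.a_ac)
    then show "x \<oplus>\<^bsub>M\<^esub> x' \<in> ?S"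
      using * Kring(7) by (blast intro: gen.intros)
  next
    fix c x assume c: "c \<in> K" and "x \<in> ?S"
    then obtain a y where *: "x = a \<odot>\<^bsub>M\<^esub> b \<oplus>\<^bsub>M\<^esub> y" "a \<in> K" "y \<in> gen M K B" by blast
    then have "c \<odot>\<^bsub>M\<^esub> x = (c \<otimes> a) \<odot>\<^bsub>M\<^esub> b \<oplus>\<^bsub>M\<^esub> c \<odot>\<^bsub>M\<^esub> y"
      using KR b c stableD(2)[OF st] by (simp add: smult_r_distr smult_assoc1 subset_iff)
    then show "c \<odot>\<^bsub>M\<^esub> x \<in> ?S"
      using * c Kring(6) by (blast intro: gen.intros)
  qed
  moreover have "insert b B \<subseteq> ?S"
  proof -
    have "b = \<one> \<odot>\<^bsub>M\<^esub> b \<oplus>\<^bsub>M\<^esub> \<zero>\<^bsub>M\<^esub>" using b by simp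
    then have "b \<in> ?S" using Kring(3) by (blast intro: gen.intros)
    moreover have "y \<in> ?S" if "y \<in> B" for y
    proof -
      have "y = \<zero> \<odot>\<^bsub>M\<^esub> b \<oplus>\<^bsub>M\<^esub> y" using b that B by auto
      then show ?thesis using Kring(2) that by (blast intro: gen.intros)
    qed
    ultimately show ?thesis by blast
  qed
  ultimately show "?L \<subseteq> ?S" by (rule gen_least)
  have "gen M K B \<subseteq> ?L" by (rule gen_mono) auto
  moreover have "b \<in> ?L" by (rule gen.gen_incl) simp
  ultimately show "?S \<subseteq> ?L" by (auto intro!: gen.gen_add gen.gen_smult)
qed

text \<open>Induction on the spanning set. The traces of a chain on the span of \<open>B\<close>
  become stationary. Either the chain stays inside that span, or some member contains a vector
  \<open>w\<close> with a non-zero coefficient at \<open>b\<close>, and subtracting multiples of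
  this one vector moves every later vector into the span of \<open>B\<close>.\<close>

lemma noetherian_on_gen_subfield:
  assumes K: "subfield K R" and "finite B" "B \<subseteq> carrier M"
  shows "noetherian_on M K (gen M K B)"
  using assms(2,3)
proof (induction B rule: finite_induct)
  case empty
  have "gen M K {} \<subseteq> {\<zero>\<^bsub>M\<^esub>}"
    using subfieldE(3)[OF K] by (intro gen_least) (auto simp: stable_def)
  then show ?case
    by (intro noetherian_onI) (metis order_trans stableD(3) empty_subsetI insert_subset)
next
  case (insert b B)
  note Kring = subringE[OF subfieldE(1)[OF K]]
  note KR = Kring(1)
  have b: "b \<in> carrier M" and B: "B \<subseteq> carrier M" using insert.prems by auto
  note st = stable_gen[OF KR B]
  have m1: "\<ominus> \<one> \<in> K" by (intro Kring(3,5))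
  show ?case
  proof (rule noetherian_onI)
    fix W :: "nat \<Rightarrow> 'c set"
    assume W: "\<And>i. stable M K (W i)" "\<And>i. W i \<subseteq> gen M K (insert b B)" 
      "\<And>i j. i \<le> j \<Longrightarrow> W i \<subseteq> W j"
    obtain k where k: "\<And>i. k \<le> i \<Longrightarrow> W i \<inter> gen M K B = W k \<inter> gen M K B"
      using noetherian_onD[OF insert.IH[OF B], of "\<lambda>i. W i \<inter> gen M K B"] W st
      by (metis (no_types, lifting) stable_Int inf_le2 Int_mono order_refl)
    show "\<exists>k. \<forall>i\<ge>k. W i \<subseteq> W k"
    proof (cases "\<forall>i. W i \<subseteq> gen M K B")
      case True
      then show ?thesis using k by blast
    next
      case False
      then obtain j w where w: "w \<in> W j" "w \<notin> gen M K B" by blast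
      then obtain a y where ay: "w = a \<odot>\<^bsub>M\<^esub> b \<oplus>\<^bsub>M\<^esub> y" "a \<in> K" "y \<in> gen M K B"
        using W(2) gen_insert[OF K b B] by blast
      then have "a \<noteq> \<zero>" using w b stableD(2)[OF st] by auto
      then have a: "a \<in> K - {\<zero>}" using ay by blast
      show ?thesis
      proof (intro exI allI impI subsetI)
        \<comment> \<open>From index \<open>j\<close> on the vector \<open>w\<close> is available,
          and from index \<open>k\<close> on the traces no longer grow; hence
          \<open>max j k\<close>.\<close>
        fix i v assume i: "max j k \<le> i" and v: "v \<in> W i"
        then obtain a' y' where ay': "v = a' \<odot>\<^bsub>M\<^esub> b \<oplus>\<^bsub>M\<^esub> y'" "a' \<in> K" "y' \<in> gen M K B"
          using W(2) gen_insert[OF K b B] by blast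
        \<comment> \<open>The quotient of the two coefficients at \<open>b\<close>, so that
          \<open>b\<close> cancels in the difference of \<open>v\<close> and \<open>c\<close> times
          \<open>w\<close>.\<close>
        define c where "c = a' \<otimes> inv a"
        have inva: "inv a \<in> K" "inv a \<otimes> a = \<one>" using subfield_m_inv[OF K a] by auto
        have c: "c \<in> K" unfolding c_def using ay' inva Kring(6) by blast
        have ca: "c \<otimes> a = a'" unfolding c_def using inva a ay' KR by (simp add: R.m_assoc
            subset_iff)
        have cw: "c \<odot>\<^bsub>M\<^esub> w \<in> W i" "c \<odot>\<^bsub>M\<^esub> w \<in> W (max j k)"
          using W(1,3) w c i stableD(5) by (metis max.boundedE subsetD, metis max.cobounded1
              subsetD)
        have yc: "y \<in> carrier M" "y' \<in> carrier M" using ay ay' stableD(2)[OF st] by auto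
        have "c \<odot>\<^bsub>M\<^esub> w = a' \<odot>\<^bsub>M\<^esub> b \<oplus>\<^bsub>M\<^esub> c \<odot>\<^bsub>M\<^esub> y"
          using ca c a KR b yc ay by (simp add: smult_r_distr smult_assoc1 subset_iff flip: ca)
        then have eq: "v \<oplus>\<^bsub>M\<^esub> \<ominus>\<^bsub>M\<^esub> (c \<odot>\<^bsub>M\<^esub> w) = y' \<oplus>\<^bsub>M\<^esub> \<ominus>\<^bsub>M\<^esub> (c \<odot>\<^bsub>M\<^esub> y)"
          using ay' c KR b yc by (simp add: M.minus_add subset_iff) (simp add: M.a_ac M.r_neg1
              M.r_neg2 subset_iff)
        have "v \<oplus>\<^bsub>M\<^esub> \<ominus>\<^bsub>M\<^esub> (c \<odot>\<^bsub>M\<^esub> w) \<in> W i \<inter> gen M K B"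
          using stable_minus[OF W(1) m1 v cw(1)] stable_minus[OF st m1 ay'(3)] stableD(5)[OF st c
              ay(3)] eq
          by auto
        then have "v \<oplus>\<^bsub>M\<^esub> \<ominus>\<^bsub>M\<^esub> (c \<odot>\<^bsub>M\<^esub> w) \<in> W (max j k)"
          using k[of i] k[of "max j k"] i by auto
        then have "(v \<oplus>\<^bsub>M\<^esub> \<ominus>\<^bsub>M\<^esub> (c \<odot>\<^bsub>M\<^esub> w)) \<oplus>\<^bsub>M\<^esub> c \<odot>\<^bsub>M\<^esub> w \<in> W (max j k)"
          using stableD(4)[OF W(1)] cw(2) by blast
        moreover have "v \<in> carrier M" "c \<odot>\<^bsub>M\<^esub> w \<in> carrier M"
          using v cw stableD(2)[OF W(1)] by blast+
        ultimately show "v \<in> W (max j k)" by (simp add: M.a_assoc M.l_neg)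
      qed
    qed
  qed
qed


section \<open>Adjoining one scalar: the step of Hilbert's basis theorem\<close>

text \<open>This is N + v N + ... + v^(i-1) N, the polynomials in \<open>v\<close> of degree less
  than \<open>i\<close> with coefficients in \<open>N\<close>. Such expressions need not be unique
  in a module, so membership in a layer replaces the degree.\<close>

primrec layer :: "'a \<Rightarrow> 'c set \<Rightarrow> nat \<Rightarrow> 'c set" where
  "layer v N 0 = {\<zero>\<^bsub>M\<^esub>}"
| "layer v N (Suc i) = {(v [^] i) \<odot>\<^bsub>M\<^esub> m \<oplus>\<^bsub>M\<^esub> y | m y. m \<in> N \<and> y \<in> layer v N i}"

lemma layer_carrier:
  assumes "v \<in> carrier R" "N \<subseteq> carrier M"
  shows "layer v N i \<subseteq> carrier M"
  by (induction i) (use assms in auto)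

lemma stable_layer:
  assumes C: "C \<subseteq> carrier R" and v: "v \<in> carrier R" and N: "stable M C N"
  shows "stable M C (layer v N i)"
proof (induction i)
  case 0
  show ?case using C by (auto simp: stable_def)
next
  case (Suc i)
  note Nc = stableD(2)[OF N] and Lc = stableD(2)[OF Suc]
  show ?case
    unfolding stable_def
  proof (intro conjI ballI)
    show "layer v N (Suc i) \<subseteq> carrier M"
      using layer_carrier[OF v] stableD(1)[OF N] by blast
    have "\<zero>\<^bsub>M\<^esub> = (v [^] i) \<odot>\<^bsub>M\<^esub> \<zero>\<^bsub>M\<^esub> \<oplus>\<^bsub>M\<^esub> \<zero>\<^bsub>M\<^esub>"
      using v by simp
    then show "\<zero>\<^bsub>M\<^esub> \<in> layer v N (Suc i)"
      unfolding layer.simps using stableD(3)[OF N] stableD(3)[OF Suc] by blast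
  next
    fix x x' assume "x \<in> layer v N (Suc i)" "x' \<in> layer v N (Suc i)"
    then obtain m y m' y' where *: "x = (v [^] i) \<odot>\<^bsub>M\<^esub> m \<oplus>\<^bsub>M\<^esub> y" "x' = (v [^] i) \<odot>\<^bsub>M\<^esub> m' \<oplus>\<^bsub>M\<^esub> y'"
      "m \<in> N" "m' \<in> N" "y \<in> layer v N i" "y' \<in> layer v N i" by auto
    then have "x \<oplus>\<^bsub>M\<^esub> x' = (v [^] i) \<odot>\<^bsub>M\<^esub> (m \<oplus>\<^bsub>M\<^esub> m') \<oplus>\<^bsub>M\<^esub> (y \<oplus>\<^bsub>M\<^esub> y')"
      using v Nc Lc by (simp add: smult_r_distr M.a_ac)
    then show "x \<oplus>\<^bsub>M\<^esub> x' \<in> layer v N (Suc i)"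
      unfolding layer.simps using stableD(4)[OF N *(3,4)] stableD(4)[OF Suc *(5,6)] by blast
  next
    fix a x assume a: "a \<in> C" and "x \<in> layer v N (Suc i)"
    then obtain m y where *: "x = (v [^] i) \<odot>\<^bsub>M\<^esub> m \<oplus>\<^bsub>M\<^esub> y" "m \<in> N" "y \<in> layer v N i" by auto
    then have "a \<odot>\<^bsub>M\<^esub> x = (v [^] i) \<odot>\<^bsub>M\<^esub> (a \<odot>\<^bsub>M\<^esub> m) \<oplus>\<^bsub>M\<^esub> a \<odot>\<^bsub>M\<^esub> y"
      using a C v Nc Lc
      by (simp add: smult_r_distr smult_assoc1[symmetric] R.m_comm subset_iff)
    then show "a \<odot>\<^bsub>M\<^esub> x \<in> layer v N (Suc i)"
      unfolding layer.simps using stableD(5)[OF N a *(2)] stableD(5)[OF Suc a *(3)] by blast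
  qed
qed

lemma layer_Suc_mono:
  assumes C: "C \<subseteq> carrier R" and v: "v \<in> carrier R" and N: "stable M C N"
  shows "layer v N i \<subseteq> layer v N (Suc i)"
proof
  fix y assume y: "y \<in> layer v N i"
  then have "y \<in> carrier M" using layer_carrier[OF v stableD(1)[OF N]] by blast
  then have "y = (v [^] i) \<odot>\<^bsub>M\<^esub> \<zero>\<^bsub>M\<^esub> \<oplus>\<^bsub>M\<^esub> y" using v by simp
  then show "y \<in> layer v N (Suc i)"
    unfolding layer.simps using y stableD(3)[OF N] by blast
qed

lemma smult_layer:
  assumes v: "v \<in> carrier R" and N: "stable M C N" and "y \<in> layer v N i"
  shows "v \<odot>\<^bsub>M\<^esub> y \<in> layer v N (Suc i)"
  using assms(3)
proof (induction i arbitrary: y)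
  case 0
  have "\<zero>\<^bsub>M\<^esub> = (v [^] (0::nat)) \<odot>\<^bsub>M\<^esub> \<zero>\<^bsub>M\<^esub> \<oplus>\<^bsub>M\<^esub> \<zero>\<^bsub>M\<^esub>"
    using v by simp
  then have "\<zero>\<^bsub>M\<^esub> \<in> layer v N (Suc 0)"
    unfolding layer.simps using stableD(3)[OF N] by blast
  with 0 show ?case using v by simp
next
  case (Suc i)
  then obtain m z where *: "y = (v [^] i) \<odot>\<^bsub>M\<^esub> m \<oplus>\<^bsub>M\<^esub> z" "m \<in> N" "z \<in> layer v N i" by auto
  then have "m \<in> carrier M" "z \<in> carrier M"
    using stableD(1)[OF N] layer_carrier[OF v stableD(1)[OF N]] by auto
  then have "v \<odot>\<^bsub>M\<^esub> y = (v [^] Suc i) \<odot>\<^bsub>M\<^esub> m \<oplus>\<^bsub>M\<^esub> v \<odot>\<^bsub>M\<^esub> z"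
    using * v by (simp add: smult_r_distr smult_assoc1[symmetric] R.m_comm)
  then show ?case
    using Suc.IH[OF *(3)] * by (subst layer.simps) blast
qed

text \<open>Scalars from \<open>C\<close> preserve each layer and \<open>v\<close> raises the index
  by one, so the union of the increasing layers is already stable under
  \<open>insert v C\<close>.\<close>

lemma gen_insert_layer:
  assumes C: "C \<subseteq> carrier R" and v: "v \<in> carrier R" and B: "B \<subseteq> carrier M"
  shows "gen M (insert v C) B \<subseteq> (\<Union>i. layer v (gen M C B) i)"
proof (rule gen_least)
  note N = stable_gen[OF C B]
  note L = stable_layer[OF C v N]
  have mono: "layer v (gen M C B) i \<subseteq> layer v (gen M C B) j" if "i \<le> j" for i j
    using lift_Suc_mono_le[of "layer v (gen M C B)", OF layer_Suc_mono[OF C v N] that] .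
  show "stable M (insert v C) (\<Union>i. layer v (gen M C B) i)"
    unfolding stable_def
  proof (intro conjI ballI)
    show "(\<Union>i. layer v (gen M C B) i) \<subseteq> carrier M" using stableD(1)[OF L] by blast
    show "\<zero>\<^bsub>M\<^esub> \<in> (\<Union>i. layer v (gen M C B) i)" using stableD(3)[OF L] by blast
  next
    fix x y assume "x \<in> (\<Union>i. layer v (gen M C B) i)" "y \<in> (\<Union>i. layer v (gen M C B) i)"
    then obtain i j where "x \<in> layer v (gen M C B) i" "y \<in> layer v (gen M C B) j" by blast
    then have "x \<in> layer v (gen M C B) (max i j)" "y \<in> layer v (gen M C B) (max i j)"
      using mono[of i "max i j"] mono[of j "max i j"] by auto
    then show "x \<oplus>\<^bsub>M\<^esub> y \<in> (\<Union>i. layer v (gen M C B) i)"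
      using stableD(4)[OF L] by blast
  next
    fix a x assume "a \<in> insert v C" "x \<in> (\<Union>i. layer v (gen M C B) i)"
    then show "a \<odot>\<^bsub>M\<^esub> x \<in> (\<Union>i. layer v (gen M C B) i)"
      using stableD(5)[OF L] smult_layer[OF v N] by blast
  qed
  show "B \<subseteq> (\<Union>i. layer v (gen M C B) i)"
  proof
    fix b assume b: "b \<in> B"
    then have "b = (v [^] (0::nat)) \<odot>\<^bsub>M\<^esub> b \<oplus>\<^bsub>M\<^esub> \<zero>\<^bsub>M\<^esub>" using B by auto
    then have "b \<in> layer v (gen M C B) (Suc 0)" using b by (auto intro: gen.intros)
    then show "b \<in> (\<Union>i. layer v (gen M C B) i)" by blast
  qed
qed

text \<open>The analogue of the ideals of leading coefficients in Hilbert's basis theorem.\<close>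

definition leading :: "'a \<Rightarrow> 'c set \<Rightarrow> nat \<Rightarrow> 'c set \<Rightarrow> 'c set" where
  "leading v N i W = {m \<in> N. \<exists>y\<in>layer v N i. (v [^] i) \<odot>\<^bsub>M\<^esub> m \<oplus>\<^bsub>M\<^esub> y \<in> W}"

lemma stable_leading:
  assumes C: "C \<subseteq> carrier R" and v: "v \<in> carrier R" and N: "stable M C N" and W: "stable M C W"
  shows "stable M C (leading v N i W)"
proof -
  note L = stable_layer[OF C v N, of i]
  note Nc = stableD(2)[OF N] and Lc = stableD(2)[OF L]
  show ?thesis
    unfolding stable_def
  proof (intro conjI ballI)
    show "leading v N i W \<subseteq> carrier M" unfolding leading_def using Nc by blast
    have "(v [^] i) \<odot>\<^bsub>M\<^esub> \<zero>\<^bsub>M\<^esub> \<oplus>\<^bsub>M\<^esub> \<zero>\<^bsub>M\<^esub> \<in> W" using v stableD(3)[OF W] by simp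
    then show "\<zero>\<^bsub>M\<^esub> \<in> leading v N i W"
      unfolding leading_def using stableD(3)[OF N] stableD(3)[OF L] by blast
  next
    fix x x' assume "x \<in> leading v N i W" "x' \<in> leading v N i W"
    then obtain y y' where *: "x \<in> N" "x' \<in> N" "y \<in> layer v N i" "y' \<in> layer v N i"
      "(v [^] i) \<odot>\<^bsub>M\<^esub> x \<oplus>\<^bsub>M\<^esub> y \<in> W" "(v [^] i) \<odot>\<^bsub>M\<^esub> x' \<oplus>\<^bsub>M\<^esub> y' \<in> W"
      unfolding leading_def by blast
    have "(v [^] i) \<odot>\<^bsub>M\<^esub> (x \<oplus>\<^bsub>M\<^esub> x') \<oplus>\<^bsub>M\<^esub> (y \<oplus>\<^bsub>M\<^esub> y') =
        ((v [^] i) \<odot>\<^bsub>M\<^esub> x \<oplus>\<^bsub>M\<^esub> y) \<oplus>\<^bsub>M\<^esub> ((v [^] i) \<odot>\<^bsub>M\<^esub> x' \<oplus>\<^bsub>M\<^esub> y')"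
      using * v Nc Lc by (simp add: smult_r_distr M.a_ac)
    then have "(v [^] i) \<odot>\<^bsub>M\<^esub> (x \<oplus>\<^bsub>M\<^esub> x') \<oplus>\<^bsub>M\<^esub> (y \<oplus>\<^bsub>M\<^esub> y') \<in> W"
      using stableD(4)[OF W *(5,6)] by simp
    then show "x \<oplus>\<^bsub>M\<^esub> x' \<in> leading v N i W"
      unfolding leading_def using * stableD(4)[OF N] stableD(4)[OF L] by blast
  next
    fix a x assume a: "a \<in> C" and "x \<in> leading v N i W"
    then obtain y where *: "x \<in> N" "y \<in> layer v N i" "(v [^] i) \<odot>\<^bsub>M\<^esub> x \<oplus>\<^bsub>M\<^esub> y \<in> W"
      unfolding leading_def by blast
    have "(v [^] i) \<odot>\<^bsub>M\<^esub> (a \<odot>\<^bsub>M\<^esub> x) \<oplus>\<^bsub>M\<^esub> a \<odot>\<^bsub>M\<^esub> y = a \<odot>\<^bsub>M\<^esub> ((v [^] i) \<odot>\<^bsub>M\<^esub> x \<oplus>\<^bsub>M\<^esub> y)"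
      using * a C v Nc Lc
      by (simp add: smult_r_distr smult_assoc1[symmetric] R.m_comm subset_iff)
    then have "(v [^] i) \<odot>\<^bsub>M\<^esub> (a \<odot>\<^bsub>M\<^esub> x) \<oplus>\<^bsub>M\<^esub> a \<odot>\<^bsub>M\<^esub> y \<in> W"
      using stableD(5)[OF W a *(3)] by simp
    then show "a \<odot>\<^bsub>M\<^esub> x \<in> leading v N i W"
      unfolding leading_def using * a stableD(5)[OF N] stableD(5)[OF L] by blast
  qed
qed

lemma leading_mono: "W \<subseteq> W' \<Longrightarrow> leading v N i W \<subseteq> leading v N i W'"
  unfolding leading_def by blast

text \<open>Multiplication by \<open>v\<close> turns a leading term of index \<open>i\<close> into
  one of index \<open>i + 1\<close>. Here stability under \<open>v\<close>, and not only under
  \<open>C\<close>, enters.\<close>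

lemma leading_Suc_mono:
  assumes C: "C \<subseteq> carrier R" and v: "v \<in> carrier R" and N: "stable M C N"
    and W: "stable M (insert v C) W"
  shows "leading v N i W \<subseteq> leading v N (Suc i) W"
proof
  fix m assume "m \<in> leading v N i W"
  then obtain y where *: "m \<in> N" "y \<in> layer v N i" "(v [^] i) \<odot>\<^bsub>M\<^esub> m \<oplus>\<^bsub>M\<^esub> y \<in> W"
    unfolding leading_def by blast
  have c: "m \<in> carrier M" "y \<in> carrier M"
    using * stableD(1)[OF N] layer_carrier[OF v stableD(1)[OF N]] by auto
  have "v \<odot>\<^bsub>M\<^esub> ((v [^] i) \<odot>\<^bsub>M\<^esub> m \<oplus>\<^bsub>M\<^esub> y) = (v [^] Suc i) \<odot>\<^bsub>M\<^esub> m \<oplus>\<^bsub>M\<^esub> v \<odot>\<^bsub>M\<^esub> y"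
    using c v by (simp add: smult_r_distr smult_assoc1[symmetric] R.m_comm)
  then have "(v [^] Suc i) \<odot>\<^bsub>M\<^esub> m \<oplus>\<^bsub>M\<^esub> v \<odot>\<^bsub>M\<^esub> y \<in> W"
    using stableD(5)[OF W insertI1 *(3)] by simp
  then show "m \<in> leading v N (Suc i) W"
    unfolding leading_def using *(1) smult_layer[OF v N *(2)] by blast
qed

text \<open>An element of \<open>W'\<close> in layer \<open>i + 1\<close> shares its leading
  coefficient with some element of \<open>W\<close>. Their difference lies in \<open>W'\<close> and
  one layer lower, hence in \<open>W\<close> by induction.\<close>

lemma subset_if_leading_subset:
  assumes C: "C \<subseteq> carrier R" "\<ominus> \<one> \<in> C" and v: "v \<in> carrier R" and N: "stable M C N"
    and W: "stable M C W" "stable M C W'" "W \<subseteq> W'"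
    and le: "\<And>i. leading v N i W' \<subseteq> leading v N i W"
  shows "W' \<inter> layer v N i \<subseteq> W"
proof (induction i)
  case 0
  show ?case using stableD(3)[OF W(1)] by auto
next
  case (Suc i)
  show ?case
  proof
    fix w assume w: "w \<in> W' \<inter> layer v N (Suc i)"
    then obtain m y where *: "w = (v [^] i) \<odot>\<^bsub>M\<^esub> m \<oplus>\<^bsub>M\<^esub> y" "m \<in> N" "y \<in> layer v N i" by auto
    then have "m \<in> leading v N i W'" unfolding leading_def using w by blast
    then obtain y' where y': "y' \<in> layer v N i" "(v [^] i) \<odot>\<^bsub>M\<^esub> m \<oplus>\<^bsub>M\<^esub> y' \<in> W"
      using le unfolding leading_def by blast
    define w' where "w' = (v [^] i) \<odot>\<^bsub>M\<^esub> m \<oplus>\<^bsub>M\<^esub> y'"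
    have c: "m \<in> carrier M" "y \<in> carrier M" "y' \<in> carrier M" "w \<in> carrier M" "w' \<in> carrier M"
      using * y' w stableD(2)[OF N] layer_carrier[OF v stableD(1)[OF N]] stableD(2)[OF W(1)]
        stableD(2)[OF W(2)] w'_def by auto
    have "w \<oplus>\<^bsub>M\<^esub> \<ominus>\<^bsub>M\<^esub> w' = y \<oplus>\<^bsub>M\<^esub> \<ominus>\<^bsub>M\<^esub> y'"
      unfolding *(1) w'_def using c v
      by (simp add: M.minus_add) (simp add: M.a_ac M.r_neg M.r_neg1 M.r_neg2)
    moreover have "y \<oplus>\<^bsub>M\<^esub> \<ominus>\<^bsub>M\<^esub> y' \<in> layer v N i"
      using stable_minus[OF stable_layer[OF C(1) v N] C(2) *(3) y'(1)] .
    moreover have "w \<oplus>\<^bsub>M\<^esub> \<ominus>\<^bsub>M\<^esub> w' \<in> W'"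
      using stable_minus[OF W(2) C(2)] w y' W(3) w'_def by blast
    ultimately have "w \<oplus>\<^bsub>M\<^esub> \<ominus>\<^bsub>M\<^esub> w' \<in> W" using Suc by auto
    then have "w \<oplus>\<^bsub>M\<^esub> \<ominus>\<^bsub>M\<^esub> w' \<oplus>\<^bsub>M\<^esub> w' \<in> W" 
      using stableD(4)[OF W(1)] y' w'_def by blast
    then show "w \<in> W" using c by (simp add: M.a_assoc M.l_neg)
  qed
qed

lemma stable_insert: "stable M (insert v C) W \<Longrightarrow> stable M C W"
  unfolding stable_def by blast

lemma noetherian_on_gen_insert:
  assumes C: "C \<subseteq> carrier R" "\<ominus> \<one> \<in> C" and v: "v \<in> carrier R" and B: "B \<subseteq> carrier M"
    and noeth: "noetherian_on M C (gen M C B)"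
  shows "noetherian_on M (insert v C) (gen M (insert v C) B)"
proof (rule noetherian_onI)
  define N where "N = gen M C B"
  have N: "stable M C N" unfolding N_def by (rule stable_gen[OF C(1) B])
  fix W :: "nat \<Rightarrow> 'c set"
  assume W: "\<And>i. stable M (insert v C) (W i)" "\<And>i. W i \<subseteq> gen M (insert v C) B" 
    "\<And>i j. i \<le> j \<Longrightarrow> W i \<subseteq> W j"
  \<comment> \<open>The row index \<open>i\<close> is the degree in \<open>v\<close>, the column
    index \<open>j\<close> is the position in the chain; \<open>ld\<close> increases in
    both.\<close>
  define ld where "ld i j = leading v N i (W j)" for i j
  have ld_stable: "stable M C (ld i j)" for i j
    unfolding ld_def by (intro stable_leading C v N stable_insert[OF W(1)])
  have ld_N: "ld i j \<subseteq> N" for i j unfolding ld_def leading_def by blast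
  have ld_mono1: "ld i j \<subseteq> ld i' j" if "i \<le> i'" for i i' j
    using lift_Suc_mono_le[of "\<lambda>i. ld i j", OF _ that]
      leading_Suc_mono[OF C(1) v N W(1)] unfolding ld_def by blast
  have ld_mono2: "ld i j \<subseteq> ld i j'" if "j \<le> j'" for i j j'
    unfolding ld_def by (intro leading_mono W(3) that)
  have ld_mono: "ld i j \<subseteq> ld i' j'" if "i \<le> i'" "j \<le> j'" for i i' j j'
    using ld_mono1 ld_mono2 that by blast
  note noeth = noeth[folded N_def]
  \<comment> \<open>The diagonal controls all rows from \<open>k\<close> on simultaneously. Only the
    finitely many rows below \<open>k\<close> remain, and row \<open>i\<close> is stationary from
    \<open>q i\<close> on; \<open>r\<close> is the maximum of \<open>k\<close> and these
    indices.\<close>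
  obtain k where k: "\<And>i. k \<le> i \<Longrightarrow> ld i i = ld k k"
    using noetherian_onD[OF noeth, of "\<lambda>i. ld i i"] ld_stable ld_N ld_mono by metis
  have "\<exists>q. \<forall>j\<ge>q. ld i j = ld i q" for i
    using noetherian_onD[OF noeth, of "\<lambda>j. ld i j"] ld_stable ld_N ld_mono2 by metis
  then obtain q where q: "\<And>i j. q i \<le> j \<Longrightarrow> ld i j = ld i (q i)" by metis
  define r where "r = Max (insert k (q ` {..<k}))"
  have r: "k \<le> r" "\<And>i. i < k \<Longrightarrow> q i \<le> r" unfolding r_def by auto
  have ld_eq: "ld i j \<subseteq> ld i r" if "r \<le> j" for i j
  proof (cases "i < k")
    case True
    then show ?thesis using q[of i j] q[of i r] r(2)[OF True] that by (metis order.trans order_refl)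
  next
    case False
    \<comment> \<open>In the rows from \<open>k\<close> on, \<open>ld i j\<close> lies below a
      diagonal entry equal to \<open>ld k k\<close>, which in turn lies below
      \<open>ld i r\<close>.\<close>
    have "ld i j \<subseteq> ld (max i j) (max i j)" by (rule ld_mono) auto
    also have "\<dots> = ld k k" by (rule k) (use False in auto)
    also have "\<dots> \<subseteq> ld i r" using False r by (intro ld_mono) auto
    finally show ?thesis .
  qed
  have "W j \<subseteq> W r" if "r \<le> j" for j
  proof -
    have "W j \<inter> layer v N i \<subseteq> W r" for i
      by (rule subset_if_leading_subset[OF C v N stable_insert[OF W(1)] stable_insert[OF W(1)]
          W(3)[OF that]])
        (use ld_eq[OF that] in \<open>auto simp: ld_def\<close>)
    moreover have "W j \<subseteq> (\<Union>i. layer v N i)"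
      using W(2)[of j] gen_insert_layer[OF C(1) v B] unfolding N_def by blast
    ultimately show ?thesis by blast
  qed
  then show "\<exists>r. \<forall>j\<ge>r. W j \<subseteq> W r" by blast
qed

theorem noetherian_on_gen:
  assumes K: "subfield K R" and "finite V" "V \<subseteq> carrier R" and B: "finite B" "B \<subseteq> carrier M"
  shows "noetherian_on M (K \<union> V) (gen M (K \<union> V) B)"
  using assms(2,3)
proof (induction V rule: finite_induct)
  case empty
  show ?case using noetherian_on_gen_subfield[OF K B] by simp
next
  case (insert v V)
  note Kring = subringE[OF subfieldE(1)[OF K]]
  have "noetherian_on M (insert v (K \<union> V)) (gen M (insert v (K \<union> V)) B)"
    using insert Kring(1) Kring(5)[OF Kring(3)] B by (intro noetherian_on_gen_insert) auto
  then show ?case by simp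
qed

end

section \<open>Finite direct powers\<close>

text \<open>The families are total functions with value zero outside \<open>A\<close>. Thus the
  operations are pointwise and equality of families is plain equality of functions.\<close>

definition power_module :: "'i set \<Rightarrow> ('a, 'm, 'y) module_scheme \<Rightarrow> ('a, 'i \<Rightarrow> 'm) module" where
  "power_module A M =
    \<lparr>carrier = {c. (\<forall>i. c i \<in> carrier M) \<and> (\<forall>i. i \<notin> A \<longrightarrow> c i = \<zero>\<^bsub>M\<^esub>)},
     mult = undefined, one = undefined, zero = (\<lambda>_. \<zero>\<^bsub>M\<^esub>), add = (\<lambda>c c' i. c i \<oplus>\<^bsub>M\<^esub> c' i),
     smult = (\<lambda>a c i. a \<odot>\<^bsub>M\<^esub> c i)\<rparr>"

lemma power_module_simps:
  "carrier (power_module A M) = {c. (\<forall>i. c i \<in> carrier M) \<and> (\<forall>i. i \<notin> A \<longrightarrow> c i = \<zero>\<^bsub>M\<^esub>)}"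
  "\<zero>\<^bsub>power_module A M\<^esub> = (\<lambda>_. \<zero>\<^bsub>M\<^esub>)"
  "c \<oplus>\<^bsub>power_module A M\<^esub> c' = (\<lambda>i. c i \<oplus>\<^bsub>M\<^esub> c' i)"
  "a \<odot>\<^bsub>power_module A M\<^esub> c = (\<lambda>i. a \<odot>\<^bsub>M\<^esub> c i)"
  by (simp_all add: power_module_def)

context Module.module
begin

lemma module_power: "Module.module R (power_module A M)"
proof (rule moduleI)
  show "abelian_group (power_module A M)"
  proof (rule abelian_groupI)
    fix x assume "x \<in> carrier (power_module A M)"
    then show "\<exists>y\<in>carrier (power_module A M). y \<oplus>\<^bsub>power_module A M\<^esub> x = \<zero>\<^bsub>power_module A M\<^esub>"
      by (intro bexI[of _ "\<lambda>i. \<ominus>\<^bsub>M\<^esub> x i"]) (auto simp: power_module_simps M.l_neg)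
  qed (auto simp: power_module_simps M.a_ac)
qed (auto simp: power_module_simps smult_l_distr smult_r_distr smult_assoc1 R.cring_axioms)

text \<open>A family is the finite sum of its one-entry families, and each of these is generated in
  the same way as its entry.\<close>

lemma gen_power_module:
  assumes A: "finite A" and C: "C \<subseteq> carrier R" and B: "B \<subseteq> carrier M" and gen: "carrier M \<subseteq> gen M
      C B"
  shows "carrier (power_module A M) \<subseteq>
    gen (power_module A M) C ((\<lambda>(i, b) j. if j = i then b else \<zero>\<^bsub>M\<^esub>) ` (A \<times> B))" (is "_ \<subseteq> ?G")
proof
  fix c assume c: "c \<in> carrier (power_module A M)"
  have single: "(\<lambda>j. if j = i then x else \<zero>\<^bsub>M\<^esub>) \<in> ?G" if "i \<in> A" "x \<in> gen M C B" for i x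
    using that(2)
  proof induction
    case gen_zero
    then show ?case using gen.gen_zero[of "power_module A M"] by (simp add: power_module_simps)
  next
    case (gen_incl b)
    then show ?case using that(1) by (intro gen.gen_incl) force
  next
    case (gen_add x y)
    have "(\<lambda>j. if j = i then x \<oplus>\<^bsub>M\<^esub> y else \<zero>\<^bsub>M\<^esub>) =
      (\<lambda>j. if j = i then x else \<zero>\<^bsub>M\<^esub>) \<oplus>\<^bsub>power_module A M\<^esub> (\<lambda>j. if j = i then y else \<zero>\<^bsub>M\<^esub>)"
      by (auto simp: power_module_simps)
    then show ?case using gen_add by (simp add: gen.gen_add)
  next
    case (gen_smult a x)
    have "(\<lambda>j. if j = i then a \<odot>\<^bsub>M\<^esub> x else \<zero>\<^bsub>M\<^esub>) =
      a \<odot>\<^bsub>power_module A M\<^esub> (\<lambda>j. if j = i then x else \<zero>\<^bsub>M\<^esub>)"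
      using gen_smult.hyps C by (simp add: power_module_simps fun_eq_iff subset_iff)
    then show ?case using gen_smult by (simp add: gen.gen_smult)
  qed
  have "(\<lambda>i. if i \<in> D then c i else \<zero>\<^bsub>M\<^esub>) \<in> ?G" if "finite D" "D \<subseteq> A" for D
    using that
  proof (induction D rule: finite_induct)
    case empty
    then show ?case using gen.gen_zero[of "power_module A M"] by (simp add: power_module_simps)
  next
    case (insert i D)
    have "(\<lambda>j. if j \<in> insert i D then c j else \<zero>\<^bsub>M\<^esub>) =
      (\<lambda>j. if j = i then c i else \<zero>\<^bsub>M\<^esub>) \<oplus>\<^bsub>power_module A M\<^esub> (\<lambda>j. if j \<in> D then c j else \<zero>\<^bsub>M\<^esub>)"
      using insert c by (auto simp: power_module_simps)
    moreover have "(\<lambda>j. if j = i then c i else \<zero>\<^bsub>M\<^esub>) \<in> ?G"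
      using insert c gen by (intro single) (auto simp: power_module_simps)
    ultimately show ?case using insert by (simp add: gen.gen_add)
  qed
  from this[OF A] have "(\<lambda>i. if i \<in> A then c i else \<zero>\<^bsub>M\<^esub>) \<in> ?G" by simp
  moreover have "(\<lambda>i. if i \<in> A then c i else \<zero>\<^bsub>M\<^esub>) = c" using c by (auto simp: power_module_simps)
  ultimately show "c \<in> ?G" by simp
qed

lemma noetherian_on_power:
  assumes A: "finite A" and K: "subfield K R" and V: "finite V" "V \<subseteq> carrier R"
    and B: "finite B" "B \<subseteq> carrier M" and gen: "carrier M \<subseteq> gen M (K \<union> V) B"
  shows "noetherian_on (power_module A M) (K \<union> V) (carrier (power_module A M))"
proof -
  define B' where "B' = (\<lambda>(i, b) j. if j = i then b else \<zero>\<^bsub>M\<^esub>) ` (A \<times> B)"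
  have B': "finite B'" "B' \<subseteq> carrier (power_module A M)"
    using A B by (auto simp: B'_def power_module_simps)
  have KV: "K \<union> V \<subseteq> carrier R" using subfieldE(3)[OF K] V by blast
  have "gen (power_module A M) (K \<union> V) B' = carrier (power_module A M)"
    using module.stable_gen[OF module_power KV B'(2)] gen_power_module[OF A KV B(2) gen]
    unfolding stable_def B'_def by blast
  then show ?thesis
    using module.noetherian_on_gen[OF module_power K V B'] by simp
qed

end

section \<open>Koszul complexes\<close>

text \<open>The sign is that of \<open>cech_differential\<close>, so that numerators of Cech
  cochains are later transformed exactly by \<open>koszul_diff\<close>.\<close>

definition alt :: "('a, 'm, 'y) module_scheme \<Rightarrow> nat set \<Rightarrow> nat \<Rightarrow> 'm \<Rightarrow> 'm" where
  "alt M J l y = (if even (card {m \<in> J. m < l}) then y else \<ominus>\<^bsub>M\<^esub> y)"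

text \<open>A cochain assigns a value to every finite set of indices, so a single map comprises all
  cohomological degrees. The sequence \<open>a\<close> is a parameter because it will be replaced by
  sequences of powers.\<close>

definition koszul_diff ::
  "('a, 'm, 'y) module_scheme \<Rightarrow> (nat \<Rightarrow> 'a) \<Rightarrow> (nat set \<Rightarrow> 'm) \<Rightarrow> nat set \<Rightarrow> 'm" where
  "koszul_diff M a c J = (\<Oplus>\<^bsub>M\<^esub>l\<in>J. alt M J l (a l \<odot>\<^bsub>M\<^esub> c (J - {l})))"

text \<open>The groups \<open>G I\<close> carry the internal degrees, which differ from one
  \<open>I\<close> to another. Both ends of the complex are included: at \<open>I = {}\<close> the
  differential is an empty sum, so a cocycle must vanish there, and the value at \<open>A\<close>
  itself enters no cocycle condition, so it must always be hit.\<close>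

definition koszul_exact ::
  "('a, 'm, 'y) module_scheme \<Rightarrow> nat set \<Rightarrow> (nat \<Rightarrow> 'a) \<Rightarrow> (nat set \<Rightarrow> 'm set) \<Rightarrow> bool" where
  "koszul_exact M A a G \<longleftrightarrow>
    (\<forall>c. (\<forall>I\<subseteq>A. c I \<in> G I) \<and> (\<forall>J\<subseteq>A. koszul_diff M a c J = \<zero>\<^bsub>M\<^esub>) \<longrightarrow>
      (\<exists>h. (\<forall>I\<subseteq>A. h I \<in> G I) \<and> (\<forall>I\<subseteq>A. c I = koszul_diff M a h I)))"

lemma koszul_exactD:
  assumes "koszul_exact M A a G" "\<And>I. I \<subseteq> A \<Longrightarrow> c I \<in> G I"
    "\<And>J. J \<subseteq> A \<Longrightarrow> koszul_diff M a c J = \<zero>\<^bsub>M\<^esub>"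
  obtains h where "\<And>I. I \<subseteq> A \<Longrightarrow> h I \<in> G I" "\<And>I. I \<subseteq> A \<Longrightarrow> c I = koszul_diff M a h I"
proof -
  have "(\<forall>I\<subseteq>A. c I \<in> G I) \<and> (\<forall>J\<subseteq>A. koszul_diff M a c J = \<zero>\<^bsub>M\<^esub>)" using assms(2,3) by simp
  then obtain h where "(\<forall>I\<subseteq>A. h I \<in> G I) \<and> (\<forall>I\<subseteq>A. c I = koszul_diff M a h I)"
    using assms(1)[unfolded koszul_exact_def, THEN spec[of _ c]] by blast
  then show ?thesis by (intro that) auto
qed

lemma koszul_exactI:
  assumes "\<And>c. (\<And>I. I \<subseteq> A \<Longrightarrow> c I \<in> G I) \<Longrightarrow>
      (\<And>J. J \<subseteq> A \<Longrightarrow> koszul_diff M a c J = \<zero>\<^bsub>M\<^esub>) \<Longrightarrow>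
      \<exists>h. (\<forall>I\<subseteq>A. h I \<in> G I) \<and> (\<forall>I\<subseteq>A. c I = koszul_diff M a h I)"
  shows "koszul_exact M A a G"
  unfolding koszul_exact_def using assms by simp

text \<open>Deleting the smaller of the two indices lowers the position of the larger by one,
  whereas deleting the larger leaves the position of the smaller unchanged.\<close>

lemma even_card_less_swap:
  fixes l m :: nat
  assumes "finite J" "l \<in> J" "m \<in> J" "l \<noteq> m"
  shows "(even (card {k \<in> J. k < m}) = even (card {k \<in> J - {l}. k < m})) \<noteq>
    (even (card {k \<in> J. k < l}) = even (card {k \<in> J - {m}. k < l}))"
  using assms
proof (induction l m rule: linorder_wlog)
  case (le l m)
  have "{k \<in> J. k < m} = insert l {k \<in> J - {l}. k < m}" using le by auto
  then have "card {k \<in> J. k < m} = Suc (card {k \<in> J - {l}. k < m})"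
    using le by (metis (no_types, lifting) DiffE card_insert_disjoint finite_Diff finite_subset
        mem_Collect_eq singletonI subsetI)
  moreover have "{k \<in> J. k < l} = {k \<in> J - {m}. k < l}" using le by auto
  ultimately show ?case by simp
next
  case (sym l m)
  then show ?case by blast
qed

section \<open>Signs, linearity and the contraction homotopy\<close>

context Module.module
begin

lemma alt_closed [simp]: "y \<in> carrier M \<Longrightarrow> alt M J l y \<in> carrier M"
  by (simp add: alt_def)

lemma alt_zero [simp]: "alt M J l \<zero>\<^bsub>M\<^esub> = \<zero>\<^bsub>M\<^esub>"
  by (simp add: alt_def)

lemma alt_alt [simp]: "y \<in> carrier M \<Longrightarrow> alt M J l (alt M J l y) = y"
  by (simp add: alt_def)

lemma alt_uminus: "alt M J l (\<ominus>\<^bsub>M\<^esub> y) = \<ominus>\<^bsub>M\<^esub> alt M J l y"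
  by (simp add: alt_def)

lemma smult_alt: "q \<in> carrier R \<Longrightarrow> y \<in> carrier M \<Longrightarrow> q \<odot>\<^bsub>M\<^esub> alt M J l y = alt M J l (q \<odot>\<^bsub>M\<^esub> y)"
  by (simp add: alt_def smult_r_minus)

lemma alt_add: "y \<in> carrier M \<Longrightarrow> z \<in> carrier M \<Longrightarrow> alt M J l (y \<oplus>\<^bsub>M\<^esub> z) = alt M J l y \<oplus>\<^bsub>M\<^esub> alt M J l z"
  by (simp add: alt_def M.minus_add)

lemma finsum_uminus:
  assumes "finite A" "f \<in> A \<rightarrow> carrier M"
  shows "(\<Oplus>\<^bsub>M\<^esub>i\<in>A. \<ominus>\<^bsub>M\<^esub> f i) = \<ominus>\<^bsub>M\<^esub> (\<Oplus>\<^bsub>M\<^esub>i\<in>A. f i)"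
proof -
  have "\<ominus>\<^bsub>M\<^esub> \<zero>\<^bsub>M\<^esub> = \<zero>\<^bsub>M\<^esub>" by (rule M.minus_equality) auto
  note zero = this
  from assms show ?thesis
  proof (induction A rule: finite_induct)
    case empty
    show ?case by (simp only: M.finsum_empty zero)
  qed (auto simp: M.minus_add Pi_iff)
qed

lemma finsum_alt:
  assumes "finite A" "f \<in> A \<rightarrow> carrier M"
  shows "(\<Oplus>\<^bsub>M\<^esub>i\<in>A. alt M J l (f i)) = alt M J l (\<Oplus>\<^bsub>M\<^esub>i\<in>A. f i)"
  using assms finsum_uminus[OF assms] by (simp add: alt_def)

lemma finsum_zero_eq: "(\<And>i. i \<in> A \<Longrightarrow> f i = \<zero>\<^bsub>M\<^esub>) \<Longrightarrow> (\<Oplus>\<^bsub>M\<^esub>i\<in>A. f i) = \<zero>\<^bsub>M\<^esub>"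
  by (rule M.add.finprod_one_eqI)

text \<open>The usual reason why the Koszul differential squares to zero: deleting two indices in
  either order gives opposite signs.\<close>

lemma alt_anticommute:
  assumes "finite J" "l \<in> J" "m \<in> J" "l \<noteq> m" "y \<in> carrier M"
  shows "alt M J l (alt M (J - {l}) m y) = \<ominus>\<^bsub>M\<^esub> alt M J m (alt M (J - {m}) l y)"
  using even_card_less_swap[OF assms(1-4)] assms(5) by (auto simp: alt_def)

lemma alt_anticommute':
  assumes "finite J" "l \<in> J" "m \<in> J" "l \<noteq> m" "y \<in> carrier M"
  shows "alt M (J - {l}) m (alt M (J - {m}) l y) = \<ominus>\<^bsub>M\<^esub> alt M J l (alt M J m y)"
  using even_card_less_swap[OF assms(1-4)] assms(5) by (auto simp: alt_def)

lemma koszul_diff_closed [simp]: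
  assumes "\<And>l. l \<in> J \<Longrightarrow> a l \<in> carrier R" "\<And>l. l \<in> J \<Longrightarrow> c (J - {l}) \<in> carrier M"
  shows "koszul_diff M a c J \<in> carrier M"
  unfolding koszul_diff_def using assms by (intro M.finsum_closed) auto

lemma koszul_diff_cong:
  assumes "\<And>l. l \<in> J \<Longrightarrow> a l \<in> carrier R" "\<And>l. l \<in> J \<Longrightarrow> c (J - {l}) \<in> carrier M"
    "\<And>l. l \<in> J \<Longrightarrow> a' l \<odot>\<^bsub>M\<^esub> c' (J - {l}) = a l \<odot>\<^bsub>M\<^esub> c (J - {l})"
  shows "koszul_diff M a' c' J = koszul_diff M a c J"
  unfolding koszul_diff_def using assms by (intro M.finsum_cong') auto

lemma koszul_diff_split:
  assumes "finite J" "l \<in> J" "\<And>l. l \<in> J \<Longrightarrow> a l \<in> carrier R" "\<And>l. l \<in> J \<Longrightarrow> c (J - {l}) \<in> carrier M"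
  shows "koszul_diff M a c J = alt M J l (a l \<odot>\<^bsub>M\<^esub> c (J - {l})) \<oplus>\<^bsub>M\<^esub>
    (\<Oplus>\<^bsub>M\<^esub>m\<in>J - {l}. alt M J m (a m \<odot>\<^bsub>M\<^esub> c (J - {m})))"
proof -
  have "koszul_diff M a c J = (\<Oplus>\<^bsub>M\<^esub>m\<in>insert l (J - {l}). alt M J m (a m \<odot>\<^bsub>M\<^esub> c (J - {m})))"
    unfolding koszul_diff_def using assms(2) by (simp add: insert_absorb)
  also have "\<dots> = alt M J l (a l \<odot>\<^bsub>M\<^esub> c (J - {l})) \<oplus>\<^bsub>M\<^esub>
    (\<Oplus>\<^bsub>M\<^esub>m\<in>J - {l}. alt M J m (a m \<odot>\<^bsub>M\<^esub> c (J - {m})))"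
    using assms by (intro M.finsum_insert) auto
  finally show ?thesis .
qed

lemma koszul_diff_add:
  assumes "finite J" "\<And>l. l \<in> J \<Longrightarrow> a l \<in> carrier R" "\<And>l. l \<in> J \<Longrightarrow> c (J - {l}) \<in> carrier M"
    "\<And>l. l \<in> J \<Longrightarrow> c' (J - {l}) \<in> carrier M"
  shows "koszul_diff M a (\<lambda>I. c I \<oplus>\<^bsub>M\<^esub> c' I) J = koszul_diff M a c J \<oplus>\<^bsub>M\<^esub> koszul_diff M a c' J"
proof -
  have "koszul_diff M a (\<lambda>I. c I \<oplus>\<^bsub>M\<^esub> c' I) J = (\<Oplus>\<^bsub>M\<^esub>l\<in>J. alt M J l (a l \<odot>\<^bsub>M\<^esub> c (J - {l})) \<oplus>\<^bsub>M\<^esub>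
      alt M J l (a l \<odot>\<^bsub>M\<^esub> c' (J - {l})))"
    unfolding koszul_diff_def using assms
    by (intro M.finsum_cong') (auto simp: smult_r_distr alt_add)
  also have "\<dots> = koszul_diff M a c J \<oplus>\<^bsub>M\<^esub> koszul_diff M a c' J"
    unfolding koszul_diff_def using assms by (intro M.finsum_addf) auto
  finally show ?thesis .
qed

lemma koszul_diff_smult:
  assumes "finite J" "q \<in> carrier R" "\<And>l. l \<in> J \<Longrightarrow> a l \<in> carrier R" "\<And>l. l \<in> J \<Longrightarrow> c (J - {l}) \<in>
      carrier M"
  shows "koszul_diff M a (\<lambda>I. q \<odot>\<^bsub>M\<^esub> c I) J = q \<odot>\<^bsub>M\<^esub> koszul_diff M a c J"
proof -
  have "koszul_diff M a (\<lambda>I. q \<odot>\<^bsub>M\<^esub> c I) J = (\<Oplus>\<^bsub>M\<^esub>l\<in>J. q \<odot>\<^bsub>M\<^esub> alt M J l (a l \<odot>\<^bsub>M\<^esub> c (J - {l})))"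
    unfolding koszul_diff_def using assms
    by (intro M.finsum_cong') (auto simp: smult_alt smult_assoc1[symmetric] R.m_comm)
  also have "\<dots> = q \<odot>\<^bsub>M\<^esub> koszul_diff M a c J"
    unfolding koszul_diff_def using assms by (intro finsum_smult_ldistr[symmetric]) auto
  finally show ?thesis .
qed

text \<open>Contraction by \<open>l\<close> is a homotopy from multiplication by \<^term>\<open>a l\<close> to zero.\<close>

definition contraction :: "nat \<Rightarrow> (nat set \<Rightarrow> 'c) \<Rightarrow> nat set \<Rightarrow> 'c" where
  "contraction l c I = (if l \<in> I then \<zero>\<^bsub>M\<^esub> else alt M (insert l I) l (c (insert l I)))"

text \<open>The homotopy formula expresses multiplication by \<open>a l\<close> as the differential
  of the contraction plus the contraction of the differential; the second summand is zero on a
  cocycle.\<close>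

lemma smult_eq_koszul_diff_contraction:
  assumes A: "finite A" "\<And>l. l \<in> A \<Longrightarrow> a l \<in> carrier R" and c: "\<And>I. I \<subseteq> A \<Longrightarrow> c I \<in> carrier M"
    and cocycle: "\<And>J. J \<subseteq> A \<Longrightarrow> koszul_diff M a c J = \<zero>\<^bsub>M\<^esub>" and l: "l \<in> A" and J: "J \<subseteq> A"
  shows "a l \<odot>\<^bsub>M\<^esub> c J = koszul_diff M a (contraction l c) J"
proof -
  have fin: "finite J" using A(1) J finite_subset by blast
  have aJ: "a m \<in> carrier R" if "m \<in> J" for m using A(2) J that by blast
  have cc: "contraction l c I \<in> carrier M" if "I \<subseteq> A" for I
    unfolding contraction_def using c that l by auto
  have ccJ: "contraction l c (J - {m}) \<in> carrier M" for m
    using cc J by blast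
  show ?thesis
  proof (cases "l \<in> J")
    case True
    \<comment> \<open>Every set \<open>J - {m}\<close> with \<open>m\<close> different from
      \<open>l\<close> still contains \<open>l\<close>, where the contraction vanishes. So only the
      summand at \<open>l\<close> survives, and its two equal signs cancel.\<close>
    have "koszul_diff M a (contraction l c) J = alt M J l (a l \<odot>\<^bsub>M\<^esub> contraction l c (J - {l})) \<oplus>\<^bsub>M\<^esub>
      (\<Oplus>\<^bsub>M\<^esub>m\<in>J - {l}. alt M J m (a m \<odot>\<^bsub>M\<^esub> contraction l c (J - {m})))"
      by (rule koszul_diff_split[where a = "a" and c = "contraction l c", OF fin True aJ ccJ])
    also have "(\<Oplus>\<^bsub>M\<^esub>m\<in>J - {l}. alt M J m (a m \<odot>\<^bsub>M\<^esub> contraction l c (J - {m}))) = \<zero>\<^bsub>M\<^esub>"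
      by (rule finsum_zero_eq) (use True aJ in \<open>auto simp: contraction_def\<close>)
    also have "contraction l c (J - {l}) = alt M J l (c J)"
      unfolding contraction_def using True by (simp add: insert_absorb)
    finally show ?thesis
      using aJ[OF True] c[OF J] by (simp add: smult_alt)
  next
    case False
    \<comment> \<open>For \<open>l\<close> outside \<open>J\<close> the claim is the cocycle
      condition at \<open>J'\<close>, solved for its summand at \<open>l\<close>.\<close>
    define J' where "J' = insert l J"
    have J': "J' \<subseteq> A" "finite J'" "J = J' - {l}" "l \<in> J'" unfolding J'_def using J l fin False by
        auto
    have aJ': "a m \<in> carrier R" if "m \<in> J'" for m using A(2) J' that by blast
    have cJ': "c (J' - {m}) \<in> carrier M" for m using c J' by blast
    have "koszul_diff M a (contraction l c) J = (\<Oplus>\<^bsub>M\<^esub>m\<in>J. \<ominus>\<^bsub>M\<^esub> alt M J' l (alt M J' m (a m \<odot>\<^bsub>M\<^esub> c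
        (J' - {m}))))"
      unfolding koszul_diff_def
    proof (intro M.finsum_cong')
      fix m assume m: "m \<in> J"
      then have ml: "m \<noteq> l" "m \<in> J'" using False J'(3) by auto
      have "contraction l c (J - {m}) = alt M (J' - {m}) l (c (J' - {m}))"
        unfolding contraction_def using False m ml by (auto simp: J'_def insert_Diff_if)
      then have "alt M J m (a m \<odot>\<^bsub>M\<^esub> contraction l c (J - {m})) =
          alt M (J' - {l}) m (alt M (J' - {m}) l (a m \<odot>\<^bsub>M\<^esub> c (J' - {m})))"
        using aJ[OF m] cJ' J'(3) by (simp add: smult_alt)
      also have "\<dots> = \<ominus>\<^bsub>M\<^esub> alt M J' l (alt M J' m (a m \<odot>\<^bsub>M\<^esub> c (J' - {m})))"
        using aJ[OF m] cJ' J' ml by (intro alt_anticommute') auto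
      finally show "alt M J m (a m \<odot>\<^bsub>M\<^esub> contraction l c (J - {m})) =
          \<ominus>\<^bsub>M\<^esub> alt M J' l (alt M J' m (a m \<odot>\<^bsub>M\<^esub> c (J' - {m})))" .
    qed (use aJ cJ' in auto)
    also have "\<dots> = \<ominus>\<^bsub>M\<^esub> alt M J' l (\<Oplus>\<^bsub>M\<^esub>m\<in>J. alt M J' m (a m \<odot>\<^bsub>M\<^esub> c (J' - {m})))" (is "_ = \<ominus>\<^bsub>M\<^esub>
        alt M J' l ?S")
      using aJ cJ' fin by (subst finsum_uminus) (auto simp: finsum_alt)
    also have "?S = \<ominus>\<^bsub>M\<^esub> alt M J' l (a l \<odot>\<^bsub>M\<^esub> c J)"
    proof -
      have "alt M J' l (a l \<odot>\<^bsub>M\<^esub> c J) \<oplus>\<^bsub>M\<^esub> ?S = \<zero>\<^bsub>M\<^esub>"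
        using koszul_diff_split[where a = "a" and c = "c", OF J'(2,4) aJ' cJ'] cocycle[OF J'(1)]
            J'(3) by simp
      moreover have "?S \<in> carrier M" "a l \<odot>\<^bsub>M\<^esub> c J \<in> carrier M"
        using aJ cJ' A l c J by (auto intro!: M.finsum_closed)
      ultimately show ?thesis
        using M.minus_equality[of ?S "alt M J' l (a l \<odot>\<^bsub>M\<^esub> c J)"] by (simp add: M.a_comm)
    qed
    finally show ?thesis using A l c J by (simp add: alt_uminus)
  qed
qed

lemma additive_subgroup_inv: "additive_subgroup G M \<Longrightarrow> y \<in> G \<Longrightarrow> \<ominus>\<^bsub>M\<^esub> y \<in> G"
  using M.add.subgroupE(3)[OF additive_subgroup.a_subgroup] by (simp add: a_inv_def)

section \<open>From a sequence to the sequence of its powers\<close>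

lemma koszul_exact_cong:
  assumes "koszul_exact M A a G" "\<And>I. I \<subseteq> A \<Longrightarrow> G I = G' I" "\<And>l. l \<in> A \<Longrightarrow> a l = a' l"
    "\<And>l. l \<in> A \<Longrightarrow> a l \<in> carrier R" "\<And>I. I \<subseteq> A \<Longrightarrow> G I \<subseteq> carrier M"
  shows "koszul_exact M A a' G'"
proof (rule koszul_exactI)
  fix c assume c: "\<And>I. I \<subseteq> A \<Longrightarrow> c I \<in> G' I" "\<And>J. J \<subseteq> A \<Longrightarrow> koszul_diff M a' c J = \<zero>\<^bsub>M\<^esub>"
  have eq: "koszul_diff M a' f J = koszul_diff M a f J" if "\<forall>I\<subseteq>A. f I \<in> G I" "J \<subseteq> A" for f J
  proof (rule koszul_diff_cong)
    fix l assume l: "l \<in> J"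
    then show "a l \<in> carrier R" "a' l \<odot>\<^bsub>M\<^esub> f (J - {l}) = a l \<odot>\<^bsub>M\<^esub> f (J - {l})"
      using assms(3,4) that(2) by (auto simp: subset_iff)
    have "J - {l} \<subseteq> A" using that(2) by blast
    then show "f (J - {l}) \<in> carrier M" using assms(5) that(1) by blast
  qed
  have cG: "\<And>I. I \<subseteq> A \<Longrightarrow> c I \<in> G I" using c(1) assms(2) by simp
  then have "\<And>J. J \<subseteq> A \<Longrightarrow> koszul_diff M a c J = \<zero>\<^bsub>M\<^esub>" using c(2) eq[of c] by simp
  with cG obtain h where h: "\<And>I. I \<subseteq> A \<Longrightarrow> h I \<in> G I" "\<And>I. I \<subseteq> A \<Longrightarrow> c I = koszul_diff M a h I"
    using koszul_exactD[OF assms(1), of c] by blast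
  with eq[of h] assms(2) show "\<exists>h. (\<forall>I\<subseteq>A. h I \<in> G' I) \<and> (\<forall>I\<subseteq>A. c I = koszul_diff M a' h I)"
    by (intro exI[of _ h]) auto
qed

text \<open>The cone of a composition is an extension of the cones of its two factors.\<close>

lemma koszul_exact_mult:
  assumes A: "finite A" "\<And>l. l \<in> A \<Longrightarrow> a l \<in> carrier R" and l: "l \<in> A"
    and pq: "p \<in> carrier R" "q \<in> carrier R"
    and G: "\<And>I. I \<subseteq> A \<Longrightarrow> additive_subgroup (G I) M"
    and H: "\<And>I. I \<subseteq> A - {l} \<Longrightarrow> additive_subgroup (H I) M"
    and p: "\<And>I y. I \<subseteq> A - {l} \<Longrightarrow> y \<in> G I \<Longrightarrow> p \<odot>\<^bsub>M\<^esub> y \<in> H I"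
    and q: "\<And>I y. I \<subseteq> A - {l} \<Longrightarrow> y \<in> H I \<Longrightarrow> q \<odot>\<^bsub>M\<^esub> y \<in> G (insert l I)"
    and exact_p: "koszul_exact M A (a(l := p)) (\<lambda>I. if l \<in> I then H (I - {l}) else G I)"
    and exact_q: "koszul_exact M A (a(l := q)) (\<lambda>I. if l \<in> I then G I else H I)"
  shows "koszul_exact M A (a(l := p \<otimes> q)) G"
proof (rule koszul_exactI)
  fix c assume cG: "\<And>I. I \<subseteq> A \<Longrightarrow> c I \<in> G I"
    and cocycle: "\<And>J. J \<subseteq> A \<Longrightarrow> koszul_diff M (a(l := p \<otimes> q)) c J = \<zero>\<^bsub>M\<^esub>"
  let ?ap = "a(l := p)" and ?aq = "a(l := q)" and ?apq = "a(l := p \<otimes> q)"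
  have GM: "y \<in> carrier M" if "y \<in> G I" "I \<subseteq> A" for y I
    using additive_subgroup.a_subset[OF G[OF that(2)]] that(1) by blast
  have HM: "y \<in> carrier M" if "y \<in> H I" "I \<subseteq> A - {l}" for y I
    using additive_subgroup.a_subset[OF H[OF that(2)]] that(1) by blast
  have fin: "finite J" if "J \<subseteq> A" for J using A(1) that finite_subset by blast
  have a: "a m \<in> carrier R" "?ap m \<in> carrier R" "?aq m \<in> carrier R" "?apq m \<in> carrier R"
    if "m \<in> J" "J \<subseteq> A" for m J using A(2) that pq by auto
  have c: "c I \<in> carrier M" if "I \<subseteq> A" for I using cG GM that by blast
  have cD: "c (I - {m}) \<in> carrier M" if "I \<subseteq> A" for I m using c that by blast
  \<comment> \<open>A cochain has a part off \<open>l\<close> and a part on the sets containing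
    \<open>l\<close>. Multiplying the former by \<open>p\<close> and keeping the latter maps the
    complex with \<open>p \<otimes> q\<close> at \<open>l\<close> to the complex with
    \<open>q\<close> at \<open>l\<close>.\<close>
  define t where "t I = (if l \<in> I then c I else p \<odot>\<^bsub>M\<^esub> c I)" for I
  have tG: "t I \<in> (if l \<in> I then G I else H I)" if "I \<subseteq> A" for I
    unfolding t_def using cG[OF that] p[of I] that by (auto simp: subset_insert_iff)
  have tD: "t (I - {m}) \<in> carrier M" if "I \<subseteq> A" for I m
    unfolding t_def using cD that pq by auto
  have t_cocycle: "koszul_diff M ?aq t J = \<zero>\<^bsub>M\<^esub>" if J: "J \<subseteq> A" for J
  proof (cases "l \<in> J")
    case True
    have "koszul_diff M ?aq t J = koszul_diff M ?apq c J"
    proof (rule koszul_diff_cong[where a = ?apq and c = c, OF a(4)[OF _ J] cD[OF J]])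
      fix m assume "m \<in> J"
      then show "?aq m \<odot>\<^bsub>M\<^esub> t (J - {m}) = ?apq m \<odot>\<^bsub>M\<^esub> c (J - {m})"
        using True pq cD[OF J] by (simp add: t_def smult_assoc1[symmetric] R.m_comm)
    qed
    then show ?thesis using cocycle[OF J] by simp
  next
    case False
    have "koszul_diff M ?aq t J = koszul_diff M ?apq (\<lambda>I. p \<odot>\<^bsub>M\<^esub> c I) J"
      using False a(4)[OF _ J] cD[OF J] pq by (intro koszul_diff_cong) (auto simp: t_def)
    also have "\<dots> = p \<odot>\<^bsub>M\<^esub> koszul_diff M ?apq c J"
      by (rule koszul_diff_smult[where a = ?apq and c = c, OF fin[OF J] pq(1) a(4)[OF _ J] cD[OF
          J]])
    finally show ?thesis using cocycle[OF J] pq by simp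
  qed
  obtain g where gG: "\<And>I. I \<subseteq> A \<Longrightarrow> g I \<in> (if l \<in> I then G I else H I)"
    and g: "\<And>I. I \<subseteq> A \<Longrightarrow> t I = koszul_diff M ?aq g I"
    using koszul_exactD[OF exact_q tG t_cocycle] by blast
  have gM: "g I \<in> carrier M" if "I \<subseteq> A" for I
    using gG[OF that] GM[of "g I" I] HM[of "g I" I] that by (auto simp: subset_insert_iff split:
        if_splits)
  have gD: "g (I - {m}) \<in> carrier M" if "I \<subseteq> A" for I m using gM that by blast
  \<comment> \<open>Off \<open>l\<close>, the primitive \<open>g\<close> shows that \<open>p\<close>
    times \<open>c\<close> is the differential of \<open>g\<close>. Hence \<open>c\<close> off
    \<open>l\<close>, completed by signed values of \<open>g\<close> on the sets containing
    \<open>l\<close>, is a cocycle for the complex with \<open>p\<close> at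
    \<open>l\<close>.\<close>
  define u where "u I = (if l \<in> I then alt M I l (g (I - {l})) else c I)" for I
  have uG: "u I \<in> (if l \<in> I then H (I - {l}) else G I)" if I: "I \<subseteq> A" for I
  proof (cases "l \<in> I")
    case True
    have "I - {l} \<subseteq> A" "I - {l} \<subseteq> A - {l}" using I by auto
    then show ?thesis
      using True gG[of "I - {l}"] H[of "I - {l}"]
      by (auto simp: u_def alt_def intro!: additive_subgroup_inv)
  qed (use cG[OF I] in \<open>simp add: u_def\<close>)
  have uD: "u (I - {m}) \<in> carrier M" if "I \<subseteq> A" for I m
    unfolding u_def using cD[OF that] gD[of "I - {m}" l] subset_trans[OF Diff_subset that] by auto
  have u_cocycle: "koszul_diff M ?ap u J = \<zero>\<^bsub>M\<^esub>" if J: "J \<subseteq> A" for J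
  proof (cases "l \<in> J")
    case False
    have "koszul_diff M ?ap u J = koszul_diff M ?apq c J"
      using False a(4)[OF _ J] cD[OF J] by (intro koszul_diff_cong) (auto simp: u_def)
    then show ?thesis using cocycle[OF J] by simp
  next
    case True
    have Jl: "J - {l} \<subseteq> A" using J by blast
    have gDD: "g (J - {l} - {m}) \<in> carrier M" for m by (rule gD[OF Jl])
    have "alt M J l (p \<odot>\<^bsub>M\<^esub> c (J - {l})) = alt M J l (koszul_diff M ?aq g (J - {l}))"
      using g[OF Jl] by (simp add: t_def)
    also have "\<dots> = (\<Oplus>\<^bsub>M\<^esub>m\<in>J - {l}. alt M J l (alt M (J - {l}) m (?aq m \<odot>\<^bsub>M\<^esub> g (J - {l} - {m}))))"
      unfolding koszul_diff_def using a(3)[OF _ J] gDD fin[OF J]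
      by (intro finsum_alt[symmetric]) auto
    finally have head: "alt M J l (p \<odot>\<^bsub>M\<^esub> c (J - {l})) = \<dots>" .
    have "(\<Oplus>\<^bsub>M\<^esub>m\<in>J - {l}. alt M J m (?ap m \<odot>\<^bsub>M\<^esub> u (J - {m}))) =
      (\<Oplus>\<^bsub>M\<^esub>m\<in>J - {l}. \<ominus>\<^bsub>M\<^esub> alt M J l (alt M (J - {l}) m (?aq m \<odot>\<^bsub>M\<^esub> g (J - {l} - {m}))))"
    proof (intro M.finsum_cong')
      fix m assume m: "m \<in> J - {l}"
      then have am: "a m \<in> carrier R" "?ap m = a m" "?aq m = a m" using a(1)[OF _ J] by auto
      have "J - {m} - {l} = J - {l} - {m}" by blast
      then have "u (J - {m}) = alt M (J - {m}) l (g (J - {l} - {m}))"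
        unfolding u_def using m True by simp
      then have "alt M J m (?ap m \<odot>\<^bsub>M\<^esub> u (J - {m})) = alt M J m (alt M (J - {m}) l (a m \<odot>\<^bsub>M\<^esub> g (J
          - {l} - {m})))"
        using am gDD by (simp add: smult_alt)
      also have "\<dots> = \<ominus>\<^bsub>M\<^esub> alt M J l (alt M (J - {l}) m (a m \<odot>\<^bsub>M\<^esub> g (J - {l} - {m})))"
        using am gDD m True fin[OF J] by (intro alt_anticommute) auto
      finally show "alt M J m (?ap m \<odot>\<^bsub>M\<^esub> u (J - {m})) =
          \<ominus>\<^bsub>M\<^esub> alt M J l (alt M (J - {l}) m (?aq m \<odot>\<^bsub>M\<^esub> g (J - {l} - {m})))"
        using am by simp
    qed (use a(3)[OF _ J] gDD in auto)
    also have "\<dots> = \<ominus>\<^bsub>M\<^esub> (\<Oplus>\<^bsub>M\<^esub>m\<in>J - {l}. alt M J l (alt M (J - {l}) m (?aq m \<odot>\<^bsub>M\<^esub> g (J - {l} -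
        {m}))))"
      using a(3)[OF _ J] gDD fin[OF J] by (intro finsum_uminus) auto
    finally have tail: "(\<Oplus>\<^bsub>M\<^esub>m\<in>J - {l}. alt M J m (?ap m \<odot>\<^bsub>M\<^esub> u (J - {m}))) = \<dots>" .
    have "koszul_diff M ?ap u J = alt M J l (?ap l \<odot>\<^bsub>M\<^esub> u (J - {l})) \<oplus>\<^bsub>M\<^esub>
      (\<Oplus>\<^bsub>M\<^esub>m\<in>J - {l}. alt M J m (?ap m \<odot>\<^bsub>M\<^esub> u (J - {m})))"
      by (rule koszul_diff_split[where a = "?ap" and c = "u", OF fin[OF J] True a(2)[OF _ J] uD[OF
          J]])
    also have "alt M J l (?ap l \<odot>\<^bsub>M\<^esub> u (J - {l})) = alt M J l (p \<odot>\<^bsub>M\<^esub> c (J - {l}))"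
      by (simp add: u_def)
    finally have diff: "koszul_diff M ?ap u J = alt M J l (p \<odot>\<^bsub>M\<^esub> c (J - {l})) \<oplus>\<^bsub>M\<^esub>
      (\<Oplus>\<^bsub>M\<^esub>m\<in>J - {l}. alt M J m (?ap m \<odot>\<^bsub>M\<^esub> u (J - {m})))" .
    have "(\<Oplus>\<^bsub>M\<^esub>m\<in>J - {l}. alt M J l (alt M (J - {l}) m (?aq m \<odot>\<^bsub>M\<^esub> g (J - {l} - {m})))) \<in> carrier M"
      using a(3)[OF _ J] gDD by (intro M.finsum_closed) auto
    with diff show ?thesis unfolding tail head by (simp only: M.r_neg)
  qed
  obtain h where hG: "\<And>I. I \<subseteq> A \<Longrightarrow> h I \<in> (if l \<in> I then H (I - {l}) else G I)"
    and h: "\<And>I. I \<subseteq> A \<Longrightarrow> u I = koszul_diff M ?ap h I"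
    using koszul_exactD[OF exact_p uG u_cocycle] by blast
  have hM: "h I \<in> carrier M" if "I \<subseteq> A" for I
    using hG[OF that] GM[of "h I" I] HM[of "h I" "I - {l}"] that by (auto split: if_splits)
  have hD: "h (I - {m}) \<in> carrier M" if "I \<subseteq> A" for I m using hM that by blast
  \<comment> \<open>The two primitives are spliced: \<open>h\<close> settles the part off
    \<open>l\<close>. On the sets containing \<open>l\<close>, \<open>q\<close> times the equation
    for \<open>h\<close> yields the contribution of \<open>g\<close> off \<open>l\<close>, and the
    added \<open>g I\<close> supplies the rest of the equation for \<open>g\<close>.\<close>
  define k where "k I = (if l \<in> I then q \<odot>\<^bsub>M\<^esub> h I \<oplus>\<^bsub>M\<^esub> g I else h I)" for I
  have "k I \<in> G I" if I: "I \<subseteq> A" for I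
  proof (cases "l \<in> I")
    case True
    then have "q \<odot>\<^bsub>M\<^esub> h I \<in> G I"
      using q[of "I - {l}" "h I"] hG[OF I] I by (auto simp: insert_absorb)
    then show ?thesis
      using True gG[OF I] additive_subgroup.a_closed[OF G[OF I]] by (simp add: k_def)
  qed (use hG[OF I] in \<open>simp add: k_def\<close>)
  moreover have "c I = koszul_diff M ?apq k I" if I: "I \<subseteq> A" for I
  proof (cases "l \<in> I")
    case False
    have "koszul_diff M ?apq k I = koszul_diff M ?ap h I"
      using False a(2)[OF _ I] hD[OF I] by (intro koszul_diff_cong) (auto simp: k_def)
    then show ?thesis using h[OF I] False by (simp add: u_def)
  next
    case True
    have kD: "k (I - {m}) \<in> carrier M" for m
      unfolding k_def using hD[OF I] gD[OF I] pq by auto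
    let ?T = "\<lambda>f. (\<Oplus>\<^bsub>M\<^esub>m\<in>I - {l}. alt M I m (a m \<odot>\<^bsub>M\<^esub> f (I - {m})))"
    have aI: "m \<in> I \<Longrightarrow> a m \<in> carrier R" for m using a(1)[OF _ I] by blast
    have T_closed: "?T f \<in> carrier M" if "\<And>m. f (I - {m}) \<in> carrier M" for f
      using that aI by (auto intro!: M.finsum_closed)
    have T: "(\<Oplus>\<^bsub>M\<^esub>m\<in>I - {l}. alt M I m ((a(l := b)) m \<odot>\<^bsub>M\<^esub> f (I - {m}))) = ?T f"
      if "\<And>m. f (I - {m}) \<in> carrier M" for f b
      using that aI by (intro M.finsum_cong') auto
    have "?T k = (\<Oplus>\<^bsub>M\<^esub>m\<in>I - {l}. q \<odot>\<^bsub>M\<^esub> alt M I m (a m \<odot>\<^bsub>M\<^esub> h (I - {m})) \<oplus>\<^bsub>M\<^esub>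
        alt M I m (a m \<odot>\<^bsub>M\<^esub> g (I - {m})))"
    proof (intro M.finsum_cong')
      fix m assume "m \<in> I - {l}"
      then show "alt M I m (a m \<odot>\<^bsub>M\<^esub> k (I - {m})) = q \<odot>\<^bsub>M\<^esub> alt M I m (a m \<odot>\<^bsub>M\<^esub> h (I - {m})) \<oplus>\<^bsub>M\<^esub>
        alt M I m (a m \<odot>\<^bsub>M\<^esub> g (I - {m}))"
        using True aI[of m] hD[OF I] gD[OF I] pq
        by (simp add: k_def smult_r_distr alt_add smult_alt smult_assoc1[symmetric] R.m_comm)
    qed (use aI hD[OF I] gD[OF I] pq in auto)
    also have "\<dots> = (\<Oplus>\<^bsub>M\<^esub>m\<in>I - {l}. q \<odot>\<^bsub>M\<^esub> alt M I m (a m \<odot>\<^bsub>M\<^esub> h (I - {m}))) \<oplus>\<^bsub>M\<^esub> ?T g"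
      using aI hD[OF I] gD[OF I] pq by (intro M.finsum_addf) auto
    also have "(\<Oplus>\<^bsub>M\<^esub>m\<in>I - {l}. q \<odot>\<^bsub>M\<^esub> alt M I m (a m \<odot>\<^bsub>M\<^esub> h (I - {m}))) = q \<odot>\<^bsub>M\<^esub> ?T h"
      using aI hD[OF I] pq fin[OF I] by (intro finsum_smult_ldistr[symmetric]) auto
    finally have Tk: "?T k = q \<odot>\<^bsub>M\<^esub> ?T h \<oplus>\<^bsub>M\<^esub> ?T g" .
    have "koszul_diff M ?apq k I = alt M I l ((p \<otimes> q) \<odot>\<^bsub>M\<^esub> h (I - {l})) \<oplus>\<^bsub>M\<^esub> ?T k"
      using koszul_diff_split[where a = "?apq" and c = "k", OF fin[OF I] True a(4)[OF _ I] kD]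
          T[where f = k, OF kD] by (simp add: k_def)
    also have "alt M I l ((p \<otimes> q) \<odot>\<^bsub>M\<^esub> h (I - {l})) = q \<odot>\<^bsub>M\<^esub> alt M I l (p \<odot>\<^bsub>M\<^esub> h (I - {l}))"
      using pq hD[OF I] by (simp add: smult_alt smult_assoc1[symmetric] R.m_comm)
    also have "\<dots> \<oplus>\<^bsub>M\<^esub> ?T k = q \<odot>\<^bsub>M\<^esub> (alt M I l (p \<odot>\<^bsub>M\<^esub> h (I - {l})) \<oplus>\<^bsub>M\<^esub> ?T h) \<oplus>\<^bsub>M\<^esub> ?T g"
      unfolding Tk using pq hD[OF I] gD[OF I] T_closed by (simp add: smult_r_distr M.a_assoc)
    also have "alt M I l (p \<odot>\<^bsub>M\<^esub> h (I - {l})) \<oplus>\<^bsub>M\<^esub> ?T h = koszul_diff M ?ap h I"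
      using koszul_diff_split[where a = "?ap" and c = "h", OF fin[OF I] True a(2)[OF _ I] hD[OF
          I]] T[where f = h, OF hD[OF I]] by simp
    also have "q \<odot>\<^bsub>M\<^esub> koszul_diff M ?ap h I = alt M I l (q \<odot>\<^bsub>M\<^esub> g (I - {l}))"
      using h[OF I, symmetric] True pq gD[OF I] by (simp add: u_def smult_alt)
    also have "\<dots> \<oplus>\<^bsub>M\<^esub> ?T g = koszul_diff M ?aq g I"
      using koszul_diff_split[where a = "?aq" and c = "g", OF fin[OF I] True a(3)[OF _ I] gD[OF
          I]] T[where f = g, OF gD[OF I]] by simp
    also have "\<dots> = c I" using g[OF I] True by (simp add: t_def)
    finally show ?thesis by (rule sym)
  qed
  ultimately show "\<exists>h. (\<forall>I\<subseteq>A. h I \<in> G I) \<and> (\<forall>I\<subseteq>A. c I = koszul_diff M ?apq h I)" by blast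
qed

lemma smult_pow_graded:
  assumes "x \<in> carrier R" "\<And>i. Mgr i \<subseteq> carrier M" "\<And>i y. y \<in> Mgr i \<Longrightarrow> x \<odot>\<^bsub>M\<^esub> y \<in> Mgr (i + \<delta>)"
    "y \<in> Mgr i"
  shows "(x [^] (s::nat)) \<odot>\<^bsub>M\<^esub> y \<in> Mgr (i + int s * \<delta>)"
proof (induction s)
  case 0
  then show ?case using assms(2)[of i] assms(4) by auto
next
  case (Suc s)
  have "y \<in> carrier M" using assms(2)[of i] assms(4) by auto
  then have "(x [^] Suc s) \<odot>\<^bsub>M\<^esub> y = x \<odot>\<^bsub>M\<^esub> ((x [^] s) \<odot>\<^bsub>M\<^esub> y)"
    using assms(1) by (simp add: smult_assoc1[symmetric] R.m_comm)
  also have "\<dots> \<in> Mgr (i + int s * \<delta> + \<delta>)" by (rule assms(3)[OF Suc])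
  finally show ?case by (simp add: algebra_simps)
qed

text \<open>Induction on the total exponent, splitting x_l^s as x_l times x_l^(s-1). The exponents
  must be allowed to differ, since the induction lowers one of them at a time. Exactness is assumed
  for every degree above \<open>b\<close> because the second factor is used one degree
  higher.\<close>

lemma koszul_exact_powers:
  assumes A: "finite A" "\<And>l. l \<in> A \<Longrightarrow> x l \<in> carrier R"
    and Mgr: "\<And>i::int. additive_subgroup (Mgr i) M"
    and x: "\<And>l i y. l \<in> A \<Longrightarrow> y \<in> Mgr i \<Longrightarrow> x l \<odot>\<^bsub>M\<^esub> y \<in> Mgr (i + 1)"
    and exact: "\<And>j. j > b \<Longrightarrow> koszul_exact M A x (\<lambda>I. Mgr (j + int (card I)))"
    and s: "\<And>l. l \<in> A \<Longrightarrow> s l > (0::nat)" and j: "j > b"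
  shows "koszul_exact M A (\<lambda>l. x l [^] s l) (\<lambda>I. Mgr (j + (\<Sum>l\<in>I. int (s l))))"
  using s j
proof (induction "\<Sum>l\<in>A. s l" arbitrary: s j rule: less_induct)
  case less
  have Mc: "Mgr i \<subseteq> carrier M" for i using additive_subgroup.a_subset[OF Mgr] .
  show ?case
  proof (cases "\<forall>l\<in>A. s l = 1")
    case True
    show ?thesis
    proof (rule koszul_exact_cong[OF exact[OF less.prems(2)]])
      fix I assume "I \<subseteq> A"
      then have "(\<Sum>l\<in>I. int (s l)) = (\<Sum>l\<in>I. 1)" using True by (intro sum.cong) auto
      then show "Mgr (j + int (card I)) = Mgr (j + (\<Sum>l\<in>I. int (s l)))" by simp
    qed (use A Mc True in auto)
  next
    case False
    then obtain l where l: "l \<in> A" "s l \<noteq> 1" by blast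
    then have sl: "s l > 1" using less.prems(1)[of l] by auto
    define a where "a m = x m [^] s m" for m
    define p q where "p = x l" and "q = x l [^] (s l - 1)"
    have less_sum: "(\<Sum>m\<in>A. (s(l := t)) m) < (\<Sum>m\<in>A. s m)" if "t < s l" for t
      using A(1) l(1) that by (intro sum_strict_mono_ex1) auto
    have IH: "koszul_exact M A (\<lambda>m. x m [^] (s(l := t)) m) (\<lambda>I. Mgr (i + (\<Sum>m\<in>I. int ((s(l := t))
        m))))"
      if "t < s l" "0 < t" "i > b" for t i
      using less.hyps[OF less_sum[OF that(1)]] less.prems(1) that by auto
    \<comment> \<open>The group between the two multiplications. The factor \<open>p = x l\<close>
      has degree 1, whence \<open>j + 1\<close>; as an off-\<open>l\<close> group it belongs to the
      complex with exponent \<open>s l - 1\<close> at \<open>l\<close>, started in degree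
      \<open>j + 1\<close>.\<close>
    define H where "H I = Mgr (j + 1 + (\<Sum>m\<in>I. int (s m)))" for I
    have sum_upd: "(\<Sum>m\<in>I. int (if m = l then t else s m)) =
        (if l \<in> I then (\<Sum>m\<in>I - {l}. int (s m)) + int t else (\<Sum>m\<in>I. int (s m)))" if "I \<subseteq> A" for I t
    proof -
      have "finite I" using A(1) that finite_subset by blast
      moreover have "(\<Sum>m\<in>I - {l}. int (if m = l then t else s m)) = (\<Sum>m\<in>I - {l}. int (s m))"
        by (intro sum.cong) auto
      moreover have "(\<Sum>m\<in>I. int (if m = l then t else s m)) = (\<Sum>m\<in>I. int (s m))" if "l \<notin> I"
        using that by (intro sum.cong) auto
      ultimately show ?thesis
        by (auto simp: sum.remove[of I l])
    qed
    have sum_l: "(\<Sum>m\<in>I. int (s m)) = (\<Sum>m\<in>I - {l}. int (s m)) + int (s l)" if "I \<subseteq> A" "l \<in> I" for I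
      using that A(1) by (subst sum.remove[of I l]) (auto intro: finite_subset)
    have "koszul_exact M A (a(l := p \<otimes> q)) (\<lambda>I. Mgr (j + (\<Sum>m\<in>I. int (s m))))"
    proof (rule koszul_exact_mult[where H = H])
      show "koszul_exact M A (a(l := p)) (\<lambda>I. if l \<in> I then H (I - {l}) else Mgr (j + (\<Sum>m\<in>I. int
          (s m))))"
        by (rule koszul_exact_cong[OF IH[of 1 j]])
          (use sl less.prems A l Mc in \<open>auto simp: sum_upd a_def p_def H_def algebra_simps\<close>)
      show "koszul_exact M A (a(l := q)) (\<lambda>I. if l \<in> I then Mgr (j + (\<Sum>m\<in>I. int (s m))) else H I)"
        by (rule koszul_exact_cong[OF IH[of "s l - 1" "j + 1"]])
          (use sl less.prems A l Mc in \<open>auto simp: sum_upd sum_l a_def q_def H_def algebra_simps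
              of_nat_diff\<close>)
      show "p \<odot>\<^bsub>M\<^esub> y \<in> H I" if "y \<in> Mgr (j + (\<Sum>m\<in>I. int (s m)))" for I y
        using x[OF l(1) that] by (simp add: p_def H_def algebra_simps)
      show "q \<odot>\<^bsub>M\<^esub> y \<in> Mgr (j + (\<Sum>m\<in>insert l I. int (s m)))" if "I \<subseteq> A - {l}" "y \<in> H I" for I y
      proof -
        have "finite I" "l \<notin> I" using that A(1) by (auto intro: finite_subset)
        then show ?thesis
          using smult_pow_graded[of "x l" Mgr 1 y "j + 1 + (\<Sum>m\<in>I. int (s m))" "s l - 1"] A l Mc x
              that sl
          by (simp add: q_def H_def of_nat_diff algebra_simps)
      qed
    qed (use A l Mgr in \<open>auto simp: a_def p_def q_def H_def\<close>)
    moreover have "a(l := p \<otimes> q) = a"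
    proof -
      have "x l [^] Suc (s l - 1) = p \<otimes> q"
        using A l unfolding p_def q_def by (simp add: R.m_comm)
      then show ?thesis using sl by (auto simp: a_def)
    qed
    ultimately show ?thesis by (simp add: a_def[abs_def])
  qed
qed

end

section \<open>Localization and Cech cohomology\<close>

context Module.module
begin

lemma smult_pow_add:
  assumes "f \<in> carrier R" "x \<in> carrier M"
  shows "(f [^] (a::nat)) \<odot>\<^bsub>M\<^esub> ((f [^] (b::nat)) \<odot>\<^bsub>M\<^esub> x) = (f [^] (a + b)) \<odot>\<^bsub>M\<^esub> x"
  using assms by (simp add: smult_assoc1[symmetric] R.nat_pow_mult)

lemma mfrac_rel_iff:
  "((x, s), (y, t)) \<in> mfrac_rel R M f \<longleftrightarrow> x \<in> carrier M \<and> y \<in> carrier M \<and>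
    (\<exists>u::nat. (f [^] (u + t)) \<odot>\<^bsub>M\<^esub> x = (f [^] (u + s)) \<odot>\<^bsub>M\<^esub> y)"
  by (simp add: mfrac_rel_def)

lemma equiv_mfrac_rel:
  assumes f: "f \<in> carrier R"
  shows "equiv (carrier M \<times> UNIV) (mfrac_rel R M f)"
proof (rule equivI)
  show "mfrac_rel R M f \<subseteq> (carrier M \<times> UNIV) \<times> (carrier M \<times> UNIV)"
    by (auto simp: mfrac_rel_def)
  show "refl_on (carrier M \<times> UNIV) (mfrac_rel R M f)"
    by (auto simp: refl_on_def mfrac_rel_def)
  show "sym (mfrac_rel R M f)"
    by (auto simp: sym_def mfrac_rel_def dest: HOL.sym)
  show "trans (mfrac_rel R M f)"
  proof (rule transI)
    fix p q r assume "(p, q) \<in> mfrac_rel R M f" "(q, r) \<in> mfrac_rel R M f"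
    moreover obtain x s y t z v where pqr: "p = (x, s)" "q = (y, t)" "r = (z, v)"
      by (metis surj_pair)
    ultimately obtain a b where c: "x \<in> carrier M" "y \<in> carrier M" "z \<in> carrier M"
      and a: "(f [^] (a + t)) \<odot>\<^bsub>M\<^esub> x = (f [^] (a + s)) \<odot>\<^bsub>M\<^esub> y"
      and b: "(f [^] (b + v)) \<odot>\<^bsub>M\<^esub> y = (f [^] (b + t)) \<odot>\<^bsub>M\<^esub> z"
      by (auto simp: mfrac_rel_iff)
    \<comment> \<open>The middle denominator \<open>t\<close> has to be part of the witness
      \<open>a + b + t\<close>: it lets both given equations be applied one after the other.\<close>
    have "(f [^] ((a + b + t) + v)) \<odot>\<^bsub>M\<^esub> x = (f [^] (b + v)) \<odot>\<^bsub>M\<^esub> ((f [^] (a + t)) \<odot>\<^bsub>M\<^esub> x)"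
      using f c by (simp add: smult_pow_add add_ac)
    also have "\<dots> = (f [^] (a + s)) \<odot>\<^bsub>M\<^esub> ((f [^] (b + v)) \<odot>\<^bsub>M\<^esub> y)"
      unfolding a using f c by (simp add: smult_pow_add add_ac)
    also have "\<dots> = (f [^] ((a + b + t) + s)) \<odot>\<^bsub>M\<^esub> z"
      unfolding b using f c by (simp add: smult_pow_add add_ac)
    finally show "(p, r) \<in> mfrac_rel R M f"
      using c unfolding pqr mfrac_rel_iff by blast
  qed
qed

lemma mfrac_eq_iff:
  assumes "f \<in> carrier R" "x \<in> carrier M" "y \<in> carrier M"
  shows "mfrac R M f x s = mfrac R M f y t \<longleftrightarrow>
    (\<exists>u::nat. (f [^] (u + t)) \<odot>\<^bsub>M\<^esub> x = (f [^] (u + s)) \<odot>\<^bsub>M\<^esub> y)"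
  unfolding mfrac_def using equiv_mfrac_rel[OF assms(1)] assms(2,3)
  by (subst eq_equiv_class_iff) (auto simp: mfrac_rel_iff)

lemma mem_mfrac_iff: "(y, t) \<in> mfrac R M f x s \<longleftrightarrow> x \<in> carrier M \<and> y \<in> carrier M \<and>
    (\<exists>u::nat. (f [^] (u + t)) \<odot>\<^bsub>M\<^esub> x = (f [^] (u + s)) \<odot>\<^bsub>M\<^esub> y)"
  by (simp add: mfrac_def mfrac_rel_iff)

lemma mfrac_self: "x \<in> carrier M \<Longrightarrow> (x, s) \<in> mfrac R M f x s"
  unfolding mem_mfrac_iff by blast

text \<open>This turns the unions over representatives in the definition of
  \<open>localization\<close> into ordinary values: if the result does not depend on the
  representative, all members of the union coincide.\<close>

lemma UN_mfrac:
  assumes "x \<in> carrier M" "\<And>y t. (y, t) \<in> mfrac R M f x s \<Longrightarrow> G y t = G x s"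
  shows "(\<Union>(y, t)\<in>mfrac R M f x s. G y t) = G x s"
proof -
  have "(\<Union>(y, t)\<in>mfrac R M f x s. G y t) = (\<Union>p\<in>mfrac R M f x s. G x s)"
    by (rule SUP_cong) (use assms(2) in auto)
  then show ?thesis using mfrac_self[OF assms(1)] by auto
qed

lemma mfrac_scale:
  assumes "f \<in> carrier R" "x \<in> carrier M"
  shows "mfrac R M f x s = mfrac R M f ((f [^] (u::nat)) \<odot>\<^bsub>M\<^esub> x) (u + s)"
  using assms by (subst mfrac_eq_iff) (auto simp: smult_pow_add add_ac)

lemma mfrac_scale':
  assumes "f \<in> carrier R" "x \<in> carrier M" "s \<le> t"
  shows "mfrac R M f x s = mfrac R M f ((f [^] (t - s)) \<odot>\<^bsub>M\<^esub> x) t"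
  using mfrac_scale[OF assms(1,2), of s "t - s"] assms(3) by simp

text \<open>Stated for all exponents from some point on, so that finitely many such thresholds can
  be replaced by their maximum.\<close>

lemma mfrac_eq_zeroD:
  assumes "f \<in> carrier R" "x \<in> carrier M" "mfrac R M f x s = mfrac R M f \<zero>\<^bsub>M\<^esub> t"
  obtains u where "\<And>v::nat. u \<le> v \<Longrightarrow> (f [^] v) \<odot>\<^bsub>M\<^esub> x = \<zero>\<^bsub>M\<^esub>"
proof -
  obtain u where u: "(f [^] (u + t)) \<odot>\<^bsub>M\<^esub> x = \<zero>\<^bsub>M\<^esub>"
    using assms by (subst (asm) mfrac_eq_iff) auto
  show ?thesis
  proof (rule that)
    fix v assume "u + t \<le> v"
    then have "(f [^] v) \<odot>\<^bsub>M\<^esub> x = (f [^] (v - (u + t))) \<odot>\<^bsub>M\<^esub> ((f [^] (u + t)) \<odot>\<^bsub>M\<^esub> x)"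
      using assms by (simp add: smult_pow_add)
    then show "(f [^] v) \<odot>\<^bsub>M\<^esub> x = \<zero>\<^bsub>M\<^esub>" using u assms by simp
  qed
qed

lemma localization_simps:
  "\<zero>\<^bsub>localization R M f\<^esub> = mfrac R M f \<zero>\<^bsub>M\<^esub> 0"
  "X \<oplus>\<^bsub>localization R M f\<^esub> Y = (\<Union>(x, s)\<in>X. \<Union>(y, t)\<in>Y.
       mfrac R M f ((f [^] t) \<odot>\<^bsub>M\<^esub> x \<oplus>\<^bsub>M\<^esub> (f [^] s) \<odot>\<^bsub>M\<^esub> y) (s + t))"
  by (simp_all add: localization_def)

lemma carrier_localization: "carrier (localization R M f) = {mfrac R M f x s | x s. x \<in> carrier M}"
  by (auto simp: localization_def quotient_def mfrac_def)

lemma mfrac_closed [simp]: "x \<in> carrier M \<Longrightarrow> mfrac R M f x s \<in> carrier (localization R M f)"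
  by (auto simp: carrier_localization)

lemma localizationE:
  assumes "X \<in> carrier (localization R M f)"
  obtains x s where "x \<in> carrier M" "X = mfrac R M f x s"
  using assms by (auto simp: carrier_localization)

lemma add_mfrac':
  assumes f: "f \<in> carrier R" and "x \<in> carrier M" "y \<in> carrier M"
  shows "mfrac R M f x s \<oplus>\<^bsub>localization R M f\<^esub> mfrac R M f y t =
    mfrac R M f ((f [^] t) \<odot>\<^bsub>M\<^esub> x \<oplus>\<^bsub>M\<^esub> (f [^] s) \<odot>\<^bsub>M\<^esub> y) (s + t)"
proof -
  have eq: "mfrac R M f ((f [^] t') \<odot>\<^bsub>M\<^esub> x' \<oplus>\<^bsub>M\<^esub> (f [^] s') \<odot>\<^bsub>M\<^esub> y') (s' + t') =
      mfrac R M f ((f [^] t) \<odot>\<^bsub>M\<^esub> x \<oplus>\<^bsub>M\<^esub> (f [^] s) \<odot>\<^bsub>M\<^esub> y) (s + t)"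
    if x': "(x', s') \<in> mfrac R M f x s" and y': "(y', t') \<in> mfrac R M f y t" for x' s' y' t'
  proof -
    obtain u where u: "(f [^] (u + s')) \<odot>\<^bsub>M\<^esub> x = (f [^] (u + s)) \<odot>\<^bsub>M\<^esub> x'" "x' \<in> carrier M"
      using x' unfolding mem_mfrac_iff by auto
    obtain v where v: "(f [^] (v + t')) \<odot>\<^bsub>M\<^esub> y = (f [^] (v + t)) \<odot>\<^bsub>M\<^esub> y'" "y' \<in> carrier M"
      using y' unfolding mem_mfrac_iff by auto
    have 1: "(f [^] (u + v + s + t + t')) \<odot>\<^bsub>M\<^esub> x' = (f [^] (u + v + s' + t' + t)) \<odot>\<^bsub>M\<^esub> x"
    proof -
      have "(f [^] (u + v + s + t + t')) \<odot>\<^bsub>M\<^esub> x' = (f [^] (v + t + t')) \<odot>\<^bsub>M\<^esub> ((f [^] (u + s)) \<odot>\<^bsub>M\<^esub>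
          x')"
        using f u by (simp add: smult_pow_add add_ac)
      also have "\<dots> = (f [^] (u + v + s' + t' + t)) \<odot>\<^bsub>M\<^esub> x"
        unfolding u(1)[symmetric] using f assms by (simp add: smult_pow_add add_ac)
      finally show ?thesis .
    qed
    have 2: "(f [^] (u + v + s + t + s')) \<odot>\<^bsub>M\<^esub> y' = (f [^] (u + v + s' + t' + s)) \<odot>\<^bsub>M\<^esub> y"
    proof -
      have "(f [^] (u + v + s + t + s')) \<odot>\<^bsub>M\<^esub> y' = (f [^] (u + s + s')) \<odot>\<^bsub>M\<^esub> ((f [^] (v + t)) \<odot>\<^bsub>M\<^esub>
          y')"
        using f v by (simp add: smult_pow_add add_ac)
      also have "\<dots> = (f [^] (u + v + s' + t' + s)) \<odot>\<^bsub>M\<^esub> y"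
        unfolding v(1)[symmetric] using f assms by (simp add: smult_pow_add add_ac)
      finally show ?thesis .
    qed
    have "(f [^] (u + v + (s + t))) \<odot>\<^bsub>M\<^esub> ((f [^] t') \<odot>\<^bsub>M\<^esub> x' \<oplus>\<^bsub>M\<^esub> (f [^] s') \<odot>\<^bsub>M\<^esub> y') =
      (f [^] (u + v + (s' + t'))) \<odot>\<^bsub>M\<^esub> ((f [^] t) \<odot>\<^bsub>M\<^esub> x \<oplus>\<^bsub>M\<^esub> (f [^] s) \<odot>\<^bsub>M\<^esub> y)"
      using f assms u v 1 2 by (simp add: smult_r_distr smult_pow_add add_ac)
    then show ?thesis using f assms u v by (subst mfrac_eq_iff) auto
  qed
  show ?thesis
    unfolding localization_simps
  proof (subst UN_mfrac[OF assms(2)])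
    fix x' s' assume x': "(x', s') \<in> mfrac R M f x s"
    show "(\<Union>(y', t')\<in>mfrac R M f y t. mfrac R M f ((f [^] t') \<odot>\<^bsub>M\<^esub> x' \<oplus>\<^bsub>M\<^esub> (f [^] s') \<odot>\<^bsub>M\<^esub> y') (s'
        + t')) =
      (\<Union>(y', t')\<in>mfrac R M f y t. mfrac R M f ((f [^] t') \<odot>\<^bsub>M\<^esub> x \<oplus>\<^bsub>M\<^esub> (f [^] s) \<odot>\<^bsub>M\<^esub> y') (s + t'))"
      by (rule SUP_cong) (use eq[OF x'] eq[OF mfrac_self[OF assms(2)]] in auto)
  next
    show "(\<Union>(y', t')\<in>mfrac R M f y t. mfrac R M f ((f [^] t') \<odot>\<^bsub>M\<^esub> x \<oplus>\<^bsub>M\<^esub> (f [^] s) \<odot>\<^bsub>M\<^esub> y') (s +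
        t')) =
      mfrac R M f ((f [^] t) \<odot>\<^bsub>M\<^esub> x \<oplus>\<^bsub>M\<^esub> (f [^] s) \<odot>\<^bsub>M\<^esub> y) (s + t)"
      by (rule UN_mfrac[OF assms(3)]) (use eq[OF mfrac_self[OF assms(2)]] in auto)
  qed
qed

lemma add_mfrac:
  assumes f: "f \<in> carrier R" and "x \<in> carrier M" "y \<in> carrier M"
  shows "mfrac R M f x s \<oplus>\<^bsub>localization R M f\<^esub> mfrac R M f y s = mfrac R M f (x \<oplus>\<^bsub>M\<^esub> y) s"
proof -
  have "(f [^] s) \<odot>\<^bsub>M\<^esub> x \<oplus>\<^bsub>M\<^esub> (f [^] s) \<odot>\<^bsub>M\<^esub> y = (f [^] s) \<odot>\<^bsub>M\<^esub> (x \<oplus>\<^bsub>M\<^esub> y)"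
    using assms by (simp add: smult_r_distr)
  then show ?thesis
    using add_mfrac'[OF assms, of s s] mfrac_scale[OF f, of "x \<oplus>\<^bsub>M\<^esub> y" s s] assms by simp
qed

lemma mfrac_zero: "f \<in> carrier R \<Longrightarrow> mfrac R M f \<zero>\<^bsub>M\<^esub> s = \<zero>\<^bsub>localization R M f\<^esub>"
  by (simp add: localization_simps mfrac_eq_iff)

text \<open>With one exponent for all classes involved, \<open>add_mfrac\<close> reduces each group
  axiom of the localization to the same axiom in \<open>M\<close>.\<close>

lemma common_denominator:
  assumes f: "f \<in> carrier R" and "finite F" "\<And>X. X \<in> F \<Longrightarrow> X \<in> carrier (localization R M f)"
  obtains s m where "\<forall>X\<in>F. m X \<in> carrier M \<and> X = mfrac R M f (m X) s"
proof -
  have "\<forall>X\<in>F. \<exists>x s. x \<in> carrier M \<and> X = mfrac R M f x s"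
    using assms(3) by (meson localizationE)
  then obtain m s where m: "\<And>X. X \<in> F \<Longrightarrow> m X \<in> carrier M" "\<And>X. X \<in> F \<Longrightarrow> X = mfrac R M f (m X) (s X)"
    by metis
  define t where "t = Max (insert 0 (s ` F))"
  have "s X \<le> t" if "X \<in> F" for X unfolding t_def using assms(2) that by auto
  then have "\<forall>X\<in>F. (f [^] (t - s X)) \<odot>\<^bsub>M\<^esub> m X \<in> carrier M \<and>
      X = mfrac R M f ((f [^] (t - s X)) \<odot>\<^bsub>M\<^esub> m X) t"
    using m f mfrac_scale'[OF f m(1)] by (metis R.nat_pow_closed smult_closed)
  then show ?thesis by (rule that)
qed

lemma abelian_group_localization:
  assumes f: "f \<in> carrier R"
  shows "abelian_group (localization R M f)"
proof (rule abelian_groupI)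
  fix X Y Z assume XYZ: "X \<in> carrier (localization R M f)" "Y \<in> carrier (localization R M f)" "Z \<in>
      carrier (localization R M f)"
  have mem: "W \<in> carrier (localization R M f)" if "W \<in> {X, Y, Z}" for W using XYZ that by auto
  obtain s m where "\<forall>W\<in>{X, Y, Z}. m W \<in> carrier M \<and> W = mfrac R M f (m W) s"
    by (rule common_denominator[where F = "{X, Y, Z}", OF f _ mem]) (simp, assumption, rule that)
  then have eqs: "X = mfrac R M f (m X) s" "Y = mfrac R M f (m Y) s" "Z = mfrac R M f (m Z) s"
    and c: "m X \<in> carrier M" "m Y \<in> carrier M" "m Z \<in> carrier M" by auto
  show "X \<oplus>\<^bsub>localization R M f\<^esub> Y \<oplus>\<^bsub>localization R M f\<^esub> Z = X \<oplus>\<^bsub>localization R M f\<^esub> (Y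
      \<oplus>\<^bsub>localization R M f\<^esub> Z)"
    by (subst (1 2) eqs(1), subst (1 2) eqs(2), subst (1 2) eqs(3)) (simp add: add_mfrac f c
        M.a_assoc)
next
  fix X Y assume XY: "X \<in> carrier (localization R M f)" "Y \<in> carrier (localization R M f)"
  have mem: "W \<in> carrier (localization R M f)" if "W \<in> {X, Y}" for W using XY that by auto
  obtain s m where "\<forall>W\<in>{X, Y}. m W \<in> carrier M \<and> W = mfrac R M f (m W) s"
    by (rule common_denominator[where F = "{X, Y}", OF f _ mem]) (simp, assumption, rule that)
  then have eqs: "X = mfrac R M f (m X) s" "Y = mfrac R M f (m Y) s"
    and c: "m X \<in> carrier M" "m Y \<in> carrier M" by auto
  show "X \<oplus>\<^bsub>localization R M f\<^esub> Y \<in> carrier (localization R M f)"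
    by (subst eqs(1), subst eqs(2)) (simp add: add_mfrac f c)
  show "X \<oplus>\<^bsub>localization R M f\<^esub> Y = Y \<oplus>\<^bsub>localization R M f\<^esub> X"
    by (subst (1 2) eqs(1), subst (1 2) eqs(2)) (simp add: add_mfrac f c M.a_comm)
next
  fix X assume "X \<in> carrier (localization R M f)"
  then obtain x s where x: "x \<in> carrier M" "X = mfrac R M f x s" by (rule localizationE)
  show "\<zero>\<^bsub>localization R M f\<^esub> \<oplus>\<^bsub>localization R M f\<^esub> X = X"
    using x f by (simp add: mfrac_zero[of f s, symmetric] add_mfrac)
  show "\<exists>Y\<in>carrier (localization R M f). Y \<oplus>\<^bsub>localization R M f\<^esub> X = \<zero>\<^bsub>localization R M f\<^esub>"
    using x f by (intro bexI[of _ "mfrac R M f (\<ominus>\<^bsub>M\<^esub> x) s"]) (auto simp: add_mfrac M.l_neg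
        mfrac_zero)
qed (simp add: localization_simps)

lemma uminus_mfrac:
  assumes f: "f \<in> carrier R" and x: "x \<in> carrier M"
  shows "\<ominus>\<^bsub>localization R M f\<^esub> mfrac R M f x s = mfrac R M f (\<ominus>\<^bsub>M\<^esub> x) s"
proof -
  interpret L: abelian_group "localization R M f" by (rule abelian_group_localization[OF f])
  show ?thesis
    using f x by (intro L.minus_equality) (auto simp: add_mfrac M.l_neg mfrac_zero)
qed

lemma finsum_mfrac:
  assumes f: "f \<in> carrier R" and "finite A" "y \<in> A \<rightarrow> carrier M"
  shows "(\<Oplus>\<^bsub>localization R M f\<^esub>l\<in>A. mfrac R M f (y l) s) = mfrac R M f (\<Oplus>\<^bsub>M\<^esub>l\<in>A. y l) s"
proof -
  interpret L: abelian_group "localization R M f" by (rule abelian_group_localization[OF f])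
  show ?thesis
    using assms(2,3)
  proof (induction A rule: finite_induct)
    case empty
    show ?case by (simp add: mfrac_zero f)
  next
    case (insert l A)
    then show ?case by (subst L.finsum_insert) (auto simp: add_mfrac f Pi_iff)
  qed
qed

lemma localization_map_mfrac:
  assumes f: "f \<in> carrier R" and g: "g \<in> carrier R" and x: "x \<in> carrier M"
  shows "localization_map R M f g (mfrac R M f x s) = mfrac R M (f \<otimes> g) ((g [^] s) \<odot>\<^bsub>M\<^esub> x) s"
  unfolding localization_map_def
proof (rule UN_mfrac[OF x])
  fix y t assume "(y, t) \<in> mfrac R M f x s"
  then obtain u where u: "(f [^] (u + t)) \<odot>\<^bsub>M\<^esub> x = (f [^] (u + s)) \<odot>\<^bsub>M\<^esub> y" and y: "y \<in> carrier M"
    unfolding mem_mfrac_iff by auto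
  have pow: "((f \<otimes> g) [^] (u + a)) \<odot>\<^bsub>M\<^esub> ((g [^] b) \<odot>\<^bsub>M\<^esub> z) =
      (g [^] (u + a + b)) \<odot>\<^bsub>M\<^esub> ((f [^] (u + a)) \<odot>\<^bsub>M\<^esub> z)" if "z \<in> carrier M" for a b z
    using f g that
    by (simp add: R.nat_pow_distrib smult_assoc1[symmetric] R.nat_pow_mult[symmetric] R.m_ac)
  have "((f \<otimes> g) [^] (u + s)) \<odot>\<^bsub>M\<^esub> ((g [^] t) \<odot>\<^bsub>M\<^esub> y) = ((f \<otimes> g) [^] (u + t)) \<odot>\<^bsub>M\<^esub> ((g [^] s) \<odot>\<^bsub>M\<^esub>
      x)"
    unfolding pow[OF x] pow[OF y] u by (simp add: add_ac)
  then show "mfrac R M (f \<otimes> g) ((g [^] t) \<odot>\<^bsub>M\<^esub> y) t = mfrac R M (f \<otimes> g) ((g [^] s) \<odot>\<^bsub>M\<^esub> x) s"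
    using f g x y by (subst mfrac_eq_iff) auto
qed

end

lemma finite_subsets_of_card: "finite (subsets_of_card n i)"
  unfolding subsets_of_card_def by (rule finite_subset[of _ "Pow {1..n}"]) auto

section \<open>Cech cochains over a common denominator\<close>

locale cech = Module.module R M for R :: "('a, 'r) ring_scheme" (structure)
    and M :: "('a, 'm, 'y) module_scheme" (structure) +
  fixes x :: "nat \<Rightarrow> 'a" and n :: nat
  assumes x_closed: "l \<in> {1..n} \<Longrightarrow> x l \<in> carrier R"
begin

definition xprod :: "nat set \<Rightarrow> 'a" where
  "xprod I = (\<Otimes>\<^bsub>R\<^esub>l\<in>I. x l)"

lemma xprod_closed [simp]: "I \<subseteq> {1..n} \<Longrightarrow> xprod I \<in> carrier R"
  unfolding xprod_def using x_closed by (intro R.finprod_closed) auto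

lemma xprod_remove:
  assumes "J \<subseteq> {1..n}" "l \<in> J"
  shows "xprod (J - {l}) \<otimes> x l = xprod J"
proof -
  have fin: "finite J" using assms(1) finite_subset by blast
  have "xprod J = (\<Otimes>\<^bsub>R\<^esub>l\<in>insert l (J - {l}). x l)"
    unfolding xprod_def using assms(2) by (simp add: insert_absorb)
  also have "\<dots> = x l \<otimes> xprod (J - {l})"
    unfolding xprod_def using assms x_closed fin by (intro R.finprod_insert) auto
  also have "\<dots> = xprod (J - {l}) \<otimes> x l"
  proof (rule R.m_comm)
    show "x l \<in> carrier R" using x_closed assms by blast
    show "xprod (J - {l}) \<in> carrier R" using assms by (intro xprod_closed) blast
  qed
  finally show ?thesis by simp
qed

lemma cech_module_eq: "cech_module R M x I = localization R M (xprod I)"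
  by (simp add: cech_module_def xprod_def)

lemma group_cech_cochains: "group (cech_cochains R M x n i)"
  unfolding cech_cochains_def cech_module_eq
proof (rule product_group)
  fix I assume "I \<in> subsets_of_card n i"
  then have "abelian_group (localization R M (xprod I))"
    by (intro abelian_group_localization) (auto simp: subsets_of_card_def)
  then show "group (add_monoid (localization R M (xprod I)))"
    by (rule abelian_group.a_group)
qed

lemma carrier_cech_cochains:
  "carrier (cech_cochains R M x n i) = (\<Pi>\<^sub>E I\<in>subsets_of_card n i. carrier (localization R M
      (xprod I)))"
  by (simp add: cech_cochains_def cech_module_eq)

lemma mult_cech_cochains:
  "c \<otimes>\<^bsub>cech_cochains R M x n i\<^esub> c' =
    (\<lambda>I\<in>subsets_of_card n i. c I \<oplus>\<^bsub>localization R M (xprod I)\<^esub> c' I)"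
  by (simp add: cech_cochains_def cech_module_eq)

lemma one_cech_cochains:
  "\<one>\<^bsub>cech_cochains R M x n i\<^esub> = (\<lambda>I\<in>subsets_of_card n i. \<zero>\<^bsub>localization R M (xprod I)\<^esub>)"
  by (simp add: cech_cochains_def cech_module_eq)

definition cech_frac :: "nat \<Rightarrow> (nat set \<Rightarrow> 'm) \<Rightarrow> nat \<Rightarrow> nat set \<Rightarrow> ('m \<times> nat) set" where
  "cech_frac i m s = (\<lambda>I\<in>subsets_of_card n i. mfrac R M (xprod I) (m I) s)"

text \<open>There are finitely many index sets, so one exponent \<open>s\<close> serves them all. It
  may be raised to any \<open>t\<close>, which is needed to bring two cochains to the same
  denominator.\<close>

lemma cech_fracE:
  assumes "c \<in> carrier (cech_cochains R M x n i)"
  obtains m s where "\<And>I. m I \<in> carrier M" "\<And>t. s \<le> t \<Longrightarrow>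
    c = cech_frac i (\<lambda>I. (xprod I [^] (t - s)) \<odot>\<^bsub>M\<^esub> m I) t"
proof -
  have "\<forall>I\<in>subsets_of_card n i. \<exists>y s. y \<in> carrier M \<and> c I = mfrac R M (xprod I) y s"
    using assms unfolding carrier_cech_cochains by (meson PiE_mem localizationE)
  then obtain m s where m: "\<And>I. I \<in> subsets_of_card n i \<Longrightarrow> m I \<in> carrier M"
    "\<And>I. I \<in> subsets_of_card n i \<Longrightarrow> c I = mfrac R M (xprod I) (m I) (s I)"
    by metis
  define t where "t = Max (insert 0 (s ` subsets_of_card n i))"
  have t: "s I \<le> t" if "I \<in> subsets_of_card n i" for I
    unfolding t_def using finite_subsets_of_card that by auto
  define m' where "m' I = (if I \<in> subsets_of_card n i then (xprod I [^] (t - s I)) \<odot>\<^bsub>M\<^esub> m I else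
      \<zero>\<^bsub>M\<^esub>)" for I
  have xp: "xprod I \<in> carrier R" if "I \<in> subsets_of_card n i" for I
    using that by (auto simp: subsets_of_card_def)
  show ?thesis
  proof (rule that[of m' t])
    show "m' I \<in> carrier M" for I unfolding m'_def using m xp by auto
    fix t' assume t': "t \<le> t'"
    show "c = cech_frac i (\<lambda>I. (xprod I [^] (t' - t)) \<odot>\<^bsub>M\<^esub> m' I) t'"
    proof
      fix I
      show "c I = cech_frac i (\<lambda>I. (xprod I [^] (t' - t)) \<odot>\<^bsub>M\<^esub> m' I) t' I"
      proof (cases "I \<in> subsets_of_card n i")
        case True
        then show ?thesis
          using m(2)[OF True] mfrac_scale'[OF xp m(1), of I I "s I" t'] t[OF True] t' xp m(1)
          by (simp add: cech_frac_def m'_def smult_pow_add)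
      next
        case False
        then show ?thesis
          by (simp add: cech_frac_def PiE_arb[OF assms[unfolded carrier_cech_cochains] False])
      qed
    qed
  qed
qed

lemma cech_frac_closed: "(\<And>I. I \<subseteq> {1..n} \<Longrightarrow> m I \<in> carrier M) \<Longrightarrow> cech_frac i m s \<in> carrier
    (cech_cochains R M x n i)"
  unfolding cech_frac_def carrier_cech_cochains by (auto simp: subsets_of_card_def)

lemma cech_frac_add:
  assumes "\<And>I. I \<subseteq> {1..n} \<Longrightarrow> m I \<in> carrier M" "\<And>I. I \<subseteq> {1..n} \<Longrightarrow> m' I \<in> carrier M"
  shows "cech_frac i m s \<otimes>\<^bsub>cech_cochains R M x n i\<^esub> cech_frac i m' s = cech_frac i (\<lambda>I. m I \<oplus>\<^bsub>M\<^esub>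
      m' I) s"
  unfolding mult_cech_cochains cech_frac_def
  using assms by (intro ext) (auto simp: subsets_of_card_def add_mfrac)

text \<open>Passing from the denominator x_(J-{l})^s to x_J^s multiplies the numerator by x_l^s.
  Hence, for a fixed \<open>s\<close>, the Cech differential acts on numerators as the Koszul
  differential of the \<open>s\<close>-th powers.\<close>

lemma cech_differential_frac:
  assumes m: "\<And>I. I \<subseteq> {1..n} \<Longrightarrow> m I \<in> carrier M"
  shows "cech_differential R M x n i (cech_frac i m s) =
    cech_frac (Suc i) (koszul_diff M (\<lambda>l. x l [^] s) m) s"
proof
  fix J
  show "cech_differential R M x n i (cech_frac i m s) J =
    cech_frac (Suc i) (koszul_diff M (\<lambda>l. x l [^] s) m) s J"
  proof (cases "J \<in> subsets_of_card n (Suc i)")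
    case True
    then have J: "J \<subseteq> {1..n}" "card J = Suc i" by (auto simp: subsets_of_card_def)
    have fin: "finite J" using J finite_subset by blast
    have xJ: "x l \<in> carrier R" if "l \<in> J" for l using x_closed J that by auto
    have mJ: "m (J - {l}) \<in> carrier M" for l using J by (intro m) auto
    interpret L: abelian_group "localization R M (xprod J)"
      by (rule abelian_group_localization) (use J in auto)
    have "cech_differential R M x n i (cech_frac i m s) J =
      (\<Oplus>\<^bsub>localization R M (xprod J)\<^esub>l\<in>J.
        (let y = localization_map R M (xprod (J - {l})) (x l) (cech_frac i m s (J - {l}))
         in if even (card {m \<in> J. m < l}) then y else \<ominus>\<^bsub>localization R M (xprod J)\<^esub> y))"
      unfolding cech_differential_def cech_module_eq xprod_def[symmetric] using True by simp
    also have "\<dots> = (\<Oplus>\<^bsub>localization R M (xprod J)\<^esub>l\<in>J.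
        mfrac R M (xprod J) (alt M J l ((x l [^] s) \<odot>\<^bsub>M\<^esub> m (J - {l}))) s)"
    proof (rule L.finsum_cong')
      fix l assume l: "l \<in> J"
      have "J - {l} \<in> subsets_of_card n i" using J l fin by (auto simp: subsets_of_card_def)
      then have "localization_map R M (xprod (J - {l})) (x l) (cech_frac i m s (J - {l})) =
        mfrac R M (xprod J) ((x l [^] s) \<odot>\<^bsub>M\<^esub> m (J - {l})) s"
        using localization_map_mfrac[of "xprod (J - {l})" "x l" "m (J - {l})" s] xJ[OF l] mJ J
          xprod_remove[OF J(1) l] xprod_closed[OF subset_trans[OF Diff_subset J(1)], of "{l}"]
        by (simp add: cech_frac_def)
      then show "(let y = localization_map R M (xprod (J - {l})) (x l) (cech_frac i m s (J - {l}))
         in if even (card {m \<in> J. m < l}) then y else \<ominus>\<^bsub>localization R M (xprod J)\<^esub> y) =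
         mfrac R M (xprod J) (alt M J l ((x l [^] s) \<odot>\<^bsub>M\<^esub> m (J - {l}))) s"
        using xJ[OF l] mJ J by (simp add: alt_def uminus_mfrac)
    qed (use xJ mJ in auto)
    also have "\<dots> = mfrac R M (xprod J) (koszul_diff M (\<lambda>l. x l [^] s) m J) s"
      unfolding koszul_diff_def using J fin xJ mJ by (intro finsum_mfrac) auto
    finally show ?thesis using True by (simp add: cech_frac_def)
  qed (simp add: cech_differential_def cech_frac_def)
qed

lemma koszul_diff_closed':
  assumes "\<And>I. I \<subseteq> {1..n} \<Longrightarrow> m I \<in> carrier M" "J \<subseteq> {1..n}"
  shows "koszul_diff M (\<lambda>l. x l [^] (s::nat)) m J \<in> carrier M"
proof (rule koszul_diff_closed)
  show "m (J - {l}) \<in> carrier M" for l using assms by (intro assms(1)) auto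
qed (use assms(2) x_closed in auto)

lemma group_hom_cech_differential:
  "group_hom (cech_cochains R M x n i) (cech_cochains R M x n (Suc i)) (cech_differential R M x n
      i)"
proof (intro group_hom.intro group_hom_axioms.intro group_cech_cochains homI)
  fix c assume "c \<in> carrier (cech_cochains R M x n i)"
  then obtain m s where m: "\<And>I. m I \<in> carrier M" "c = cech_frac i (\<lambda>I. (xprod I [^] (s - s)) \<odot>\<^bsub>M\<^esub>
      m I) s"
    by (rule cech_fracE) blast
  then have "c = cech_frac i m s" by simp
  moreover have "cech_frac (Suc i) (koszul_diff M (\<lambda>l. x l [^] s) m) s \<in> carrier (cech_cochains R
      M x n (Suc i))"
    by (intro cech_frac_closed koszul_diff_closed' m(1))
  ultimately show "cech_differential R M x n i c \<in> carrier (cech_cochains R M x n (Suc i))"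
    using m by (simp add: cech_differential_frac)
next
  fix c c' assume c: "c \<in> carrier (cech_cochains R M x n i)" "c' \<in> carrier (cech_cochains R M x n
      i)"
  obtain m s where m: "\<And>I. m I \<in> carrier M"
    "\<And>t. s \<le> t \<Longrightarrow> c = cech_frac i (\<lambda>I. (xprod I [^] (t - s)) \<odot>\<^bsub>M\<^esub> m I) t"
    using cech_fracE[OF c(1)] by blast
  obtain m' s' where m': "\<And>I. m' I \<in> carrier M"
    "\<And>t. s' \<le> t \<Longrightarrow> c' = cech_frac i (\<lambda>I. (xprod I [^] (t - s')) \<odot>\<^bsub>M\<^esub> m' I) t"
    using cech_fracE[OF c(2)] by blast
  define t where "t = max s s'"
  define q where "q I = (xprod I [^] (t - s)) \<odot>\<^bsub>M\<^esub> m I" for I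
  define q' where "q' I = (xprod I [^] (t - s')) \<odot>\<^bsub>M\<^esub> m' I" for I
  have q: "c = cech_frac i q t" "c' = cech_frac i q' t"
    using m(2)[of t] m'(2)[of t] unfolding t_def q_def q'_def by auto
  have qM: "q I \<in> carrier M" "q' I \<in> carrier M" if "I \<subseteq> {1..n}" for I
    unfolding q_def q'_def using m m' that by auto
  have "cech_differential R M x n i (c \<otimes>\<^bsub>cech_cochains R M x n i\<^esub> c') =
    cech_frac (Suc i) (koszul_diff M (\<lambda>l. x l [^] t) (\<lambda>I. q I \<oplus>\<^bsub>M\<^esub> q' I)) t"
    unfolding q using qM by (simp add: cech_frac_add cech_differential_frac del: One_nat_def)
  also have "\<dots> = cech_frac (Suc i) (\<lambda>J. koszul_diff M (\<lambda>l. x l [^] t) q J \<oplus>\<^bsub>M\<^esub> koszul_diff M (\<lambda>l.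
      x l [^] t) q' J) t"
    unfolding cech_frac_def
  proof (rule restrict_ext)
    fix J assume "J \<in> subsets_of_card n (Suc i)"
    then have J: "J \<subseteq> {1..n}" by (auto simp: subsets_of_card_def)
    have "koszul_diff M (\<lambda>l. x l [^] t) (\<lambda>I. q I \<oplus>\<^bsub>M\<^esub> q' I) J =
      koszul_diff M (\<lambda>l. x l [^] t) q J \<oplus>\<^bsub>M\<^esub> koszul_diff M (\<lambda>l. x l [^] t) q' J"
    proof (rule koszul_diff_add)
      show "finite J" using J finite_subset by blast
      show "q (J - {l}) \<in> carrier M" "q' (J - {l}) \<in> carrier M" for l using J by (auto intro!: qM)
      show "x l [^] t \<in> carrier R" if "l \<in> J" for l using J x_closed that by auto
    qed
    then show "mfrac R M (xprod J) (koszul_diff M (\<lambda>l. x l [^] t) (\<lambda>I. q I \<oplus>\<^bsub>M\<^esub> q' I) J) t =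
      mfrac R M (xprod J) (koszul_diff M (\<lambda>l. x l [^] t) q J \<oplus>\<^bsub>M\<^esub> koszul_diff M (\<lambda>l. x l [^] t) q'
          J) t"
      by simp
  qed
  also have "\<dots> = cech_differential R M x n i c \<otimes>\<^bsub>cech_cochains R M x n (Suc i)\<^esub> cech_differential
      R M x n i c'"
    unfolding q using qM koszul_diff_closed'
    by (simp add: cech_frac_add cech_differential_frac del: One_nat_def)
  finally show "cech_differential R M x n i (c \<otimes>\<^bsub>cech_cochains R M x n i\<^esub> c') =
    cech_differential R M x n i c \<otimes>\<^bsub>cech_cochains R M x n (Suc i)\<^esub> cech_differential R M x n i c'" .
qed

lemma subgroup_cech_coboundaries: "subgroup (cech_coboundaries R M x n i) (cech_cochains R M x n i)"
proof (cases i)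
  case 0
  then show ?thesis
    using group.triv_subgroup[OF group_cech_cochains] by (simp add: cech_coboundaries_def)
next
  case (Suc i')
  then show ?thesis
    using group_hom.img_is_subgroup[OF group_hom_cech_differential] by (simp add:
        cech_coboundaries_def)
qed

end

section \<open>Homogeneous Cech cocycles and Koszul exactness\<close>

locale graded_cech = cech R M x n for R :: "('a, 'r) ring_scheme" (structure)
    and M :: "('a, 'm, 'y) module_scheme" (structure) and x n +
  fixes Mgr :: "int \<Rightarrow> 'm set"
  assumes Mgr: "additive_subgroup (Mgr j) M"
    and x_graded: "l \<in> {1..n} \<Longrightarrow> y \<in> Mgr j \<Longrightarrow> x l \<odot>\<^bsub>M\<^esub> y \<in> Mgr (j + 1)"
begin

lemma Mgr_carrier: "Mgr j \<subseteq> carrier M"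
  using additive_subgroup.a_subset[OF Mgr] .

lemma xprod_graded:
  assumes "I \<subseteq> {1..n}" "y \<in> Mgr j"
  shows "xprod I \<odot>\<^bsub>M\<^esub> y \<in> Mgr (j + int (card I))"
proof -
  have "finite I" using assms(1) finite_subset by blast
  from this assms(1) show ?thesis
  proof (induction I rule: finite_induct)
    case empty
    have "y \<in> carrier M" using assms(2) Mgr_carrier by blast
    then show ?case using assms(2) by (simp add: xprod_def)
  next
    case (insert l I)
    have "xprod (insert l I) = x l \<otimes> xprod I"
      unfolding xprod_def using insert x_closed by (intro R.finprod_insert) auto
    then have "xprod (insert l I) \<odot>\<^bsub>M\<^esub> y = x l \<odot>\<^bsub>M\<^esub> (xprod I \<odot>\<^bsub>M\<^esub> y)"
      using insert.prems x_closed[of l] xprod_closed[of I] subsetD[OF Mgr_carrier assms(2)]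
      by (simp add: smult_assoc1)
    also have "\<dots> \<in> Mgr (j + int (card I) + 1)"
      using insert by (intro x_graded) auto
    finally show ?case using insert by (simp add: add_ac)
  qed
qed

lemma xprod_pow_graded:
  assumes "I \<subseteq> {1..n}" "y \<in> Mgr j"
  shows "(xprod I [^] (s::nat)) \<odot>\<^bsub>M\<^esub> y \<in> Mgr (j + int s * int (card I))"
  using assms Mgr_carrier xprod_graded by (intro smult_pow_graded) auto

text \<open>Over a common denominator the numerators form a Koszul cocycle only up to elements
  killed by powers of x_J. Enlarging the denominator once more multiplies the Koszul differential at
  J by a power of x_J and so removes this defect.\<close>

lemma homogeneous_cocycle_imp_koszul_cocycle:
  assumes z: "z \<in> cech_cocycles R M x n i"
    and hom: "\<And>I. I \<in> subsets_of_card n i \<Longrightarrow>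
      z I \<in> localization_component R M Mgr (xprod I) (int (card I)) j"
  obtains m s where "s > 0" "z = cech_frac i m s"
    "\<And>I. I \<subseteq> {1..n} \<Longrightarrow> m I \<in> Mgr (j + int s * int (card I))"
    "\<And>J. J \<subseteq> {1..n} \<Longrightarrow> koszul_diff M (\<lambda>l. x l [^] s) m J = \<zero>\<^bsub>M\<^esub>"
proof -
  have sub: "I \<subseteq> {1..n}" if "I \<in> subsets_of_card n k" for I k using that by (auto simp:
      subsets_of_card_def)
  have zc: "z \<in> carrier (cech_cochains R M x n i)"
    and dz: "cech_differential R M x n i z = \<one>\<^bsub>cech_cochains R M x n (Suc i)\<^esub>"
    using z by (auto simp: cech_cocycles_def kernel_def)
  have zero: "\<zero>\<^bsub>M\<^esub> \<in> Mgr d" for d using additive_subgroup.zero_closed[OF Mgr] .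
  have "\<forall>I\<in>subsets_of_card n i. \<exists>y s. z I = mfrac R M (xprod I) y s \<and> y \<in> Mgr (j + int s * int
      (card I))"
    using hom unfolding localization_component_def by blast
  then obtain m0 s0 where m0: "\<And>I. I \<in> subsets_of_card n i \<Longrightarrow> z I = mfrac R M (xprod I) (m0 I) (s0
      I)"
    "\<And>I. I \<in> subsets_of_card n i \<Longrightarrow> m0 I \<in> Mgr (j + int (s0 I) * int (card I))" by metis
  \<comment> \<open>The \<open>Suc\<close> makes the exponent positive, as required for exactness
    for powers.\<close>
  define t where "t = Suc (Max (insert 0 (s0 ` subsets_of_card n i)))"
  have t: "s0 I \<le> t" if "I \<in> subsets_of_card n i" for I
    unfolding t_def using finite_subsets_of_card that by (simp add: le_SucI)
  \<comment> \<open>The numerators are set to zero outside the \<open>i\<close>-element sets, so the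
    differential can be non-zero only on sets with \<open>i + 1\<close> elements.\<close>
  define m1 where "m1 I = (if I \<in> subsets_of_card n i then (xprod I [^] (t - s0 I)) \<odot>\<^bsub>M\<^esub> m0 I else
      \<zero>\<^bsub>M\<^esub>)" for I
  have m1: "m1 I \<in> Mgr (j + int t * int (card I))" for I
  proof (cases "I \<in> subsets_of_card n i")
    case True
    have "j + int (s0 I) * int (card I) + int (t - s0 I) * int (card I) = j + int t * int (card I)"
      using t[OF True] by (simp add: of_nat_diff algebra_simps)
    with xprod_pow_graded[OF sub[OF True] m0(2)[OF True], of "t - s0 I"] True show ?thesis
      by (simp add: m1_def)
  qed (use zero in \<open>simp add: m1_def\<close>)
  have m1M: "m1 I \<in> carrier M" for I using m1 Mgr_carrier by blast
  have z1: "z = cech_frac i m1 t"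
  proof
    fix I
    show "z I = cech_frac i m1 t I"
    proof (cases "I \<in> subsets_of_card n i")
      case True
      have "m0 I \<in> carrier M" using m0(2)[OF True] Mgr_carrier by blast
      then show ?thesis
        using True m0(1)[OF True] mfrac_scale'[OF xprod_closed[OF sub[OF True]] _ t[OF True]]
        by (simp add: cech_frac_def m1_def)
    next
      case False
      then show ?thesis
        by (simp add: cech_frac_def PiE_arb[OF zc[unfolded carrier_cech_cochains] False])
    qed
  qed
  have "\<exists>u. \<forall>v\<ge>u. (xprod J [^] (v::nat)) \<odot>\<^bsub>M\<^esub> koszul_diff M (\<lambda>l. x l [^] t) m1 J = \<zero>\<^bsub>M\<^esub>"
    if J: "J \<in> subsets_of_card n (Suc i)" for J
  proof -
    have "cech_frac (Suc i) (koszul_diff M (\<lambda>l. x l [^] t) m1) t J = \<one>\<^bsub>cech_cochains R M x n (Suc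
        i)\<^esub> J"
      using dz m1M unfolding z1 by (simp add: cech_differential_frac)
    then have "mfrac R M (xprod J) (koszul_diff M (\<lambda>l. x l [^] t) m1 J) t = mfrac R M (xprod J)
        \<zero>\<^bsub>M\<^esub> 0"
      using J by (simp add: cech_frac_def one_cech_cochains localization_simps)
    from mfrac_eq_zeroD[OF xprod_closed[OF sub[OF J]] koszul_diff_closed'[OF m1M sub[OF J]] this]
    show ?thesis by metis
  qed
  then obtain u where u: "\<And>J v. J \<in> subsets_of_card n (Suc i) \<Longrightarrow> u J \<le> v \<Longrightarrow>
    (xprod J [^] (v::nat)) \<odot>\<^bsub>M\<^esub> koszul_diff M (\<lambda>l. x l [^] t) m1 J = \<zero>\<^bsub>M\<^esub>" by metis
  define v where "v = Max (insert 0 (u ` subsets_of_card n (Suc i)))"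
  have v: "u J \<le> v" if "J \<in> subsets_of_card n (Suc i)" for J
    unfolding v_def using finite_subsets_of_card that by auto
  \<comment> \<open>Numerators and denominators are both multiplied by \<open>xprod I [^] v\<close>,
    with one \<open>v\<close> that kills the defect for all \<open>J\<close>.\<close>
  define m where "m I = (xprod I [^] v) \<odot>\<^bsub>M\<^esub> m1 I" for I
  show ?thesis
  proof (rule that[of "v + t" m])
    show "v + t > 0" by (simp add: t_def)
    show "z = cech_frac i m (v + t)"
      unfolding z1 cech_frac_def m_def using m1M sub
      by (intro restrict_ext) (auto intro!: mfrac_scale)
    show "m I \<in> Mgr (j + int (v + t) * int (card I))" if "I \<subseteq> {1..n}" for I
      using xprod_pow_graded[OF that m1[of I], of v] by (simp add: m_def algebra_simps)
    show "koszul_diff M (\<lambda>l. x l [^] (v + t)) m J = \<zero>\<^bsub>M\<^esub>" if J: "J \<subseteq> {1..n}" for J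
    proof (cases "J \<in> subsets_of_card n (Suc i)")
      case True
      have xJ: "x l \<in> carrier R" if "l \<in> J" for l using J x_closed that by auto
      have Jl: "J - {l} \<subseteq> {1..n}" for l using J by blast
      have "koszul_diff M (\<lambda>l. x l [^] (v + t)) m J =
          koszul_diff M (\<lambda>l. x l [^] t) (\<lambda>I. (xprod J [^] v) \<odot>\<^bsub>M\<^esub> m1 I) J"
      proof (rule koszul_diff_cong)
        fix l assume l: "l \<in> J"
        \<comment> \<open>The factor \<open>x l [^] v\<close> completes the power of
          \<open>xprod (J - {l})\<close> to that of \<open>xprod J\<close>, which no longer depends
          on \<open>l\<close> and can be pulled out of the sum.\<close>
        have "(x l [^] (v + t)) \<otimes> xprod (J - {l}) [^] v = (x l [^] t) \<otimes> (xprod (J - {l}) \<otimes> x l)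
            [^] v"
          using xJ[OF l] Jl by (simp add: R.nat_pow_distrib R.nat_pow_mult[symmetric] R.m_ac)
        also have "\<dots> = (x l [^] t) \<otimes> xprod J [^] v"
          by (simp add: xprod_remove[OF J l])
        finally show "(x l [^] (v + t)) \<odot>\<^bsub>M\<^esub> m (J - {l}) = (x l [^] t) \<odot>\<^bsub>M\<^esub> ((xprod J [^] v) \<odot>\<^bsub>M\<^esub>
            m1 (J - {l}))"
          unfolding m_def using xJ[OF l] Jl J m1M by (simp add: smult_assoc1[symmetric])
      qed (use xJ J m1M in auto)
      also have "\<dots> = (xprod J [^] v) \<odot>\<^bsub>M\<^esub> koszul_diff M (\<lambda>l. x l [^] t) m1 J"
        using J xJ m1M by (intro koszul_diff_smult) (auto simp: finite_subset[OF J])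
      finally show ?thesis using u[OF True v[OF True]] by simp
    next
      case False
      have "m (J - {l}) = \<zero>\<^bsub>M\<^esub>" if "l \<in> J" for l
      proof -
        have "finite J" using J finite_subset by blast
        then have "card J = Suc (card (J - {l}))" using that by (rule card.remove)
        then have "J - {l} \<notin> subsets_of_card n i" using False J by (auto simp: subsets_of_card_def)
        moreover have "xprod (J - {l}) \<in> carrier R" using J by (intro xprod_closed) auto
        ultimately show ?thesis by (simp add: m_def m1_def)
      qed
      moreover have "x l \<in> carrier R" if "l \<in> J" for l using J x_closed that by auto
      ultimately show ?thesis
        unfolding koszul_diff_def by (intro finsum_zero_eq) simp
    qed
  qed
qed

text \<open>A Koszul primitive of the numerators, divided by the same denominators, is a Cech
  primitive. Exactness is needed for every \<open>s\<close> because the denominator of a given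
  cocycle is not known in advance.\<close>

theorem cech_cohomology_component_trivial:
  assumes exact: "\<And>s::nat. s > 0 \<Longrightarrow>
    koszul_exact M {1..n} (\<lambda>l. x l [^] s) (\<lambda>I. Mgr (j + int s * int (card I)))"
  shows "cech_cohomology_component R M Mgr x n i j = {\<one>\<^bsub>cech_cohomology R M x n i\<^esub>}"
proof -
  let ?B = "cech_coboundaries R M x n i"
  let ?G = "(cech_cochains R M x n i)\<lparr>carrier := cech_cocycles R M x n i\<rparr>"
  have coset: "?B #>\<^bsub>?G\<^esub> z = ?B" if "z \<in> ?B" for z
  proof -
    have "?B #>\<^bsub>?G\<^esub> z = ?B #>\<^bsub>cech_cochains R M x n i\<^esub> z" by (simp add: r_coset_def)
    also have "\<dots> = ?B"
      using that subgroup.subset[OF subgroup_cech_coboundaries]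
      by (intro group.coset_join2[OF group_cech_cochains _ subgroup_cech_coboundaries]) auto
    finally show ?thesis .
  qed
  have one: "\<one>\<^bsub>cech_cohomology R M x n i\<^esub> = ?B" by (simp add: cech_cohomology_def FactGroup_def)
  have boundary: "z \<in> ?B" if z: "z \<in> cech_cocycles R M x n i" and hom: "\<And>I. I \<in> subsets_of_card n
      i \<Longrightarrow>
      z I \<in> localization_component R M Mgr (xprod I) (int (card I)) j" for z
  proof -
    obtain s m where ms: "s > 0" "z = cech_frac i m s"
      "\<And>I. I \<subseteq> {1..n} \<Longrightarrow> m I \<in> Mgr (j + int s * int (card I))"
      "\<And>J. J \<subseteq> {1..n} \<Longrightarrow> koszul_diff M (\<lambda>l. x l [^] s) m J = \<zero>\<^bsub>M\<^esub>"
      by (rule homogeneous_cocycle_imp_koszul_cocycle[OF z hom]) (assumption, rule that)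
    obtain h where h: "\<And>I. I \<subseteq> {1..n} \<Longrightarrow> h I \<in> Mgr (j + int s * int (card I))"
      "\<And>I. I \<subseteq> {1..n} \<Longrightarrow> m I = koszul_diff M (\<lambda>l. x l [^] s) h I"
      by (rule koszul_exactD[OF exact[OF ms(1)] ms(3,4)]) (assumption, assumption, rule that)
    have hM: "h I \<in> carrier M" if "I \<subseteq> {1..n}" for I using h(1)[OF that] Mgr_carrier by blast
    have z': "z = cech_frac i (koszul_diff M (\<lambda>l. x l [^] s) h) s"
      unfolding ms(2) cech_frac_def using h(2) by (intro restrict_ext) (auto simp:
          subsets_of_card_def)
    show ?thesis
    proof (cases i)
      case 0
      \<comment> \<open>In degree 0 the coboundaries are trivial by definition, so \<open>z\<close>
        itself must vanish; its only numerator is an empty Koszul sum.\<close>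
      have "z = \<one>\<^bsub>cech_cochains R M x n 0\<^esub>"
        unfolding z' 0 cech_frac_def one_cech_cochains
      proof (rule restrict_ext)
        fix I assume "I \<in> subsets_of_card n 0"
        then have "I = {}" by (auto simp: subsets_of_card_def finite_subset)
        then show "mfrac R M (xprod I) (koszul_diff M (\<lambda>l. x l [^] s) h I) s = \<zero>\<^bsub>localization R M
            (xprod I)\<^esub>"
          by (simp add: koszul_diff_def mfrac_zero)
      qed
      then show ?thesis by (simp add: 0 cech_coboundaries_def)
    next
      case (Suc i')
      have "z = cech_differential R M x n i' (cech_frac i' h s)"
        unfolding z' Suc using hM by (simp add: cech_differential_frac del: One_nat_def)
      then show ?thesis
        using hM by (auto simp: Suc cech_coboundaries_def intro!: cech_frac_closed)
    qed
  qed
  \<comment> \<open>The graded component is a set of cosets. To equal the singleton of the trivial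
    coset it must also be nonempty, which the zero cocycle ensures.\<close>
  have "\<exists>z. z \<in> cech_cocycles R M x n i \<and> (\<forall>I\<in>subsets_of_card n i.
      z I \<in> localization_component R M Mgr (xprod I) (int (card I)) j)"
  proof (intro exI conjI ballI)
    show "\<one>\<^bsub>cech_cochains R M x n i\<^esub> \<in> cech_cocycles R M x n i"
      unfolding cech_cocycles_def
      using subgroup.one_closed[OF group_hom.subgroup_kernel[OF group_hom_cech_differential]] .
    fix I assume I: "I \<in> subsets_of_card n i"
    have "\<zero>\<^bsub>M\<^esub> \<in> Mgr (j + int 0 * int (card I))" by (rule additive_subgroup.zero_closed[OF Mgr])
    then have "mfrac R M (xprod I) \<zero>\<^bsub>M\<^esub> 0 \<in> localization_component R M Mgr (xprod I) (int (card
        I)) j"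
      unfolding localization_component_def by blast
    then show "\<one>\<^bsub>cech_cochains R M x n i\<^esub> I \<in> localization_component R M Mgr (xprod I) (int (card
        I)) j"
      using I unfolding one_cech_cochains by (simp add: localization_simps)
  qed
  with boundary coset show ?thesis
    unfolding one cech_cohomology_component_def xprod_def[symmetric] by blast
qed

end

section \<open>Polynomial rings and graded modules\<close>

lemma mpoly_ring_simps [simp]:
  "mult (mpoly_ring V) = (*)" "\<one>\<^bsub>mpoly_ring V\<^esub> = 1" "\<zero>\<^bsub>mpoly_ring V\<^esub> = 0" "add (mpoly_ring V) = (+)"
  by (simp_all add: mpoly_ring_def)

lemma mem_mpoly_ring: "p \<in> carrier (mpoly_ring V) \<longleftrightarrow> (\<forall>m\<in>Poly_Mapping.keys p. Poly_Mapping.keys m \<subseteq>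
    V)"
  by (simp add: mpoly_ring_def)

lemma mpoly_ring_add_closed:
  "p \<in> carrier (mpoly_ring V) \<Longrightarrow> q \<in> carrier (mpoly_ring V) \<Longrightarrow> p + q \<in> carrier (mpoly_ring V)"
  using Poly_Mapping.keys_add[of p q] by (auto simp: mem_mpoly_ring)

lemma mpoly_ring_mult_closed:
  assumes "p \<in> carrier (mpoly_ring V)" "q \<in> carrier (mpoly_ring V)"
  shows "p * q \<in> carrier (mpoly_ring V)"
  unfolding mem_mpoly_ring
proof
  fix m assume "m \<in> Poly_Mapping.keys (p * q)"
  then obtain a b where "m = a + b" "a \<in> Poly_Mapping.keys p" "b \<in> Poly_Mapping.keys q"
    using keys_mult[of p q] by blast
  then show "Poly_Mapping.keys m \<subseteq> V"
    using assms Poly_Mapping.keys_add[of a b] unfolding mem_mpoly_ring by blast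
qed

lemma mpoly_ring_zero_one_closed: "0 \<in> carrier (mpoly_ring V)" "1 \<in> carrier (mpoly_ring V)"
  by (simp_all add: mem_mpoly_ring)

lemma cring_mpoly_ring: "cring (mpoly_ring V)"
proof (rule cringI)
  show "abelian_group (mpoly_ring V)"
  proof (rule abelian_groupI)
    fix p assume "p \<in> carrier (mpoly_ring V)"
    then show "\<exists>q\<in>carrier (mpoly_ring V). q \<oplus>\<^bsub>mpoly_ring V\<^esub> p = \<zero>\<^bsub>mpoly_ring V\<^esub>"
      by (intro bexI[of _ "- p"]) (auto simp: mem_mpoly_ring in_keys_iff)
  qed (auto simp: mpoly_ring_add_closed add_ac mpoly_ring_zero_one_closed)
  show "comm_monoid (mpoly_ring V)"
    by (rule comm_monoidI) (auto simp: mpoly_ring_mult_closed mult_ac mpoly_ring_zero_one_closed)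
qed (auto simp: algebra_simps)

definition mpoly_consts :: "('v, 'k::comm_ring_1) mpoly set" where
  "mpoly_consts = range (Poly_Mapping.single 0)"

lemma mpoly_consts_closed: "mpoly_consts \<subseteq> carrier (mpoly_ring V)"
  by (auto simp: mpoly_consts_def mem_mpoly_ring)

lemma mpoly_var_closed: "v \<in> V \<Longrightarrow> mpoly_var v \<in> carrier (mpoly_ring V)"
  by (auto simp: mpoly_var_def mem_mpoly_ring)

lemma subfield_mpoly_consts: "subfield (mpoly_consts :: ('v, 'k::field) mpoly set) (mpoly_ring V)"
proof -
  let ?R = "mpoly_ring V :: ('v, 'k) mpoly ring"
  interpret R: cring ?R by (rule cring_mpoly_ring)
  note sub = mpoly_consts_closed[of V]
  have "subring mpoly_consts ?R"
  proof (rule R.subringI[OF sub])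
    show "\<one>\<^bsub>?R\<^esub> \<in> mpoly_consts" by (auto simp: mpoly_consts_def simp flip: single_one)
    fix p q :: "('v, 'k) mpoly" assume "p \<in> mpoly_consts" "q \<in> mpoly_consts"
    then obtain a b where ab: "p = Poly_Mapping.single 0 a" "q = Poly_Mapping.single 0 b"
      by (auto simp: mpoly_consts_def)
    show "p \<otimes>\<^bsub>?R\<^esub> q \<in> mpoly_consts" by (simp add: ab mult_single mpoly_consts_def)
    show "p \<oplus>\<^bsub>?R\<^esub> q \<in> mpoly_consts" by (simp add: ab mpoly_consts_def flip: single_add)
    have "\<ominus>\<^bsub>?R\<^esub> p = Poly_Mapping.single 0 (- a)"
      using sub by (intro R.minus_equality) (auto simp: ab mpoly_consts_def simp flip: single_add)
    then show "\<ominus>\<^bsub>?R\<^esub> p \<in> mpoly_consts" by (simp add: mpoly_consts_def)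
  qed
  moreover have "Units (?R\<lparr>carrier := mpoly_consts\<rparr>) = mpoly_consts - {\<zero>\<^bsub>?R\<^esub>}"
  proof
    show "Units (?R\<lparr>carrier := mpoly_consts\<rparr>) \<subseteq> mpoly_consts - {\<zero>\<^bsub>?R\<^esub>}"
      by (auto simp: Units_def)
    show "mpoly_consts - {\<zero>\<^bsub>?R\<^esub>} \<subseteq> Units (?R\<lparr>carrier := mpoly_consts\<rparr>)"
    proof
      fix p :: "('v, 'k) mpoly" assume "p \<in> mpoly_consts - {\<zero>\<^bsub>?R\<^esub>}"
      then obtain a where a: "p = Poly_Mapping.single 0 a" "p \<noteq> 0"
        unfolding mpoly_consts_def by auto
      then have "a \<noteq> 0" by auto
      with a have "Poly_Mapping.single 0 (inverse a) * p = 1" "p * Poly_Mapping.single 0 (inverse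
          a) = 1"
        by (simp_all add: mult_single)
      moreover have "Poly_Mapping.single 0 (inverse a) \<in> mpoly_consts" "p \<in> mpoly_consts"
        by (auto simp: mpoly_consts_def a)
      ultimately show "p \<in> Units (?R\<lparr>carrier := mpoly_consts\<rparr>)"
        unfolding Units_def by auto
    qed
  qed
  ultimately show ?thesis by (intro R.subfieldI R.subcringI') auto
qed

lemma poly_mapping_sum_single: "(\<Sum>a\<in>Poly_Mapping.keys t. Poly_Mapping.single a
    (Poly_Mapping.lookup t a)) = t"
proof (rule poly_mapping_eqI)
  fix b
  have "Poly_Mapping.lookup (\<Sum>a\<in>Poly_Mapping.keys t. Poly_Mapping.single a (Poly_Mapping.lookup t
      a)) b =
    (\<Sum>a\<in>Poly_Mapping.keys t. if a = b then Poly_Mapping.lookup t a else 0)"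
    by (simp add: lookup_sum lookup_single when_def)
  also have "\<dots> = Poly_Mapping.lookup t b"
    by (simp add: in_keys_iff)
  finally show "Poly_Mapping.lookup (\<Sum>a\<in>Poly_Mapping.keys t. Poly_Mapping.single a
      (Poly_Mapping.lookup t a)) b =
    Poly_Mapping.lookup t b" .
qed

lemma mpoly_ring_induct [consumes 1, case_names const var add mult]:
  fixes p :: "('v, 'k::comm_ring_1) mpoly"
  assumes p: "p \<in> carrier (mpoly_ring V)"
    and const: "\<And>c. P (Poly_Mapping.single 0 c)"
    and var: "\<And>v. v \<in> V \<Longrightarrow> P (mpoly_var v)"
    and add: "\<And>p q. P p \<Longrightarrow> P q \<Longrightarrow> P (p + q)"
    and mult: "\<And>p q. P p \<Longrightarrow> P q \<Longrightarrow> P (p * q)"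
  shows "P p"
proof -
  have power: "P (Poly_Mapping.single (Poly_Mapping.single v k) 1)" if "v \<in> V" for v k
  proof (induction k)
    case 0
    then show ?case using const[of 1] by simp
  next
    case (Suc k)
    have "Poly_Mapping.single (Poly_Mapping.single v (Suc k)) (1::'k) =
      mpoly_var v * Poly_Mapping.single (Poly_Mapping.single v k) 1"
      by (simp add: mpoly_var_def mult_single flip: single_add)
    then show ?case using mult[OF var[OF that] Suc] by simp
  qed
  have mon: "P (Poly_Mapping.single (\<Sum>v\<in>F. Poly_Mapping.single v (k v)) 1)" if "finite F" "F \<subseteq> V"
      for F k
    using that
  proof (induction F rule: finite_induct)
    case empty
    then show ?case using const[of 1] by simp
  next
    case (insert v F)
    have "Poly_Mapping.single (\<Sum>v\<in>insert v F. Poly_Mapping.single v (k v)) (1::'k) =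
      Poly_Mapping.single (Poly_Mapping.single v (k v)) 1 *
      Poly_Mapping.single (\<Sum>v\<in>F. Poly_Mapping.single v (k v)) 1"
      using insert by (simp add: mult_single)
    then show ?case using mult[OF power] insert by simp
  qed
  have monomial: "P (Poly_Mapping.single m c)" if "Poly_Mapping.keys m \<subseteq> V" for m c
  proof -
    have "Poly_Mapping.single m c = Poly_Mapping.single 0 c * Poly_Mapping.single m 1"
      by (simp add: mult_single)
    then show ?thesis
      using mult[OF const[of c] mon[OF finite_keys that, of "Poly_Mapping.lookup m"]]
      by (simp add: poly_mapping_sum_single)
  qed
  have "P (\<Sum>m\<in>F. Poly_Mapping.single m (Poly_Mapping.lookup p m))"
    if "finite F" "F \<subseteq> Poly_Mapping.keys p" for F
    using that
  proof (induction F rule: finite_induct)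
    case empty
    then show ?case using const[of 0] by simp
  next
    case (insert m F)
    then have "Poly_Mapping.keys m \<subseteq> V" using p by (auto simp: mem_mpoly_ring)
    then show ?case using insert by (simp add: add monomial)
  qed
  from this[OF finite_keys order_refl] show ?thesis by (simp add: poly_mapping_sum_single)
qed

text \<open>These elements play the role of the scalar set \<open>C\<close>. Each of them is
  homogeneous for any grading of the variables, so homogeneous components need to be followed only
  through multiplication by homogeneous scalars.\<close>

definition mpoly_gens :: "'v set \<Rightarrow> ('v, 'k::comm_ring_1) mpoly set" where
  "mpoly_gens V = mpoly_consts \<union> mpoly_var ` V"

lemma mpoly_gens_closed: "mpoly_gens V \<subseteq> carrier (mpoly_ring V)"
  using mpoly_consts_closed[of V] by (auto simp: mpoly_gens_def intro: mpoly_var_closed)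

lemma stable_mpoly_gens_smult:
  assumes M: "Module.module (mpoly_ring V) M" and W: "stable M (mpoly_gens V) W"
    and p: "p \<in> carrier (mpoly_ring V)" and y: "y \<in> W"
  shows "p \<odot>\<^bsub>M\<^esub> y \<in> W"
proof -
  interpret M: Module.module "mpoly_ring V" M by (rule M)
  note Wc = stableD(2)[OF W]
  \<comment> \<open>Membership in the ring is carried along because the module laws for sums and
    products of scalars require it.\<close>
  have "p \<in> carrier (mpoly_ring V) \<and> (\<forall>y\<in>W. p \<odot>\<^bsub>M\<^esub> y \<in> W)"
    using p
  proof (induction p rule: mpoly_ring_induct)
    case (const c)
    have "Poly_Mapping.single 0 c \<in> mpoly_consts" by (simp add: mpoly_consts_def)
    then show ?case using mpoly_consts_closed[of V] stableD(5)[OF W] by (auto simp: mpoly_gens_def)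
  next
    case (var v)
    then show ?case using mpoly_var_closed[of v V] stableD(5)[OF W] by (auto simp: mpoly_gens_def)
  next
    case (add p q)
    then show ?case
      using M.smult_l_distr[of p q] Wc stableD(4)[OF W] by (auto simp: mpoly_ring_add_closed)
  next
    case (mult p q)
    then show ?case
      using M.smult_assoc1[of p q] Wc by (auto simp: mpoly_ring_mult_closed)
  qed
  with y show ?thesis by blast
qed

lemma (in Module.module) finsum_stable:
  assumes "stable M C W" "finite A" "f \<in> A \<rightarrow> W"
  shows "(\<Oplus>\<^bsub>M\<^esub>i\<in>A. f i) \<in> W"
  using assms(2,3)
proof (induction A rule: finite_induct)
  case empty
  then show ?case using stableD(3)[OF assms(1)] by simp
next
  case (insert a A)
  then show ?case
    using stableD(2,4)[OF assms(1)] by (subst M.finsum_insert) (auto simp: Pi_iff)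
qed

lemma finitely_generated_imp_gen:
  assumes M: "Module.module (mpoly_ring V) M" and "finitely_generated (mpoly_ring V) M"
  obtains B where "finite B" "B \<subseteq> carrier M" "carrier M \<subseteq> gen M (mpoly_gens V) B"
proof -
  interpret M: Module.module "mpoly_ring V" M by (rule M)
  obtain B where B: "finite B" "B \<subseteq> carrier M"
    "\<And>x. x \<in> carrier M \<Longrightarrow> \<exists>c \<in> B \<rightarrow> carrier (mpoly_ring V). x = (\<Oplus>\<^bsub>M\<^esub>b\<in>B. c b \<odot>\<^bsub>M\<^esub> b)"
    using assms(2) unfolding finitely_generated_def by blast
  have st: "stable M (mpoly_gens V) (gen M (mpoly_gens V) B)"
    by (rule M.stable_gen[OF mpoly_gens_closed B(2)])
  have "x \<in> gen M (mpoly_gens V) B" if x: "x \<in> carrier M" for x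
  proof -
    obtain c where c: "c \<in> B \<rightarrow> carrier (mpoly_ring V)" "x = (\<Oplus>\<^bsub>M\<^esub>b\<in>B. c b \<odot>\<^bsub>M\<^esub> b)"
      using B(3)[OF x] by blast
    show ?thesis
      unfolding c(2)
    proof (rule M.finsum_stable[OF st B(1)], rule Pi_I)
      fix b assume "b \<in> B"
      then show "c b \<odot>\<^bsub>M\<^esub> b \<in> gen M (mpoly_gens V) B"
        using c(1) by (intro stable_mpoly_gens_smult[OF M st]) (auto intro: gen.gen_incl)
    qed
  qed
  then show ?thesis using B that by blast
qed

section \<open>Homogeneous components in a graded module\<close>

locale graded_over = Module.module R M for R :: "('a, 'r) ring_scheme" (structure)
    and M :: "('a, 'm, 'y) module_scheme" (structure) +
  fixes Rgr :: "'g::ab_group_add \<Rightarrow> 'a set" and Mgr :: "'g \<Rightarrow> 'm set"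
  assumes graded: "graded_module R Rgr M Mgr"
begin

definition decomposes :: "('g \<Rightarrow> 'm) \<Rightarrow> 'm \<Rightarrow> bool" where
  "decomposes f x \<longleftrightarrow> (\<forall>g. f g \<in> Mgr g) \<and> finite {g. f g \<noteq> \<zero>\<^bsub>M\<^esub>} \<and>
    x = (\<Oplus>\<^bsub>M\<^esub>g\<in>{g. f g \<noteq> \<zero>\<^bsub>M\<^esub>}. f g)"

definition hcomp :: "'m \<Rightarrow> 'g \<Rightarrow> 'm" where
  "hcomp x = (THE f. decomposes f x)"

lemma additive_subgroup_Mgr: "additive_subgroup (Mgr g) M"
  using graded unfolding graded_module_def by blast

lemma Mgr_carrier: "Mgr g \<subseteq> carrier M"
  using additive_subgroup.a_subset[OF additive_subgroup_Mgr] .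

lemma Mgr_zero: "\<zero>\<^bsub>M\<^esub> \<in> Mgr g"
  using additive_subgroup.zero_closed[OF additive_subgroup_Mgr] .

lemma Mgr_add: "x \<in> Mgr g \<Longrightarrow> y \<in> Mgr g \<Longrightarrow> x \<oplus>\<^bsub>M\<^esub> y \<in> Mgr g"
  using additive_subgroup.a_closed[OF additive_subgroup_Mgr] .

lemma Mgr_smult: "a \<in> Rgr g \<Longrightarrow> x \<in> Mgr h \<Longrightarrow> a \<odot>\<^bsub>M\<^esub> x \<in> Mgr (g + h)"
  using graded unfolding graded_module_def by blast

lemma ex1_decomposes: "x \<in> carrier M \<Longrightarrow> \<exists>!f. decomposes f x"
  using graded unfolding graded_module_def decomposes_def by blast

lemma decomposes_hcomp: "x \<in> carrier M \<Longrightarrow> decomposes (hcomp x) x"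
  unfolding hcomp_def by (rule theI'[OF ex1_decomposes])

lemma hcomp_eqI: "x \<in> carrier M \<Longrightarrow> decomposes f x \<Longrightarrow> hcomp x = f"
  using ex1_decomposes[of x] decomposes_hcomp[of x] by blast

lemma hcomp_in: "x \<in> carrier M \<Longrightarrow> hcomp x g \<in> Mgr g"
  using decomposes_hcomp[of x] unfolding decomposes_def by blast

lemma hcomp_closed: "x \<in> carrier M \<Longrightarrow> hcomp x g \<in> carrier M"
  using hcomp_in Mgr_carrier by blast

text \<open>\<open>decomposes\<close> sums over the exact support, which is unwieldy when entries of
  a sum or a scalar multiple happen to cancel. Any finite set containing the support may be used
  instead.\<close>

lemma decomposesI:
  assumes "\<And>g. f g \<in> Mgr g" "finite A" "\<And>g. g \<notin> A \<Longrightarrow> f g = \<zero>\<^bsub>M\<^esub>" "x = (\<Oplus>\<^bsub>M\<^esub>g\<in>A. f g)"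
  shows "decomposes f x"
proof -
  have sub: "{g. f g \<noteq> \<zero>\<^bsub>M\<^esub>} \<subseteq> A" using assms(3) by blast
  have "(\<Oplus>\<^bsub>M\<^esub>g\<in>{g. f g \<noteq> \<zero>\<^bsub>M\<^esub>}. f g) = (\<Oplus>\<^bsub>M\<^esub>g\<in>A. f g)"
    using assms(1,2) sub Mgr_carrier by (intro M.add.finprod_mono_neutral_cong_left) auto
  then show ?thesis
    unfolding decomposes_def using assms finite_subset[OF sub assms(2)] by simp
qed

lemma decomposesE:
  assumes "x \<in> carrier M"
  obtains A where "finite A" "\<And>g. g \<notin> A \<Longrightarrow> hcomp x g = \<zero>\<^bsub>M\<^esub>" "x = (\<Oplus>\<^bsub>M\<^esub>g\<in>A. hcomp x g)"
  using decomposes_hcomp[OF assms] unfolding decomposes_def by (intro that) auto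

lemma decomposesE':
  assumes "x \<in> carrier M" "finite A" "\<And>g. g \<notin> A \<Longrightarrow> hcomp x g = \<zero>\<^bsub>M\<^esub>"
  shows "x = (\<Oplus>\<^bsub>M\<^esub>g\<in>A. hcomp x g)"
proof -
  have "x = (\<Oplus>\<^bsub>M\<^esub>g\<in>{g. hcomp x g \<noteq> \<zero>\<^bsub>M\<^esub>}. hcomp x g)"
    using decomposes_hcomp[OF assms(1)] unfolding decomposes_def by blast
  also have "\<dots> = (\<Oplus>\<^bsub>M\<^esub>g\<in>A. hcomp x g)"
    using assms hcomp_closed by (intro M.add.finprod_mono_neutral_cong_left) auto
  finally show ?thesis .
qed

lemma hcomp_homogeneous:
  assumes "x \<in> Mgr g"
  shows "hcomp x = (\<lambda>h. if h = g then x else \<zero>\<^bsub>M\<^esub>)"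
proof (rule hcomp_eqI)
  show x: "x \<in> carrier M" using assms Mgr_carrier by blast
  show "decomposes (\<lambda>h. if h = g then x else \<zero>\<^bsub>M\<^esub>) x"
    by (rule decomposesI[of _ "{g}"]) (use assms x Mgr_zero in auto)
qed

lemma hcomp_add:
  assumes x: "x \<in> carrier M" and y: "y \<in> carrier M"
  shows "hcomp (x \<oplus>\<^bsub>M\<^esub> y) = (\<lambda>g. hcomp x g \<oplus>\<^bsub>M\<^esub> hcomp y g)"
proof (rule hcomp_eqI)
  obtain A where A: "finite A" "\<And>g. g \<notin> A \<Longrightarrow> hcomp x g = \<zero>\<^bsub>M\<^esub>" using decomposesE[OF x] by metis
  obtain B where B: "finite B" "\<And>g. g \<notin> B \<Longrightarrow> hcomp y g = \<zero>\<^bsub>M\<^esub>" using decomposesE[OF y] by metis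
  show "decomposes (\<lambda>g. hcomp x g \<oplus>\<^bsub>M\<^esub> hcomp y g) (x \<oplus>\<^bsub>M\<^esub> y)"
  proof (rule decomposesI[of _ "A \<union> B"])
    have "x = (\<Oplus>\<^bsub>M\<^esub>g\<in>A \<union> B. hcomp x g)" "y = (\<Oplus>\<^bsub>M\<^esub>g\<in>A \<union> B. hcomp y g)"
      using A B x y by (auto intro!: decomposesE')
    moreover have "(\<Oplus>\<^bsub>M\<^esub>g\<in>A \<union> B. hcomp x g \<oplus>\<^bsub>M\<^esub> hcomp y g) =
        (\<Oplus>\<^bsub>M\<^esub>g\<in>A \<union> B. hcomp x g) \<oplus>\<^bsub>M\<^esub> (\<Oplus>\<^bsub>M\<^esub>g\<in>A \<union> B. hcomp y g)"
      using x y by (intro M.finsum_addf) (auto intro: hcomp_closed)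
    ultimately show "x \<oplus>\<^bsub>M\<^esub> y = (\<Oplus>\<^bsub>M\<^esub>g\<in>A \<union> B. hcomp x g \<oplus>\<^bsub>M\<^esub> hcomp y g)" by simp
  qed (use A B x y in \<open>auto intro: Mgr_add hcomp_in\<close>)
qed (use x y in auto)

lemma hcomp_smult:
  assumes a: "a \<in> Rgr g" "a \<in> carrier R" and x: "x \<in> carrier M"
  shows "hcomp (a \<odot>\<^bsub>M\<^esub> x) = (\<lambda>h. a \<odot>\<^bsub>M\<^esub> hcomp x (h - g))"
proof (rule hcomp_eqI)
  obtain A where A: "finite A" "\<And>g. g \<notin> A \<Longrightarrow> hcomp x g = \<zero>\<^bsub>M\<^esub>" "x = (\<Oplus>\<^bsub>M\<^esub>g\<in>A. hcomp x g)"
    using decomposesE[OF x] by metis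
  show "decomposes (\<lambda>h. a \<odot>\<^bsub>M\<^esub> hcomp x (h - g)) (a \<odot>\<^bsub>M\<^esub> x)"
  proof (rule decomposesI[of _ "(\<lambda>h. g + h) ` A"])
    show "a \<odot>\<^bsub>M\<^esub> hcomp x (h - g) \<in> Mgr h" for h
      using Mgr_smult[OF a(1) hcomp_in[OF x, of "h - g"]] by simp
    show "a \<odot>\<^bsub>M\<^esub> hcomp x (h - g) = \<zero>\<^bsub>M\<^esub>" if "h \<notin> (\<lambda>h. g + h) ` A" for h
    proof -
      have "h - g \<notin> A" using that by (metis add.commute diff_add_cancel image_eqI)
      then show ?thesis using A(2) a by simp
    qed
    have "a \<odot>\<^bsub>M\<^esub> x = (\<Oplus>\<^bsub>M\<^esub>h\<in>A. a \<odot>\<^bsub>M\<^esub> hcomp x h)"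
      using A a x hcomp_closed by (subst A(3)) (intro finsum_smult_ldistr, auto)
    also have "\<dots> = (\<Oplus>\<^bsub>M\<^esub>h\<in>A. a \<odot>\<^bsub>M\<^esub> hcomp x ((g + h) - g))" by simp
    also have "\<dots> = (\<Oplus>\<^bsub>M\<^esub>h\<in>(\<lambda>h. g + h) ` A. a \<odot>\<^bsub>M\<^esub> hcomp x (h - g))"
      using a x hcomp_closed by (intro M.finsum_reindex[symmetric]) (auto simp: inj_on_def)
    finally show "a \<odot>\<^bsub>M\<^esub> x = (\<Oplus>\<^bsub>M\<^esub>h\<in>(\<lambda>h. g + h) ` A. a \<odot>\<^bsub>M\<^esub> hcomp x (h - g))" .
  qed (use A in simp)
qed (use a x in simp)

lemma hcomp_zero: "hcomp \<zero>\<^bsub>M\<^esub> g = \<zero>\<^bsub>M\<^esub>"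
  using hcomp_homogeneous[OF Mgr_zero[of g]] by simp

lemma hcomp_uminus:
  assumes "x \<in> carrier M"
  shows "hcomp (\<ominus>\<^bsub>M\<^esub> x) g = \<ominus>\<^bsub>M\<^esub> hcomp x g"
proof (rule M.minus_equality[symmetric])
  have "hcomp (\<ominus>\<^bsub>M\<^esub> x) g \<oplus>\<^bsub>M\<^esub> hcomp x g = hcomp (\<ominus>\<^bsub>M\<^esub> x \<oplus>\<^bsub>M\<^esub> x) g"
    using assms by (simp add: hcomp_add)
  then show "hcomp (\<ominus>\<^bsub>M\<^esub> x) g \<oplus>\<^bsub>M\<^esub> hcomp x g = \<zero>\<^bsub>M\<^esub>"
    using assms by (simp add: M.l_neg hcomp_zero)
qed (use assms hcomp_closed in auto)

lemma hcomp_alt: "x \<in> carrier M \<Longrightarrow> hcomp (alt M J l x) g = alt M J l (hcomp x g)"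
  by (simp add: alt_def hcomp_uminus)

lemma hcomp_finsum:
  assumes "finite A" "f \<in> A \<rightarrow> carrier M"
  shows "hcomp (\<Oplus>\<^bsub>M\<^esub>i\<in>A. f i) g = (\<Oplus>\<^bsub>M\<^esub>i\<in>A. hcomp (f i) g)"
  using assms
proof (induction A rule: finite_induct)
  case empty
  then show ?case by (simp add: hcomp_zero)
next
  case (insert a A)
  then show ?case by (simp add: hcomp_add hcomp_closed Pi_iff)
qed

end

section \<open>Bigraded modules\<close>

lemma mpoly_consts_component: "p \<in> mpoly_consts \<Longrightarrow> p \<in> mpoly_component V w 0"
  using mpoly_consts_closed[of V]
  by (auto simp: mpoly_component_def mpoly_consts_def monomial_degree_def split: if_splits)

lemma mpoly_var_component: "v \<in> V \<Longrightarrow> mpoly_var v \<in> mpoly_component V w (w v)"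
  using mpoly_var_closed[of v V]
  by (auto simp: mpoly_component_def mpoly_var_def monomial_degree_def split: if_splits)

lemma mpoly_ring_mono: "V \<subseteq> V' \<Longrightarrow> carrier (mpoly_ring V) \<subseteq> carrier (mpoly_ring V')"
  unfolding mem_mpoly_ring subset_iff by blast

locale bigraded_module = graded_over "XY_ring n r" L "XY_component n r d" Lgr
  for n r :: nat and d :: "nat \<Rightarrow> nat" and L :: "('k::field xypoly, 'm) module"
    and Lgr :: "int \<times> int \<Rightarrow> 'm set" +
  assumes fg: "finitely_generated (XY_ring n r) L"
begin

definition X :: "nat \<Rightarrow> 'k xypoly" where
  "X l = mpoly_var (Inl l)"

definition dmax :: int where
  "dmax = int (Max (d ` {1..r}))"

lemma X_closed: "l \<in> {1..n} \<Longrightarrow> X l \<in> carrier (XY_ring n r)"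
  unfolding X_def XY_ring_def by (rule mpoly_var_closed) (auto simp: XY_vars_def)

lemma X_component: "l \<in> {1..n} \<Longrightarrow> X l \<in> XY_component n r d (1, 0)"
  using mpoly_var_component[of "Inl l" "XY_vars n r" "bidegree d"]
  by (auto simp: X_def XY_component_def XY_vars_def bidegree_def)

lemma gens_closed: "mpoly_gens (XY_vars n r) \<subseteq> carrier (XY_ring n r)"
  unfolding XY_ring_def by (rule mpoly_gens_closed)

lemma gens_cases:
  assumes "a \<in> mpoly_gens (XY_vars n r)"
  obtains "a \<in> XY_component n r d (0, 0)" | l where "l \<in> {1..n}" "a = X l"
  | t where "t \<in> {1..r}" "a \<in> XY_component n r d (int (d t), 1)"
proof -
  consider "a \<in> mpoly_consts" | l where "l \<in> {1..n}" "a = mpoly_var (Inl l)"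
    | t where "t \<in> {1..r}" "a = mpoly_var (Inr t)"
    using assms by (auto simp: mpoly_gens_def XY_vars_def)
  then show ?thesis
  proof cases
    case 1
    then have "a \<in> XY_component n r d 0" unfolding XY_component_def by (rule mpoly_consts_component)
    then show ?thesis using that(1) by (simp add: zero_prod_def)
  next
    case 2
    then show ?thesis using that(2) by (simp add: X_def)
  next
    case 3
    then have "a \<in> XY_component n r d (bidegree d (Inr t))"
      unfolding XY_component_def 3 by (intro mpoly_var_component) (auto simp: XY_vars_def)
    then show ?thesis using that(3) 3 by (simp add: bidegree_def)
  qed
qed

lemma smult_X: "l \<in> {1..n} \<Longrightarrow> y \<in> Lgr (p, e) \<Longrightarrow> X l \<odot>\<^bsub>L\<^esub> y \<in> Lgr (p + 1, e)"
  using Mgr_smult[OF X_component, of l y "(p, e)"] by (simp add: add_ac)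

section \<open>Bigraded Koszul cocycles and boundaries\<close>

definition cocycles :: "(nat set \<Rightarrow> 'm) set" where
  "cocycles = {c \<in> carrier (power_module (Pow {1..n}) L). \<forall>J\<subseteq>{1..n}. koszul_diff L X c J = \<zero>\<^bsub>L\<^esub>}"

text \<open>The shift by \<open>card I\<close> compensates for the degree of the \<open>X l\<close>,
  so that the Koszul differential preserves the bidegree \<open>(p, e)\<close>.\<close>

definition homogeneous :: "int \<Rightarrow> int \<Rightarrow> (nat set \<Rightarrow> 'm) \<Rightarrow> bool" where
  "homogeneous p e c \<longleftrightarrow> (\<forall>I\<subseteq>{1..n}. c I \<in> Lgr (p + int (card I), e))"

definition boundary :: "int \<Rightarrow> int \<Rightarrow> (nat set \<Rightarrow> 'm) \<Rightarrow> bool" where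
  "boundary p e c \<longleftrightarrow> (\<exists>h. homogeneous p e h \<and> (\<forall>I\<subseteq>{1..n}. c I = koszul_diff L X h I))"

definition component :: "int \<Rightarrow> int \<Rightarrow> (nat set \<Rightarrow> 'm) \<Rightarrow> nat set \<Rightarrow> 'm" where
  "component p e c I = hcomp (c I) (p + int (card I), e)"

lemma cocycles_closed: "c \<in> cocycles \<Longrightarrow> c I \<in> carrier L"
  by (simp add: cocycles_def power_module_simps)

lemma cocyclesD: "c \<in> cocycles \<Longrightarrow> J \<subseteq> {1..n} \<Longrightarrow> koszul_diff L X c J = \<zero>\<^bsub>L\<^esub>"
  by (simp add: cocycles_def)

lemma XJ_closed: "J \<subseteq> {1..n} \<Longrightarrow> l \<in> J \<Longrightarrow> X l \<in> carrier (XY_ring n r)"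
  using X_closed by blast

lemma homogeneous_closed: "homogeneous p e c \<Longrightarrow> I \<subseteq> {1..n} \<Longrightarrow> c I \<in> carrier L"
  unfolding homogeneous_def using Mgr_carrier by blast

lemma finite_J: "J \<subseteq> {1..n} \<Longrightarrow> finite (J :: nat set)"
  by (rule finite_subset) auto

lemma homogeneous_Diff: "homogeneous p e c \<Longrightarrow> J \<subseteq> {1..n} \<Longrightarrow> c (J - {l}) \<in> carrier L"
  by (rule homogeneous_closed) auto

lemma boundary_zero: "(\<And>I. I \<subseteq> {1..n} \<Longrightarrow> c I = \<zero>\<^bsub>L\<^esub>) \<Longrightarrow> boundary p e c"
  unfolding boundary_def homogeneous_def
  by (rule exI[of _ "\<lambda>_. \<zero>\<^bsub>L\<^esub>"]) (auto simp: Mgr_zero koszul_diff_def XJ_closed intro!: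
      finsum_zero_eq[symmetric])

lemma boundary_add:
  assumes "boundary p e c" "boundary p e c'" "\<And>I. I \<subseteq> {1..n} \<Longrightarrow> c'' I = c I \<oplus>\<^bsub>L\<^esub> c' I"
  shows "boundary p e c''"
proof -
  obtain h h' where h: "homogeneous p e h" "\<And>I. I \<subseteq> {1..n} \<Longrightarrow> c I = koszul_diff L X h I"
    and h': "homogeneous p e h'" "\<And>I. I \<subseteq> {1..n} \<Longrightarrow> c' I = koszul_diff L X h' I"
    using assms(1,2) unfolding boundary_def by blast
  have "c'' I = koszul_diff L X (\<lambda>I. h I \<oplus>\<^bsub>L\<^esub> h' I) I" if I: "I \<subseteq> {1..n}" for I
    using koszul_diff_add[where a = X and c = h and c' = h', OF finite_J[OF I] XJ_closed[OF I]
        homogeneous_Diff[OF h(1) I] homogeneous_Diff[OF h'(1) I]] assms(3)[OF I] h(2)[OF I]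
            h'(2)[OF I] by simp
  moreover have "homogeneous p e (\<lambda>I. h I \<oplus>\<^bsub>L\<^esub> h' I)"
    using h(1) h'(1) Mgr_add unfolding homogeneous_def by simp
  ultimately show ?thesis unfolding boundary_def by blast
qed

lemma boundary_smult:
  assumes "boundary p e c" "a \<in> XY_component n r d (i, j)" "a \<in> carrier (XY_ring n r)"
    "\<And>I. I \<subseteq> {1..n} \<Longrightarrow> c' I = a \<odot>\<^bsub>L\<^esub> c I"
  shows "boundary (i + p) (j + e) c'"
proof -
  obtain h where h: "homogeneous p e h" "\<And>I. I \<subseteq> {1..n} \<Longrightarrow> c I = koszul_diff L X h I"
    using assms(1) unfolding boundary_def by blast
  have "c' I = koszul_diff L X (\<lambda>I. a \<odot>\<^bsub>L\<^esub> h I) I" if I: "I \<subseteq> {1..n}" for I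
    using koszul_diff_smult[where a = X and c = h, OF finite_J[OF I] assms(3) XJ_closed[OF I]
        homogeneous_Diff[OF h(1) I]] assms(4)[OF I] h(2)[OF I] by simp
  moreover have "homogeneous (i + p) (j + e) (\<lambda>I. a \<odot>\<^bsub>L\<^esub> h I)"
    unfolding homogeneous_def
  proof (intro allI impI)
    fix I assume "I \<subseteq> {1..n}"
    then show "a \<odot>\<^bsub>L\<^esub> h I \<in> Lgr (i + p + int (card I), j + e)"
      using Mgr_smult[OF assms(2), of "h I" "(p + int (card I), e)"] h(1)
      by (simp add: homogeneous_def add_ac)
  qed
  ultimately show ?thesis unfolding boundary_def by blast
qed

lemma alt_Mgr: "y \<in> Lgr g \<Longrightarrow> alt L J l y \<in> Lgr g"
  unfolding alt_def using additive_subgroup_inv[OF additive_subgroup_Mgr] by simp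

text \<open>The primitive is \<open>contraction l c\<close>. It places the value of \<open>c\<close>
  at \<open>insert l I\<close>, of first degree \<open>p + card I + 1\<close>, at \<open>I\<close>,
  and therefore has bidegree \<open>(p + 1, e)\<close>, as multiplication by \<open>X l\<close>
  demands.\<close>

lemma boundary_X:
  assumes c: "homogeneous p e c" and cocycle: "\<And>J. J \<subseteq> {1..n} \<Longrightarrow> koszul_diff L X c J = \<zero>\<^bsub>L\<^esub>"
    and l: "l \<in> {1..n}" and c': "\<And>I. I \<subseteq> {1..n} \<Longrightarrow> c' I = X l \<odot>\<^bsub>L\<^esub> c I"
  shows "boundary (p + 1) e c'"
proof -
  have "c' I = koszul_diff L X (contraction l c) I" if I: "I \<subseteq> {1..n}" for I
    using smult_eq_koszul_diff_contraction[where A = "{1..n}" and a = X and c = c, OF _ X_closed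
        homogeneous_closed[OF c] cocycle l I] c'[OF I] by simp
  moreover have "homogeneous (p + 1) e (contraction l c)"
    unfolding homogeneous_def
  proof (intro allI impI)
    fix I assume I: "I \<subseteq> {1..n}"
    show "contraction l c I \<in> Lgr (p + 1 + int (card I), e)"
    proof (cases "l \<in> I")
      case True
      then show ?thesis by (simp add: contraction_def Mgr_zero)
    next
      case False
      then have "c (insert l I) \<in> Lgr (p + 1 + int (card I), e)"
        using c[unfolded homogeneous_def, rule_format, of "insert l I"] I l finite_J[OF I] by
            (simp add: add_ac)
      then show ?thesis using False by (simp add: contraction_def alt_Mgr)
    qed
  qed
  ultimately show ?thesis unfolding boundary_def by blast
qed

lemma homogeneous_component: "(\<And>I. c I \<in> carrier L) \<Longrightarrow> homogeneous p e (component p e c)"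
  by (simp add: homogeneous_def component_def hcomp_in)

text \<open>The differential preserves bidegrees, so it commutes with taking components. In
  particular, the components of a cocycle are cocycles.\<close>

lemma koszul_diff_component:
  assumes c: "\<And>I. c I \<in> carrier L" and J: "J \<subseteq> {1..n}"
  shows "koszul_diff L X (component p e c) J = hcomp (koszul_diff L X c J) (p + int (card J), e)"
proof -
  have "hcomp (koszul_diff L X c J) (p + int (card J), e) =
    (\<Oplus>\<^bsub>L\<^esub>l\<in>J. hcomp (alt L J l (X l \<odot>\<^bsub>L\<^esub> c (J - {l}))) (p + int (card J), e))"
    unfolding koszul_diff_def using c J XJ_closed finite_J by (intro hcomp_finsum) auto
  also have "\<dots> = koszul_diff L X (component p e c) J"
    unfolding koszul_diff_def
  proof (intro M.finsum_cong')
    fix l assume l: "l \<in> J"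
    have card_J: "card J = Suc (card (J - {l}))" by (rule card.remove[OF finite_J[OF J] l])
    have "hcomp (X l \<odot>\<^bsub>L\<^esub> c (J - {l})) (p + int (card J), e) = X l \<odot>\<^bsub>L\<^esub> component p e c (J - {l})"
      unfolding component_def hcomp_smult[OF X_component[OF subsetD[OF J l]] XJ_closed[OF J l] c]
          card_J by simp
    then show "hcomp (alt L J l (X l \<odot>\<^bsub>L\<^esub> c (J - {l}))) (p + int (card J), e) =
      alt L J l (X l \<odot>\<^bsub>L\<^esub> component p e c (J - {l}))"
      using c XJ_closed[OF J l] by (simp add: hcomp_alt)
  qed (use c J XJ_closed in \<open>auto simp: component_def hcomp_closed\<close>)
  finally show ?thesis by simp
qed

section \<open>The degree bound from the ascending chain condition\<close>

text \<open>An increasing chain of submodules that contains every homogeneous cocycle from some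
  index on. Its stationarity supplies the constant of the theorem, so that no generating set has to
  be split into homogeneous parts.\<close>

definition bounded_cocycles :: "nat \<Rightarrow> (nat set \<Rightarrow> 'm) set" where
  "bounded_cocycles k = gen (power_module (Pow {1..n}) L) (mpoly_gens (XY_vars n r))
    {c \<in> cocycles. \<exists>p e. homogeneous p e c \<and> p \<le> dmax * e + int k}"

lemma power: "Module.module (XY_ring n r) (power_module (Pow {1..n}) L)"
  by (rule module_power)

lemma cocycles_carrier: "cocycles \<subseteq> carrier (power_module (Pow {1..n}) L)"
  by (auto simp: cocycles_def)

lemma stable_cocycles: "stable (power_module (Pow {1..n}) L) (mpoly_gens (XY_vars n r)) cocycles"
proof -
  interpret P: Module.module "XY_ring n r" "power_module (Pow {1..n}) L" by (rule power)
  show ?thesis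
    unfolding stable_def
  proof (intro conjI ballI cocycles_carrier)
    show "\<zero>\<^bsub>power_module (Pow {1..n}) L\<^esub> \<in> cocycles"
      by (auto simp: cocycles_def power_module_simps koszul_diff_def XJ_closed intro!:
          finsum_zero_eq)
  next
    fix c c' assume c: "c \<in> cocycles" and c': "c' \<in> cocycles"
    have "koszul_diff L X (\<lambda>I. c I \<oplus>\<^bsub>L\<^esub> c' I) J = \<zero>\<^bsub>L\<^esub>" if J: "J \<subseteq> {1..n}" for J
      using koszul_diff_add[where a = X and c = c and c' = c', OF finite_J[OF J] XJ_closed[OF J]
          cocycles_closed[OF c] cocycles_closed[OF c']] cocyclesD[OF c J] cocyclesD[OF c' J] by simp
    then show "c \<oplus>\<^bsub>power_module (Pow {1..n}) L\<^esub> c' \<in> cocycles"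
      using c c' cocycles_carrier by (auto simp: cocycles_def power_module_simps)
  next
    fix a :: "'k xypoly" and c assume a: "a \<in> mpoly_gens (XY_vars n r)" and c: "c \<in> cocycles"
    have aR: "a \<in> carrier (XY_ring n r)" using a gens_closed by blast
    have "koszul_diff L X (\<lambda>I. a \<odot>\<^bsub>L\<^esub> c I) J = \<zero>\<^bsub>L\<^esub>" if J: "J \<subseteq> {1..n}" for J
      using koszul_diff_smult[where a = X and c = c, OF finite_J[OF J] aR XJ_closed[OF J]
          cocycles_closed[OF c]] cocyclesD[OF c J] aR by simp
    then show "a \<odot>\<^bsub>power_module (Pow {1..n}) L\<^esub> c \<in> cocycles"
      using c aR by (auto simp: cocycles_def power_module_simps)
  qed
qed

lemma bounded_cocycles_stationary: "\<exists>k. \<forall>i\<ge>k. bounded_cocycles i = bounded_cocycles k"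
proof -
  let ?P = "power_module (Pow {1..n}) L" and ?C = "mpoly_gens (XY_vars n r)"
  let ?V = "mpoly_var ` XY_vars n r :: 'k xypoly set"
  have L: "Module.module (mpoly_ring (XY_vars n r)) L" "finitely_generated (mpoly_ring (XY_vars n
      r)) L"
    using module_axioms fg by (auto simp: XY_ring_def)
  obtain B where B: "finite B" "B \<subseteq> carrier L" "carrier L \<subseteq> gen L ?C B"
    using finitely_generated_imp_gen[OF L] by blast
  have "noetherian_on ?P (mpoly_consts \<union> ?V) (carrier ?P)"
  proof (rule noetherian_on_power)
    show "subfield mpoly_consts (XY_ring n r)" unfolding XY_ring_def by (rule subfield_mpoly_consts)
    show "?V \<subseteq> carrier (XY_ring n r)" using gens_closed by (auto simp: mpoly_gens_def)
    show "finite ?V" by (simp add: XY_vars_def)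
    show "carrier L \<subseteq> gen L (mpoly_consts \<union> ?V) B" using B(3) by (simp add: mpoly_gens_def)
  qed (use B in auto)
  then have noeth: "noetherian_on ?P ?C (carrier ?P)" by (simp add: mpoly_gens_def)
  have st: "stable ?P ?C (bounded_cocycles k)" for k
    unfolding bounded_cocycles_def
    by (rule module.stable_gen[OF power gens_closed]) (use cocycles_carrier in auto)
  have mono: "bounded_cocycles i \<subseteq> bounded_cocycles j" if "i \<le> j" for i j
    unfolding bounded_cocycles_def
  proof (rule gen_mono)
    show "{c \<in> cocycles. \<exists>p e. homogeneous p e c \<and> p \<le> dmax * e + int i} \<subseteq>
      {c \<in> cocycles. \<exists>p e. homogeneous p e c \<and> p \<le> dmax * e + int j}"
      using that by fastforce
  qed auto
  obtain k where "\<And>i. k \<le> i \<Longrightarrow> bounded_cocycles i = bounded_cocycles k"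
    by (rule noetherian_onD[of ?P ?C "carrier ?P" bounded_cocycles, OF noeth st stableD(1)[OF st]
        mono])
      (assumption, rule that)
  then show ?thesis by blast
qed

text \<open>A generator of bidegree \<open>(q, f)\<close> with \<open>q \<le> dmax * f + k\<close> has to be multiplied by at least
    one \<open>X\<^sub>l\<close>
  in order to reach a bidegree \<open>(p, e)\<close> with \<open>p > dmax * e + k\<close>, and \<open>X\<^sub>l\<close> annihilates Koszul
      cohomology.\<close>

lemma bounded_cocycles_boundary:
  assumes "y \<in> bounded_cocycles k" "p > dmax * e + int k"
  shows "boundary p e (component p e y)"
proof -
  let ?P = "power_module (Pow {1..n}) L" and ?C = "mpoly_gens (XY_vars n r)"
  \<comment> \<open>Generated elements need not be homogeneous, so the claim is phrased for all
    components above the line with slope \<open>dmax\<close> and offset \<open>k\<close>. It then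
    suffices that \<open>T\<close> is stable and contains the generators.\<close>
  define T where "T = {y \<in> cocycles. \<forall>p e. p > dmax * e + int k \<longrightarrow> boundary p e (component p e y)}"
  note cc = cocycles_closed
  have "bounded_cocycles k \<subseteq> T"
    unfolding bounded_cocycles_def
  proof (rule gen_least)
    show "{c \<in> cocycles. \<exists>p e. homogeneous p e c \<and> p \<le> dmax * e + int k} \<subseteq> T"
    proof
      fix c assume "c \<in> {c \<in> cocycles. \<exists>p e. homogeneous p e c \<and> p \<le> dmax * e + int k}"
      then obtain q f where c: "c \<in> cocycles" "homogeneous q f c" "q \<le> dmax * f + int k" by blast
      \<comment> \<open>A generator sits on or below the line, so its components above the line are
        zero.\<close>
      have "boundary p e (component p e c)" if "p > dmax * e + int k" for p e
      proof (rule boundary_zero)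
        fix I assume "I \<subseteq> {1..n}"
        then have "c I \<in> Lgr (q + int (card I), f)" using c(2) by (simp add: homogeneous_def)
        moreover have "(p, e) \<noteq> (q, f)" using c(3) that by auto
        ultimately show "component p e c I = \<zero>\<^bsub>L\<^esub>" by (auto simp: component_def hcomp_homogeneous)
      qed
      then show "c \<in> T" using c(1) by (simp add: T_def)
    qed
    show "stable ?P ?C T"
      unfolding stable_def
    proof (intro conjI ballI)
      show "T \<subseteq> carrier ?P" using cocycles_carrier by (auto simp: T_def)
      show "\<zero>\<^bsub>?P\<^esub> \<in> T"
        using stableD(3)[OF stable_cocycles]
        by (auto simp: T_def power_module_simps component_def hcomp_zero intro!: boundary_zero)
    next
      fix c c' assume c: "c \<in> T" and c': "c' \<in> T"
      then have z: "c \<in> cocycles" "c' \<in> cocycles" by (auto simp: T_def)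
      have "boundary p e (component p e (c \<oplus>\<^bsub>?P\<^esub> c'))" if "p > dmax * e + int k" for p e
        by (rule boundary_add[of p e "component p e c" "component p e c'"])
          (use c c' that in \<open>auto simp: T_def component_def power_module_simps hcomp_add cc\<close>)
      then show "c \<oplus>\<^bsub>?P\<^esub> c' \<in> T" using stableD(4)[OF stable_cocycles z] by (simp add: T_def)
    next
      fix a :: "'k xypoly" and c assume a: "a \<in> ?C" and cT: "c \<in> T"
      have aR: "a \<in> carrier (XY_ring n r)" using a gens_closed by blast
      have c: "c \<in> cocycles" using cT by (simp add: T_def)
      have comp: "component p e (a \<odot>\<^bsub>?P\<^esub> c) I = a \<odot>\<^bsub>L\<^esub> component (p - i) (e - j) c I"
        if "a \<in> XY_component n r d (i, j)" for p e i j I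
        using hcomp_smult[OF that aR cc[OF c]]
        by (simp add: component_def power_module_simps algebra_simps)
      have "boundary p e (component p e (a \<odot>\<^bsub>?P\<^esub> c))" if pe: "p > dmax * e + int k" for p e
        using a
      proof (cases rule: gens_cases)
        case 1
        have "boundary p e (component p e c)" using cT pe by (simp add: T_def)
        from boundary_smult[OF this 1 aR] show ?thesis using comp[OF 1] by simp
      next
        case (2 l)
        note aX = X_component[OF 2(1), folded 2(2)]
        \<comment> \<open>The bidegree \<open>(p - 1, e)\<close> may lie on the line, where
          \<open>T\<close> gives no information. Only the cocycle property of this component is
          used, and contraction does the rest.\<close>
        have "koszul_diff L X (component (p - 1) e c) J = \<zero>\<^bsub>L\<^esub>" if "J \<subseteq> {1..n}" for J
          using that c by (simp add: koszul_diff_component cc cocyclesD hcomp_zero)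
        from boundary_X[OF homogeneous_component this 2(1)] show ?thesis
          using comp[OF aX] cc[OF c] 2(2) by simp
      next
        case (3 t)
        have "int (d t) \<le> dmax" using 3(1) by (simp add: dmax_def)
        \<comment> \<open>Removing \<open>Y_t\<close> lowers \<open>e\<close> by one and
          \<open>p\<close> by at most \<open>dmax\<close>, so the bidegree stays above the
          line.\<close>
        then have "p - int (d t) > dmax * (e - 1) + int k" using pe by (simp add: algebra_simps)
        then have "boundary (p - int (d t)) (e - 1) (component (p - int (d t)) (e - 1) c)"
          using cT by (simp add: T_def)
        from boundary_smult[OF this 3(2) aR] show ?thesis using comp[OF 3(2)] by simp
      qed
      then show "a \<odot>\<^bsub>?P\<^esub> c \<in> T" using stableD(5)[OF stable_cocycles a c] by (simp add: T_def)
    qed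
  qed
  with assms show ?thesis by (auto simp: T_def)
qed

theorem koszul_exact_high_degree:
  obtains k :: nat where "\<And>p e. p > dmax * e + int k \<Longrightarrow>
    koszul_exact L {1..n} X (\<lambda>I. Lgr (p + int (card I), e))"
proof -
  obtain k where k: "\<And>i. k \<le> i \<Longrightarrow> bounded_cocycles i = bounded_cocycles k"
    using bounded_cocycles_stationary by blast
  show ?thesis
  proof (rule that[of k], rule koszul_exactI)
    fix p e c
    assume pe: "p > dmax * e + int k" and hom: "\<And>I. I \<subseteq> {1..n} \<Longrightarrow> c I \<in> Lgr (p + int (card I), e)"
      and cocycle: "\<And>J. J \<subseteq> {1..n} \<Longrightarrow> koszul_diff L X c J = \<zero>\<^bsub>L\<^esub>"
    \<comment> \<open>Extension by zero makes the cochain an element of the power module; exactness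
      itself only constrains the subsets of \<open>{1..n}\<close>.\<close>
    define c' where "c' I = (if I \<subseteq> {1..n} then c I else \<zero>\<^bsub>L\<^esub>)" for I
    have cM: "c I \<in> carrier L" if "I \<subseteq> {1..n}" for I using hom[OF that] Mgr_carrier by blast
    have "koszul_diff L X c' J = \<zero>\<^bsub>L\<^esub>" if J: "J \<subseteq> {1..n}" for J
    proof -
      have sub: "J - {l} \<subseteq> {1..n}" for l using J by blast
      have "koszul_diff L X c' J = koszul_diff L X c J"
        by (rule koszul_diff_cong) (use XJ_closed[OF J] cM[OF sub] sub in \<open>auto simp: c'_def\<close>)
      then show ?thesis using cocycle[OF J] by simp
    qed
    then have c': "c' \<in> cocycles" using cM by (auto simp: cocycles_def power_module_simps c'_def)
    have hom': "homogeneous p e c'" using hom by (simp add: homogeneous_def c'_def)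
    \<comment> \<open>Large enough for the given bidegree to satisfy the bound with offset
      \<open>i\<close>, and at least \<open>k\<close>, so that stationarity brings \<open>c'\<close>
      back into \<open>bounded_cocycles k\<close>.\<close>
    define i where "i = max k (nat (p - dmax * e))"
    have "p \<le> dmax * e + int i" unfolding i_def by linarith
    then have "c' \<in> bounded_cocycles i"
      unfolding bounded_cocycles_def using c' hom' by (intro gen.gen_incl) blast
    then have "c' \<in> bounded_cocycles k" using k[of i] by (simp add: i_def)
    from bounded_cocycles_boundary[OF this pe]
    obtain h where h: "homogeneous p e h" "\<And>I. I \<subseteq> {1..n} \<Longrightarrow> component p e c' I = koszul_diff L X h
        I"
      unfolding boundary_def by blast
    have "component p e c' I = c I" if I: "I \<subseteq> {1..n}" for I
      using hcomp_homogeneous[OF hom[OF I]] I by (simp add: component_def c'_def)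
    with h show "\<exists>h. (\<forall>I\<subseteq>{1..n}. h I \<in> Lgr (p + int (card I), e)) \<and>
        (\<forall>I\<subseteq>{1..n}. c I = koszul_diff L X h I)"
      by (intro exI[of _ h]) (simp add: homogeneous_def)
  qed
qed

section \<open>Slices and the transfer of exactness to them\<close>

definition slice_carrier :: "int \<Rightarrow> 'm set" where
  "slice_carrier e = carrier (slice L Lgr e)"

text \<open>Membership in a slice becomes the vanishing of components in all other rows, so the
  closure properties follow from the rules for \<open>hcomp\<close>.\<close>

lemma slice_carrier_iff:
  "x \<in> slice_carrier e \<longleftrightarrow> x \<in> carrier L \<and> (\<forall>i f. f \<noteq> e \<longrightarrow> hcomp x (i, f) = \<zero>\<^bsub>L\<^esub>)"
proof
  assume "x \<in> slice_carrier e"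
  then obtain f A where x: "x = (\<Oplus>\<^bsub>L\<^esub>i\<in>A. f i)" "finite A" "\<And>i. i \<in> A \<Longrightarrow> f i \<in> Lgr (i, e)"
    unfolding slice_carrier_def slice_def by auto
  have f: "f \<in> A \<rightarrow> carrier L" using x(3) Mgr_carrier by blast
  have "hcomp x (i, e') = \<zero>\<^bsub>L\<^esub>" if "e' \<noteq> e" for i e'
    unfolding x(1) hcomp_finsum[OF x(2) f] using that
    by (intro finsum_zero_eq) (simp add: hcomp_homogeneous[OF x(3)])
  then show "x \<in> carrier L \<and> (\<forall>i f. f \<noteq> e \<longrightarrow> hcomp x (i, f) = \<zero>\<^bsub>L\<^esub>)"
    using x(1) f by simp
next
  assume x: "x \<in> carrier L \<and> (\<forall>i f. f \<noteq> e \<longrightarrow> hcomp x (i, f) = \<zero>\<^bsub>L\<^esub>)"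
  then obtain A where A: "finite A" "\<And>g. g \<notin> A \<Longrightarrow> hcomp x g = \<zero>\<^bsub>L\<^esub>"
    using decomposesE[of x] by metis
  have "x = (\<Oplus>\<^bsub>L\<^esub>g\<in>(\<lambda>i. (i, e)) ` fst ` A. hcomp x g)"
  proof (rule decomposesE')
    fix g assume "g \<notin> (\<lambda>i. (i, e)) ` fst ` A"
    then have "g \<notin> A \<or> snd g \<noteq> e" by (metis image_eqI prod.collapse)
    then show "hcomp x g = \<zero>\<^bsub>L\<^esub>" using A x by (metis prod.collapse)
  qed (use x A in auto)
  also have "\<dots> = (\<Oplus>\<^bsub>L\<^esub>i\<in>fst ` A. hcomp x (i, e))"
    using x by (intro M.finsum_reindex) (auto simp: inj_on_def hcomp_closed)
  finally show "x \<in> slice_carrier e"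
    unfolding slice_carrier_def slice_def using A x
    by (auto intro!: exI[of _ "\<lambda>i. hcomp x (i, e)"] exI[of _ "fst ` A"] hcomp_in)
qed

lemma Lgr_slice_carrier: "Lgr (i, e) \<subseteq> slice_carrier e"
proof
  fix x assume x: "x \<in> Lgr (i, e)"
  then have "x \<in> carrier L" using Mgr_carrier by blast
  then show "x \<in> slice_carrier e" by (simp add: slice_carrier_iff hcomp_homogeneous[OF x])
qed

lemma slice_eq: "slice L Lgr e = L\<lparr>carrier := slice_carrier e\<rparr>"
  by (simp add: slice_carrier_def slice_def)

lemma X_ring_subset: "carrier (X_ring n) \<subseteq> carrier (XY_ring n r)"
  unfolding X_ring_def XY_ring_def by (rule mpoly_ring_mono) (auto simp: X_vars_def XY_vars_def)

lemma module_X_ring: "Module.module (X_ring n) L"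
proof (rule moduleI)
  show "cring (X_ring n)" unfolding X_ring_def by (rule cring_mpoly_ring)
  show "abelian_group L" by (rule M.abelian_group_axioms)
next
  fix x assume "x \<in> carrier L"
  then show "\<one>\<^bsub>X_ring n\<^esub> \<odot>\<^bsub>L\<^esub> x = x" using smult_one[of x] by (simp add: X_ring_def XY_ring_def)
next
  fix a b :: "'k xypoly" and x assume "a \<in> carrier (X_ring n)" "b \<in> carrier (X_ring n)" and x: "x
      \<in> carrier L"
  then have ab: "a \<in> carrier (XY_ring n r)" "b \<in> carrier (XY_ring n r)" using X_ring_subset by auto
  show "(a \<oplus>\<^bsub>X_ring n\<^esub> b) \<odot>\<^bsub>L\<^esub> x = a \<odot>\<^bsub>L\<^esub> x \<oplus>\<^bsub>L\<^esub> b \<odot>\<^bsub>L\<^esub> x"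
    using smult_l_distr[OF ab x] by (simp add: X_ring_def XY_ring_def)
  show "(a \<otimes>\<^bsub>X_ring n\<^esub> b) \<odot>\<^bsub>L\<^esub> x = a \<odot>\<^bsub>L\<^esub> (b \<odot>\<^bsub>L\<^esub> x)"
    using smult_assoc1[OF ab x] by (simp add: X_ring_def XY_ring_def)
qed (use X_ring_subset in \<open>auto intro: smult_r_distr\<close>)

lemma submodule_slice: "submodule (slice_carrier e) (X_ring n) L"
proof -
  have st: "stable L (mpoly_gens (X_vars n)) (slice_carrier e)"
    unfolding stable_def
  proof (intro conjI ballI)
    show "slice_carrier e \<subseteq> carrier L" by (auto simp: slice_carrier_iff)
    show "\<zero>\<^bsub>L\<^esub> \<in> slice_carrier e" by (auto simp: slice_carrier_iff hcomp_zero)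
  next
    fix x y assume "x \<in> slice_carrier e" "y \<in> slice_carrier e"
    then show "x \<oplus>\<^bsub>L\<^esub> y \<in> slice_carrier e" by (auto simp: slice_carrier_iff hcomp_add)
  next
    fix a :: "'k xypoly" and x assume "a \<in> mpoly_gens (X_vars n)" and x: "x \<in> slice_carrier e"
    then have "a \<in> mpoly_consts \<or> (\<exists>l\<in>{1..n}. a = X l)"
      by (auto simp: mpoly_gens_def X_vars_def X_def)
    moreover have "a \<in> XY_component n r d (0, 0)" if "a \<in> mpoly_consts"
      using that unfolding XY_component_def zero_prod_def[symmetric] by (rule
          mpoly_consts_component)
    \<comment> \<open>Constants and the \<open>X l\<close> have second degree 0, so multiplication
      by them moves components within their row.\<close>
    ultimately obtain i where i: "a \<in> XY_component n r d (i, 0)" using X_component by blast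
    then have "a \<in> carrier (XY_ring n r)" by (simp add: XY_component_def mpoly_component_def
        XY_ring_def)
    then show "a \<odot>\<^bsub>L\<^esub> x \<in> slice_carrier e"
      using x by (auto simp: slice_carrier_iff hcomp_smult[OF i])
  qed
  show ?thesis
  proof (rule module.submoduleI[OF module_X_ring])
    fix a :: "'k xypoly" and x assume "a \<in> carrier (X_ring n)" "x \<in> slice_carrier e"
    then show "a \<odot>\<^bsub>L\<^esub> x \<in> slice_carrier e"
      using stable_mpoly_gens_smult[OF _ st] module_X_ring by (simp add: X_ring_def)
  next
    fix x assume "x \<in> slice_carrier e"
    then show "\<ominus>\<^bsub>L\<^esub> x \<in> slice_carrier e" by (simp add: slice_carrier_iff hcomp_uminus)
  qed (use stableD[OF st] in auto)
qed

lemma module_slice: "Module.module (X_ring n) (slice L Lgr e)"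
  unfolding slice_eq by (rule submodule.submodule_is_module[OF submodule_slice module_X_ring])

lemma slice_simps:
  "carrier (slice L Lgr e) = slice_carrier e" "\<zero>\<^bsub>slice L Lgr e\<^esub> = \<zero>\<^bsub>L\<^esub>" "add (slice L Lgr e) = add
      L"
  "smult (slice L Lgr e) = smult L"
  by (simp_all add: slice_eq)

text \<open>Negation is defined through the carrier, so replacing the carrier of \<open>L\<close>
  does not preserve it by definition; uniqueness of inverses in the slice is needed.
  \<open>finsum_slice\<close> settles the same issue for finite sums.\<close>

lemma uminus_slice:
  assumes "x \<in> slice_carrier e"
  shows "\<ominus>\<^bsub>slice L Lgr e\<^esub> x = \<ominus>\<^bsub>L\<^esub> x"
proof -
  interpret S: Module.module "X_ring n" "slice L Lgr e" by (rule module_slice)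
  have "\<ominus>\<^bsub>L\<^esub> x \<in> slice_carrier e" using assms by (simp add: slice_carrier_iff hcomp_uminus)
  then show ?thesis
    using assms by (intro S.M.minus_equality) (auto simp: slice_simps M.l_neg slice_carrier_iff)
qed

lemma finsum_slice:
  assumes "finite A" "f \<in> A \<rightarrow> slice_carrier e"
  shows "(\<Oplus>\<^bsub>slice L Lgr e\<^esub>i\<in>A. f i) = (\<Oplus>\<^bsub>L\<^esub>i\<in>A. f i)"
proof -
  interpret S: Module.module "X_ring n" "slice L Lgr e" by (rule module_slice)
  show ?thesis
    using assms
  proof (induction A rule: finite_induct)
    case empty
    show ?case by (simp add: slice_simps)
  next
    case (insert a A)
    then have "f a \<in> slice_carrier e" "f \<in> A \<rightarrow> slice_carrier e" by auto
    moreover from this have "f a \<in> carrier L" "f \<in> A \<rightarrow> carrier L"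
      by (auto simp: slice_carrier_iff)
    ultimately show ?case
      using insert S.M.finsum_insert[of A a f] M.finsum_insert[of A a f] by (simp add: slice_simps)
  qed
qed

lemma X_closed_X_ring: "l \<in> {1..n} \<Longrightarrow> X l \<in> carrier (X_ring n)"
  unfolding X_def X_ring_def by (rule mpoly_var_closed) (auto simp: X_vars_def)

lemma koszul_diff_slice:
  assumes c: "\<And>l. l \<in> J \<Longrightarrow> c (J - {l}) \<in> slice_carrier e" and J: "J \<subseteq> {1..n}"
  shows "koszul_diff (slice L Lgr e) X c J = koszul_diff L X c J"
proof -
  interpret S: Module.module "X_ring n" "slice L Lgr e" by (rule module_slice)
  have Xc: "X l \<odot>\<^bsub>L\<^esub> c (J - {l}) \<in> slice_carrier e" if "l \<in> J" for l
    using S.smult_closed[of "X l" "c (J - {l})"] c[OF that] X_closed_X_ring[of l] J that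
    by (auto simp: slice_simps)
  have alt: "alt (slice L Lgr e) J l y = alt L J l y" if "y \<in> slice_carrier e" for l y
    using uminus_slice[OF that] by (simp add: alt_def)
  have alt_in: "alt L J l y \<in> slice_carrier e" if "y \<in> slice_carrier e" for l y
    using that by (auto simp: alt_def slice_carrier_iff hcomp_uminus)
  have "koszul_diff (slice L Lgr e) X c J = (\<Oplus>\<^bsub>slice L Lgr e\<^esub>l\<in>J. alt L J l (X l \<odot>\<^bsub>L\<^esub> c (J - {l})))"
    unfolding koszul_diff_def slice_simps using alt[OF Xc] alt_in[OF Xc]
    by (intro S.M.finsum_cong') (auto simp: slice_simps)
  also have "\<dots> = koszul_diff L X c J"
    unfolding koszul_diff_def using alt_in[OF Xc] by (intro finsum_slice finite_J[OF J]) auto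
  finally show ?thesis .
qed

lemma additive_subgroup_slice_component: "additive_subgroup (slice_component Lgr e j) (slice L Lgr
    e)"
proof -
  interpret S: Module.module "X_ring n" "slice L Lgr e" by (rule module_slice)
  show ?thesis
  proof (rule additive_subgroup.intro, rule S.M.add.subgroupI)
    show "slice_component Lgr e j \<subseteq> carrier (slice L Lgr e)"
      using Lgr_slice_carrier by (simp add: slice_component_def slice_simps)
    show "slice_component Lgr e j \<noteq> {}" using Mgr_zero by (auto simp: slice_component_def)
  next
    fix x assume x: "x \<in> slice_component Lgr e j"
    then have "x \<in> slice_carrier e" using Lgr_slice_carrier by (auto simp: slice_component_def)
    then show "\<ominus>\<^bsub>slice L Lgr e\<^esub> x \<in> slice_component Lgr e j"
      using x additive_subgroup_inv[OF additive_subgroup_Mgr] by (simp add: uminus_slice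
          slice_component_def)
  next
    fix x y assume "x \<in> slice_component Lgr e j" "y \<in> slice_component Lgr e j"
    then show "x \<oplus>\<^bsub>slice L Lgr e\<^esub> y \<in> slice_component Lgr e j"
      by (simp add: slice_component_def slice_simps Mgr_add)
  qed
qed

lemma graded_cech_slice: "graded_cech (X_ring n) (slice L Lgr e) X n (slice_component Lgr e)"
proof (intro graded_cech.intro cech.intro cech_axioms.intro graded_cech_axioms.intro module_slice
    X_closed_X_ring additive_subgroup_slice_component)
  fix l y j assume "l \<in> {1..n}" "y \<in> slice_component Lgr e j"
  then show "X l \<odot>\<^bsub>slice L Lgr e\<^esub> y \<in> slice_component Lgr e (j + 1)"
    by (simp only: slice_component_def slice_simps smult_X)
qed

text \<open>Both complexes have the same groups \<open>Lgr (p + int (card I), e)\<close>, and on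
  their elements the operations of \<open>L\<close> and of the slice agree.\<close>

lemma koszul_exact_slice:
  assumes "koszul_exact L {1..n} X (\<lambda>I. Lgr (p + int (card I), e))"
  shows "koszul_exact (slice L Lgr e) {1..n} X (\<lambda>I. slice_component Lgr e (p + int (card I)))"
proof (rule koszul_exactI)
  have diff: "koszul_diff (slice L Lgr e) X f J = koszul_diff L X f J"
    if f: "\<And>I. I \<subseteq> {1..n} \<Longrightarrow> f I \<in> Lgr (p + int (card I), e)" and J: "J \<subseteq> {1..n}" for f J
  proof (rule koszul_diff_slice[OF _ J])
    fix l
    have "J - {l} \<subseteq> {1..n}" using J by blast
    from f[OF this] show "f (J - {l}) \<in> slice_carrier e" using Lgr_slice_carrier by blast
  qed
  fix c assume "\<And>I. I \<subseteq> {1..n} \<Longrightarrow> c I \<in> slice_component Lgr e (p + int (card I))"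
    and cocycle: "\<And>J. J \<subseteq> {1..n} \<Longrightarrow> koszul_diff (slice L Lgr e) X c J = \<zero>\<^bsub>slice L Lgr e\<^esub>"
  then have c: "\<And>I. I \<subseteq> {1..n} \<Longrightarrow> c I \<in> Lgr (p + int (card I), e)" by (simp add: slice_component_def)
  have "\<And>J. J \<subseteq> {1..n} \<Longrightarrow> koszul_diff L X c J = \<zero>\<^bsub>L\<^esub>"
    using cocycle diff[OF c] by (simp add: slice_simps)
  from koszul_exactD[OF assms c this] obtain h where h: "\<And>I. I \<subseteq> {1..n} \<Longrightarrow> h I \<in> Lgr (p + int (card
      I), e)"
    "\<And>I. I \<subseteq> {1..n} \<Longrightarrow> c I = koszul_diff L X h I" by blast
  with diff[OF h(1)] show "\<exists>h. (\<forall>I\<subseteq>{1..n}. h I \<in> slice_component Lgr e (p + int (card I))) \<and>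
      (\<forall>I\<subseteq>{1..n}. c I = koszul_diff (slice L Lgr e) X h I)"
    by (intro exI[of _ h]) (simp add: slice_component_def)
qed

theorem a_star_slice_le:
  obtains k :: nat where "\<And>e. a_star n (slice L Lgr e) (slice_component Lgr e) \<le>
    ereal (real_of_int (dmax * e + int k))"
proof -
  obtain k where k: "\<And>p e. p > dmax * e + int k \<Longrightarrow>
    koszul_exact L {1..n} X (\<lambda>I. Lgr (p + int (card I), e))"
    by (rule koszul_exact_high_degree) (rule that)
  have trivial: "local_cohomology_component n (slice L Lgr e) (slice_component Lgr e) i j =
      {\<one>\<^bsub>local_cohomology n (slice L Lgr e) i\<^esub>}" if j: "j > dmax * e + int k" for e i j
  proof -
    interpret G: graded_cech "X_ring n" "slice L Lgr e" X n "slice_component Lgr e"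
      by (rule graded_cech_slice)
    have "koszul_exact (slice L Lgr e) {1..n} (\<lambda>l. X l [^]\<^bsub>X_ring n\<^esub> s)
        (\<lambda>I. slice_component Lgr e (j + int s * int (card I)))" if "s > 0" for s :: nat
    \<comment> \<open>The case of equal exponents; the sum of the exponents over \<open>I\<close> is
      then \<open>s\<close> times \<open>card I\<close>. All degrees above the bound for this
      \<open>e\<close> are covered by \<open>k\<close>, including the one-step shifts in the
      induction on exponents.\<close>
    proof -
      have "koszul_exact (slice L Lgr e) {1..n} (\<lambda>l. X l [^]\<^bsub>X_ring n\<^esub> s)
          (\<lambda>I. slice_component Lgr e (j + (\<Sum>l\<in>I. int s)))"
        by (rule G.koszul_exact_powers[where s = "\<lambda>_. s"])
          (use X_closed_X_ring G.Mgr G.x_graded koszul_exact_slice[OF k] that j in auto)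
      then show ?thesis by (simp add: mult.commute)
    qed
    from G.cech_cohomology_component_trivial[OF this, of i] show ?thesis
      unfolding local_cohomology_component_def local_cohomology_def X_def[abs_def] .
  qed
  have "a_invariant n (slice L Lgr e) (slice_component Lgr e) i \<le> ereal (real_of_int (dmax * e +
      int k))" for e i
    unfolding a_invariant_def
  proof (rule Sup_least)
    fix z assume "z \<in> {ereal (real_of_int j) | j.
      local_cohomology_component n (slice L Lgr e) (slice_component Lgr e) i j \<noteq>
        {\<one>\<^bsub>local_cohomology n (slice L Lgr e) i\<^esub>}}"
    then obtain j where "z = ereal (real_of_int j)" "j \<le> dmax * e + int k"
      using trivial by (force simp: not_less)
    then show "z \<le> ereal (real_of_int (dmax * e + int k))"
      by (simp only: ereal_less_eq of_int_le_iff)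
  qed
  then have "a_star n (slice L Lgr e) (slice_component Lgr e) \<le> ereal (real_of_int (dmax * e + int
      k))" for e
    unfolding a_star_def by (intro SUP_least)
  then show ?thesis by (rule that)
qed

end

theorem theorem15:
  fixes n r :: nat
    and d :: "nat \<Rightarrow> nat"
    and L :: "('k::field xypoly, 'm) module"
    and Lgr :: "int \<times> int \<Rightarrow> 'm set"
  assumes "r \<ge> 1"
    and "graded_module (XY_ring n r) (XY_component n r d) L Lgr"
    and "finitely_generated (XY_ring n r) L"
  shows "\<exists>\<alpha>::int. \<forall>e::int.
    a_star n (slice L Lgr e) (slice_component Lgr e)
      \<le> ereal (real_of_int (int (Max (d ` {1..r})) * e + \<alpha>))"
proof -
  have "Module.module (XY_ring n r) L" using assms(2) by (simp add: graded_module_def)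
  then interpret bigraded_module n r d L Lgr
    by (intro bigraded_module.intro graded_over.intro graded_over_axioms.intro
        bigraded_module_axioms.intro assms)
  \<comment> \<open>The witness for \<alpha> is the index \<open>k\<close> at which the chain of
    bounded cocycles is stationary.\<close>
  show ?thesis using a_star_slice_le unfolding dmax_def by metis
qed

end
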